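(* Let $(\mu,\nu)\in\mathcal{M}_+^2$ and let $\mathcal{K}(\mu,\nu)$ be the generalized Kellerer transport plan from $\mu$ to $\nu$. Then $$\mathrm{Ent}(\mathcal{K}(\mu,\nu)|\mu\otimes\nu)=\min_{\pi\in\mathfrak{C}(\mu,\nu)}\mathrm{Ent}(\pi|\mu\otimes\nu)$$ (as an identity in $]-\infty,+\infty]$).
   Context: Notation. $\mathcal{M}_+(E)$ and $\mathcal{M}_+^\sigma(E)$ are the finite, resp. $\sigma$-finite, positive Borel measures on $E$; $\mathcal{M}_+^2=\{(\mu,\nu)\in\mathcal{M}_+(\mathbb{R})^2:\mu(\mathbb{R})=\nu(\mathbb{R})>0\}$. $\gamma|_A$ is the restriction of $\gamma$ to $A$; $\gamma(x)=\gamma(\{x\})$; $F_\gamma^+(t)=\gamma((-\infty,t])$, $F_\gamma^-(t)=\gamma((-\infty,t))$; $\{F_\mu^+>F_\nu^+\}=\{x: F_\mu^+(x)>F_\nu^+(x)\}$, etc. $\mathrm{Marg}(\gamma_1,\gamma_2)$ is the set of $\pi\in\mathcal{M}_+(\mathbb{R}^2)$ with marginals $\gamma_1,\gamma_2$. $\mathrm F=\{(x,y)\in\mathbb{R}^2:x\le y\}$. $\mathrm{Ent}(\gamma_1|\gamma_2)=\int\log\big(\frac{d\gamma_1}{d\gamma_2}\big)\frac{d\gamma_1}{d\gamma_2}\,d\gamma_2$ if $\gamma_1\ll\gamma_2$, and $+\infty$ otherwise. A set $\Gamma\subset\mathbb{R}^2$ is cyclically monotone if for all $n\ge1$ and $(x_1,y_1),\dots,(x_n,y_n)\in\Gamma$,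 $\sum_{i=1}^n|y_i-x_i|\le\sum_{i=1}^n|y_{i+1}-x_i|$ ($y_{n+1}=y_1$); $\mathfrak{C}(\mu,\nu)$ is the set of $\pi\in\mathrm{Marg}(\mu,\nu)$ concentrated on a cyclically monotone set. Components of the real line. $E^+=\{F_\mu^+>F_\nu^+\}\cap\{F_\mu^->F_\nu^-\}$, $E^-=\{F_\mu^+<F_\nu^+\}\cap\{F_\mu^-<F_\nu^-\}$ (both open), $E^==\mathbb{R}\setminus(E^+\cup E^-)$. Let $(]a_k^+,b_k^+[)_{k\in\mathcal{K}^+}$ and $(]a_k^-,b_k^-[)_{k\in\mathcal{K}^-}$ be the countable families of connected components of $E^+$ and $E^-$ (endpoints may be infinite). $B$ is the set of all finite endpoints $a_k^\pm,b_k^\pm$. Components of the marginals (terms at infinite endpoints are zero). For $k\in\mathcal{K}^+$: $\mu_k^+=(F_\mu^+(a_k^+)-F_\nu^+(a_k^+))\delta_{a_k^+}+\mu|_{]a_k^+,b_k^+[}$ and $\nu_k^+=\nu|_{]a_k^+,b_k^+[}+(F_\mu^-(b_k^+)-F_\nu^-(b_k^+))\delta_{b_k^+}$. For $k\in\mathcal{K}^-$: $\mu_k^-=\mu|_{]a_k^-,b_k^-[}+(F_\nu^-(b_k^-)-F_\mu^-(b_k^-))\delta_{b_k^-}$ and $\nu_k^-=(F_\nu^+(a_k^-)-F_\mu^+(a_k^-))\delta_{a_k^-}+\nu|_{]a_k^-,b_k^-[}$. With $\mu^\pm=\sum_{k\in\mathcal{K}^\pm}\mu_k^\pm$: $\mu^==\mu|_{B^c\cap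 E^=}+\sum_{x\in B}(\mu(x)-\mu^+(x)-\mu^-(x))\delta_x$. Kellerer transport plans. For each $k\in\mathcal{K}^+$ there is exactly one measure in $\mathrm{Marg}(\mu_k^+,\nu_k^+)$ of the form $(\eta_1\otimes\eta_2)|_{\mathrm F}$ with $\eta_1,\eta_2\in\mathcal{M}_+^\sigma(\mathbb{R})$ (theorem of Kellerer); it is denoted $\mathcal{K}_{\mathrm F}(\mu_k^+,\nu_k^+)$. For $k\in\mathcal{K}^-$, likewise $\mathcal{K}_{\mathrm F}(\nu_k^-,\mu_k^-)$ exists and is unique, and $\mathcal{K}_{\tilde{\mathrm F}}(\mu_k^-,\nu_k^-):=i_\#\mathcal{K}_{\mathrm F}(\nu_k^-,\mu_k^-)$ with $i(x,y)=(y,x)$. The generalized Kellerer transport plan is $$\mathcal{K}(\mu,\nu)=\sum_{k\in\mathcal{K}^+}\mathcal{K}_{\mathrm F}(\mu_k^+,\nu_k^+)+\sum_{k\in\mathcal{K}^-}\mathcal{K}_{\tilde{\mathrm F}}(\mu_k^-,\nu_k^-)+(\mathrm{id},\mathrm{id})_\#\mu^=,$$ and it belongs to $\mathfrak{C}(\mu,\nu)$. *)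

theory Defs
  imports "HOL-Probability.Probability"
begin

definition add_measure ::
  "'a::topological_space measure \<Rightarrow> 'a measure \<Rightarrow> 'a measure" (infixl "\<oplus>\<^sub>m" 65) where
  "M \<oplus>\<^sub>m N = measure_of UNIV (sets borel) (\<lambda>A. emeasure M A + emeasure N A)"

text \<open>The sum of a family of measures; the integral against the counting measure is the
  (unordered) sum in \<open>[0, \<infinity>]\<close>.\<close>

definition sum_measure ::
  "'i set \<Rightarrow> ('i \<Rightarrow> 'a::topological_space measure) \<Rightarrow> 'a measure" where
  "sum_measure I M =
     measure_of UNIV (sets borel) (\<lambda>A. \<integral>\<^sup>+i. emeasure (M i) A \<partial>count_space I)"

text \<open>The restriction \<open>\<gamma>|\<^sub>A\<close>, as a measure on the whole space.\<close>

definition restr :: "'a measure \<Rightarrow> 'a set \<Rightarrow> 'a measure" where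
  "restr \<gamma> A = density \<gamma> (indicator A)"

lemma sets_add_measure [simp]: "sets (M \<oplus>\<^sub>m N) = sets borel"
  unfolding add_measure_def
  by (metis sets.sigma_sets_eq sets_measure_of space_borel sets.space_closed)

lemma emeasure_add_measure:
  fixes M N :: "'a::topological_space measure"
  assumes "sets M = sets borel" "sets N = sets borel" "A \<in> sets borel"
  shows "emeasure (M \<oplus>\<^sub>m N) A = emeasure M A + emeasure N A"
proof (rule emeasure_measure_of [OF add_measure_def])
  show "countably_additive (sets (M \<oplus>\<^sub>m N)) (\<lambda>A. emeasure M A + emeasure N A)"
  proof (rule countably_additiveI)
    fix B :: "nat \<Rightarrow> 'a set"
    assume B: "range B \<subseteq> sets (M \<oplus>\<^sub>m N)" "disjoint_family B"
    then have "range B \<subseteq> sets M" "range B \<subseteq> sets N" using assms by auto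
    with B show "(\<Sum>i. emeasure M (B i) + emeasure N (B i)) =
        emeasure M (\<Union>i. B i) + emeasure N (\<Union>i. B i)"
      by (simp add: suminf_add [symmetric] suminf_emeasure)
  qed
qed (use assms in \<open>auto simp: positive_def\<close>)

lemma sets_sum_measure [simp]: "sets (sum_measure I M) = sets borel"
  unfolding sum_measure_def
  by (metis sets.sigma_sets_eq sets_measure_of space_borel sets.space_closed)

lemma emeasure_sum_measure:
  fixes M :: "'i \<Rightarrow> 'a::topological_space measure"
  assumes "\<And>i. i \<in> I \<Longrightarrow> sets (M i) = sets borel" "A \<in> sets borel"
  shows "emeasure (sum_measure I M) A = (\<integral>\<^sup>+i. emeasure (M i) A \<partial>count_space I)"
proof (rule emeasure_measure_of [OF sum_measure_def])
  show "countably_additive (sets (sum_measure I M))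
      (\<lambda>A. \<integral>\<^sup>+i. emeasure (M i) A \<partial>count_space I)"
  proof (rule countably_additiveI)
    fix B :: "nat \<Rightarrow> 'a set"
    assume B: "range B \<subseteq> sets (sum_measure I M)" "disjoint_family B"
    have "(\<Sum>j. \<integral>\<^sup>+i. emeasure (M i) (B j) \<partial>count_space I) =
        (\<integral>\<^sup>+i. (\<Sum>j. emeasure (M i) (B j)) \<partial>count_space I)"
      by (simp add: nn_integral_suminf)
    also have "\<dots> = (\<integral>\<^sup>+i. emeasure (M i) (\<Union>j. B j) \<partial>count_space I)"
      using B assms by (intro nn_integral_cong) (auto intro!: suminf_emeasure)
    finally show "(\<Sum>j. \<integral>\<^sup>+i. emeasure (M i) (B j) \<partial>count_space I) =
        (\<integral>\<^sup>+i. emeasure (M i) (\<Union>j. B j) \<partial>count_space I)" .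
  qed
qed (use assms in \<open>auto simp: positive_def\<close>)

text \<open>The integral in \<open>[-\<infinity>, \<infinity>]\<close>, meaningful when the positive or the negative part of \<open>f\<close> is
  integrable.  Note that \<open>ennreal\<close> truncates negative numbers to \<open>0\<close>.\<close>

definition ext_integral :: "'a measure \<Rightarrow> ('a \<Rightarrow> real) \<Rightarrow> ereal" where
  "ext_integral M f =
     enn2ereal (\<integral>\<^sup>+x. ennreal (f x) \<partial>M) - enn2ereal (\<integral>\<^sup>+x. ennreal (- f x) \<partial>M)"

text \<open>When \<open>\<gamma>\<^sub>2\<close> is finite the negative part of the integrand is integrable, since
  \<open>t \<mapsto> t ln t\<close> is bounded below (with \<open>0 ln 0 = 0\<close>).\<close>

definition Ent :: "'a measure \<Rightarrow> 'a measure \<Rightarrow> ereal" where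
  "Ent \<gamma>\<^sub>1 \<gamma>\<^sub>2 =
     (if absolutely_continuous \<gamma>\<^sub>2 \<gamma>\<^sub>1
      then ext_integral \<gamma>\<^sub>2
             (\<lambda>z. ln (enn2real (RN_deriv \<gamma>\<^sub>2 \<gamma>\<^sub>1 z)) * enn2real (RN_deriv \<gamma>\<^sub>2 \<gamma>\<^sub>1 z))
      else \<infinity>)"

definition Marg :: "real measure \<Rightarrow> real measure \<Rightarrow> (real \<times> real) measure set" where
  "Marg \<gamma>\<^sub>1 \<gamma>\<^sub>2 = {\<pi>. finite_measure \<pi> \<and> sets \<pi> = sets borel \<and>
     distr \<pi> borel fst = \<gamma>\<^sub>1 \<and> distr \<pi> borel snd = \<gamma>\<^sub>2}"

definition cyclically_monotone :: "(real \<times> real) set \<Rightarrow> bool" where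
  "cyclically_monotone \<Gamma> \<longleftrightarrow>
     (\<forall>n\<ge>1. \<forall>x y :: nat \<Rightarrow> real. (\<forall>i<n. (x i, y i) \<in> \<Gamma>) \<longrightarrow>
        (\<Sum>i<n. \<bar>y i - x i\<bar>) \<le> (\<Sum>i<n. \<bar>y (Suc i mod n) - x i\<bar>))"

definition cyc_mono_plans :: "real measure \<Rightarrow> real measure \<Rightarrow> (real \<times> real) measure set" where
  "cyc_mono_plans \<mu> \<nu> =
     {\<pi> \<in> Marg \<mu> \<nu>. \<exists>\<Gamma>. cyclically_monotone \<Gamma> \<and> (AE z in \<pi>. z \<in> \<Gamma>)}"

text \<open>\<open>F\<^sup>+\<close> is the library's \<open>cdf\<close>; the following is \<open>F\<^sup>-\<close>.\<close>

definition cdf_left :: "real measure \<Rightarrow> real \<Rightarrow> real" where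
  "cdf_left M t = measure M {..<t}"

definition E_plus :: "real measure \<Rightarrow> real measure \<Rightarrow> real set" where
  "E_plus \<mu> \<nu> = {x. cdf \<mu> x > cdf \<nu> x} \<inter> {x. cdf_left \<mu> x > cdf_left \<nu> x}"

definition E_minus :: "real measure \<Rightarrow> real measure \<Rightarrow> real set" where
  "E_minus \<mu> \<nu> = {x. cdf \<mu> x < cdf \<nu> x} \<inter> {x. cdf_left \<mu> x < cdf_left \<nu> x}"

definition E_eq :: "real measure \<Rightarrow> real measure \<Rightarrow> real set" where
  "E_eq \<mu> \<nu> = UNIV - (E_plus \<mu> \<nu> \<union> E_minus \<mu> \<nu>)"

text \<open>The families \<open>]a\<^sub>k, b\<^sub>k[\<close> are indexed by the connected components themselves: the index \<open>k\<close>
  is the component \<open>C = ]lep C, rep C[\<close>, with possibly infinite left and right endpoints.\<close>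

definition lep :: "real set \<Rightarrow> ereal" where
  "lep C = Inf (ereal ` C)"

definition rep :: "real set \<Rightarrow> ereal" where
  "rep C = Sup (ereal ` C)"

definition endpts :: "real measure \<Rightarrow> real measure \<Rightarrow> real set" where
  "endpts \<mu> \<nu> = {x. \<exists>C \<in> components (E_plus \<mu> \<nu>) \<union> components (E_minus \<mu> \<nu>).
     ereal x = lep C \<or> ereal x = rep C}"

text \<open>The measure \<open>w(e) \<delta>\<^sub>e\<close>, which is zero for an infinite endpoint \<open>e\<close>.\<close>

definition atom_at :: "ereal \<Rightarrow> (real \<Rightarrow> real) \<Rightarrow> real measure" where
  "atom_at e w =
     (if \<bar>e\<bar> = \<infinity> then null_measure borel
      else scale_measure (ennreal (w (real_of_ereal e))) (return borel (real_of_ereal e)))"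

definition mu_plus :: "real measure \<Rightarrow> real measure \<Rightarrow> real set \<Rightarrow> real measure" where
  "mu_plus \<mu> \<nu> C = atom_at (lep C) (\<lambda>a. cdf \<mu> a - cdf \<nu> a) \<oplus>\<^sub>m restr \<mu> C"

definition nu_plus :: "real measure \<Rightarrow> real measure \<Rightarrow> real set \<Rightarrow> real measure" where
  "nu_plus \<mu> \<nu> C = restr \<nu> C \<oplus>\<^sub>m atom_at (rep C) (\<lambda>b. cdf_left \<mu> b - cdf_left \<nu> b)"

definition mu_minus :: "real measure \<Rightarrow> real measure \<Rightarrow> real set \<Rightarrow> real measure" where
  "mu_minus \<mu> \<nu> C = restr \<mu> C \<oplus>\<^sub>m atom_at (rep C) (\<lambda>b. cdf_left \<nu> b - cdf_left \<mu> b)"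

definition nu_minus :: "real measure \<Rightarrow> real measure \<Rightarrow> real set \<Rightarrow> real measure" where
  "nu_minus \<mu> \<nu> C = atom_at (lep C) (\<lambda>a. cdf \<nu> a - cdf \<mu> a) \<oplus>\<^sub>m restr \<nu> C"

definition mu_plus_total :: "real measure \<Rightarrow> real measure \<Rightarrow> real measure" where
  "mu_plus_total \<mu> \<nu> = sum_measure (components (E_plus \<mu> \<nu>)) (mu_plus \<mu> \<nu>)"

definition mu_minus_total :: "real measure \<Rightarrow> real measure \<Rightarrow> real measure" where
  "mu_minus_total \<mu> \<nu> = sum_measure (components (E_minus \<mu> \<nu>)) (mu_minus \<mu> \<nu>)"

definition mu_eq :: "real measure \<Rightarrow> real measure \<Rightarrow> real measure" where
  "mu_eq \<mu> \<nu> =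
     restr \<mu> (- endpts \<mu> \<nu> \<inter> E_eq \<mu> \<nu>) \<oplus>\<^sub>m
     sum_measure (endpts \<mu> \<nu>) (\<lambda>x. scale_measure
       (ennreal (measure \<mu> {x} - measure (mu_plus_total \<mu> \<nu>) {x}
                 - measure (mu_minus_total \<mu> \<nu>) {x}))
       (return borel x))"

definition F_set :: "(real \<times> real) set" where
  "F_set = {(x, y). x \<le> y}"

definition kellerer_F :: "real measure \<Rightarrow> real measure \<Rightarrow> (real \<times> real) measure" where
  "kellerer_F \<gamma>\<^sub>1 \<gamma>\<^sub>2 = (THE \<pi>. \<pi> \<in> Marg \<gamma>\<^sub>1 \<gamma>\<^sub>2 \<and>
     (\<exists>\<eta>\<^sub>1 \<eta>\<^sub>2 :: real measure.
        sigma_finite_measure \<eta>\<^sub>1 \<and> sets \<eta>\<^sub>1 = sets borel \<and>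
        sigma_finite_measure \<eta>\<^sub>2 \<and> sets \<eta>\<^sub>2 = sets borel \<and>
        \<pi> = restr (\<eta>\<^sub>1 \<Otimes>\<^sub>M \<eta>\<^sub>2) F_set))"

definition kellerer_F_tilde :: "real measure \<Rightarrow> real measure \<Rightarrow> (real \<times> real) measure" where
  "kellerer_F_tilde \<gamma>\<^sub>1 \<gamma>\<^sub>2 = distr (kellerer_F \<gamma>\<^sub>2 \<gamma>\<^sub>1) borel prod.swap"

definition kellerer_plan :: "real measure \<Rightarrow> real measure \<Rightarrow> (real \<times> real) measure" where
  "kellerer_plan \<mu> \<nu> =
     sum_measure (components (E_plus \<mu> \<nu>))
       (\<lambda>C. kellerer_F (mu_plus \<mu> \<nu> C) (nu_plus \<mu> \<nu> C)) \<oplus>\<^sub>m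
     sum_measure (components (E_minus \<mu> \<nu>))
       (\<lambda>C. kellerer_F_tilde (mu_minus \<mu> \<nu> C) (nu_minus \<mu> \<nu> C)) \<oplus>\<^sub>m
     distr (mu_eq \<mu> \<nu>) borel (\<lambda>x. (x, x))"

end

theory Submission
  imports Defs
begin

text \<open>On the line, a plan is cyclically monotone for \<open>\<bar>y - x\<bar>\<close> iff no mass crosses a point in both
  directions.  Such a plan is forced to split: it lives on the disjoint regions attached to the
  components of \<open>E\<^sup>+\<close>, \<open>E\<^sup>-\<close> and on the diagonal over \<open>E\<^sup>=\<close>, and its restriction to each region has
  the marginals \<open>\<mu>\<^sub>k\<^sup>\<plusminus>\<close>, \<open>\<nu>\<^sub>k\<^sup>\<plusminus>\<close>, whichever the plan.

  On a component, let \<open>D(t)\<close> be the mass crossing \<open>t\<close>.  If \<open>(\<eta>\<^sub>1 \<otimes> \<eta>\<^sub>2)|\<^sub>F\<close> has marginals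
  \<open>\<gamma>\<^sub>1\<close>, \<open>\<gamma>\<^sub>2\<close>, then \<open>A(t) = \<eta>\<^sub>1(]-\<infinity>, t[)\<close> and \<open>B(t) = \<eta>\<^sub>2([t, \<infinity>[)\<close> satisfy \<open>A B = D\<close> and
  \<open>d\<gamma>\<^sub>1 = B dA\<close>, so \<open>A\<close> is the product integral of \<open>d\<gamma>\<^sub>1 / D\<close>; conversely this \<open>A\<close> and \<open>B = D / A\<close>
  produce the Kellerer plan, whose density with respect to \<open>\<mu> \<otimes> \<nu>\<close> is a product \<open>G(x) H(y)\<close> on \<open>F\<close>.

  For a competitor with density \<open>f\<close>, Young's inequality \<open>f ln f \<ge> f w + f - exp w\<close> is applied with sums
  \<open>w\<close> of truncations of \<open>ln G(x)\<close> and \<open>ln H(y)\<close>.  The integral of \<open>f w\<close> then depends on the marginals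
  only, and removing the truncation gives the entropy of the Kellerer plan as a lower bound.\<close>

text \<open>The equations for \<open>A\<close> and \<open>B\<close> are Fubini's theorem: the pairs
  with x < t \<le> y fill a rectangle of mass \<open>A(t) B(t)\<close>, and the slice of F over x
  has mass \<open>B(x)\<close>; eliminating \<open>B\<close> leaves dA / A =
  d\<open>\<gamma>\<^sub>1\<close> / D. Two obstacles shape the construction. At an atom A has to
  jump by the factor 1 + atom / D rather than exp (atom / D), and D may tend to 0 at the ends of a
  component, so the product integral is started at an interior point and the ends are reached by
  limits. The choice of that point is the freedom to scale A by c and B by 1 / c.

  Existence and uniqueness of Kellerer plans are proved here because \<open>kellerer_F\<close> is a
  definite description, which says nothing before both are known.

  The formulas for the component marginals involve atoms at endpoints that several components may
  share. Identities about them are therefore read off from a noncrossing plan, either a competitor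
  or the quantile coupling.\<close>

lemma sets_restr [simp]: "sets (restr \<gamma> A) = sets \<gamma>"
  by (simp add: restr_def)

lemma space_restr [simp]: "space (restr \<gamma> A) = space \<gamma>"
  by (simp add: restr_def)

lemma emeasure_restr:
  "A \<in> sets \<gamma> \<Longrightarrow> X \<in> sets \<gamma> \<Longrightarrow> emeasure (restr \<gamma> A) X = emeasure \<gamma> (A \<inter> X)"
  unfolding restr_def by (rule emeasure_restricted)

lemma AE_restr_iff:
  "A \<in> sets \<gamma> \<Longrightarrow> (AE x in restr \<gamma> A. P x) \<longleftrightarrow> (AE x in \<gamma>. x \<in> A \<longrightarrow> P x)"
  unfolding restr_def by (subst AE_density) (auto simp: indicator_def)

lemma finite_measure_restr:
  "finite_measure \<gamma> \<Longrightarrow> A \<in> sets \<gamma> \<Longrightarrow> finite_measure (restr \<gamma> A)"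
  by (intro finite_measureI) (auto simp: emeasure_restr finite_measure.emeasure_finite)

lemma sets_atom_at [simp]: "sets (atom_at e w) = sets borel"
  by (simp add: atom_at_def)

lemma emeasure_atom_at:
  "X \<in> sets borel \<Longrightarrow> emeasure (atom_at e w) X =
     (if \<bar>e\<bar> \<noteq> \<infinity> \<and> real_of_ereal e \<in> X then ennreal (w (real_of_ereal e)) else 0)"
  by (auto simp: atom_at_def)

section \<open>Noncrossing sets\<close>

text \<open>A point strictly between \<open>max x y'\<close> and \<open>min y x'\<close> is passed
  rightwards by (x, y) and leftwards by (x', y'). The form with \<open>max\<close> and
  \<open>min\<close> hides the quantifier over that point, and its negation is a closed condition on
  the two pairs.\<close>

definition noncrossing :: "(real \<times> real) set \<Rightarrow> bool" where
  "noncrossing \<Gamma> \<longleftrightarrow> (\<forall>(x, y)\<in>\<Gamma>. \<forall>(x', y')\<in>\<Gamma>. \<not> max x y' < min y x')"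

lemma noncrossingI:
  "(\<And>x y x' y'. (x, y) \<in> \<Gamma> \<Longrightarrow> (x', y') \<in> \<Gamma> \<Longrightarrow> min y x' \<le> max x y') \<Longrightarrow> noncrossing \<Gamma>"
  unfolding noncrossing_def not_less by clarify

lemma noncrossingD:
  "noncrossing \<Gamma> \<Longrightarrow> (x, y) \<in> \<Gamma> \<Longrightarrow> (x', y') \<in> \<Gamma> \<Longrightarrow> min y x' \<le> max x y'"
  unfolding noncrossing_def by (force simp: not_less)

text \<open>Cycles of length two suffice: exchanging the targets of two arrows that overlap in
  opposite directions shortens the total distance by twice the length of the overlap.\<close>

lemma cyclically_monotone_imp_noncrossing:
  assumes "cyclically_monotone \<Gamma>"
  shows "noncrossing \<Gamma>"
  unfolding noncrossing_def
proof clarify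
  fix x y x' y' assume z: "(x, y) \<in> \<Gamma>" "(x', y') \<in> \<Gamma>" and less: "max x y' < min y x'"
  have "(\<Sum>i<2::nat. \<bar>(if i = 0 then y else y') - (if i = 0 then x else x')\<bar>)
      \<le> (\<Sum>i<2::nat. \<bar>(if Suc i mod 2 = 0 then y else y') - (if i = 0 then x else x')\<bar>)"
    using assms[unfolded cyclically_monotone_def, rule_format, of 2
      "\<lambda>i. if i = 0 then x else x'" "\<lambda>i. if i = 0 then y else y'"] z by auto
  then have "\<bar>y - x\<bar> + \<bar>y' - x'\<bar> \<le> \<bar>y' - x\<bar> + \<bar>y - x'\<bar>"
    by (simp add: numeral_2_eq_2)
  then show False using less by (auto simp: abs_if max_def min_def split: if_splits)
qed

text \<open>The distance \<open>\<bar>y - x\<bar>\<close> is the integral over \<open>t\<close> of \<open>\<bar>1\<^bsub>t < x\<^esub> - 1\<^bsub>t < y\<^esub>\<bar>\<close>, and in a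
  noncrossing set all the differences \<open>1\<^bsub>t < x\<^esub> - 1\<^bsub>t < y\<^esub>\<close> have the same sign for fixed \<open>t\<close>.\<close>

lemma noncrossing_imp_cyclically_monotone:
  assumes nc: "noncrossing \<Gamma>"
  shows "cyclically_monotone \<Gamma>"
  unfolding cyclically_monotone_def
proof (intro allI impI)
  fix n :: nat and x y :: "nat \<Rightarrow> real"
  assume n: "1 \<le> n" and G: "\<forall>i<n. (x i, y i) \<in> \<Gamma>"
  define s :: "real \<Rightarrow> real \<Rightarrow> real" where "s a t = indicator {..<a} t" for a t
  have s: "\<bar>s a t - s b t\<bar> = indicator {min a b..<max a b} t" for a b t
    by (auto simp: s_def indicator_def)
  have int: "integrable lborel (\<lambda>t. \<bar>s a t - s b t\<bar>)" for a b
    unfolding s by (rule integrable_real_indicator) (auto simp: max_def min_def)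
  have eq: "\<bar>b - a\<bar> = (\<integral>t. \<bar>s a t - s b t\<bar> \<partial>lborel)" for a b
    unfolding s by (auto simp: max_def min_def)
  have cyc: "(\<Sum>i<n. f (Suc i mod n)) = (\<Sum>i<n. f i)" for f :: "nat \<Rightarrow> real"
  proof -
    obtain m where m: "n = Suc m" using n by (cases n) auto
    have "(\<Sum>i<Suc m. f (Suc i mod Suc m)) = (\<Sum>i<m. f (Suc i mod Suc m)) + f 0"
      by simp
    also have "(\<Sum>i<m. f (Suc i mod Suc m)) = (\<Sum>i<m. f (Suc i))"
      by (rule sum.cong) auto
    also have "\<dots> + f 0 = (\<Sum>i<Suc m. f i)"
      by (simp only: sum.lessThan_Suc_shift add.commute)
    finally show ?thesis by (simp only: m)
  qed
  have le: "(\<Sum>i<n. \<bar>s (x i) t - s (y i) t\<bar>) \<le> (\<Sum>i<n. \<bar>s (x i) t - s (y (Suc i mod n)) t\<bar>)" for t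
  proof -
    have "(\<forall>i<n. s (x i) t \<le> s (y i) t) \<or> (\<forall>i<n. s (y i) t \<le> s (x i) t)"
    proof (rule ccontr)
      assume "\<not> ?thesis"
      then obtain i j where ij: "i < n" "j < n" "s (y i) t < s (x i) t" "s (x j) t < s (y j) t"
        by (auto simp: not_le)
      then have "max (x j) (y i) < min (y j) (x i)"
        by (auto simp: s_def indicator_def split: if_splits)
      moreover have "min (y j) (x i) \<le> max (x j) (y i)"
        by (rule noncrossingD[OF nc]) (use G ij(1,2) in auto)
      ultimately show False by linarith
    qed
    then have "(\<Sum>i<n. \<bar>s (x i) t - s (y i) t\<bar>) = \<bar>\<Sum>i<n. s (x i) t - s (y i) t\<bar>"
    proof
      assume "\<forall>i<n. s (x i) t \<le> s (y i) t"
      then have "(\<Sum>i<n. \<bar>s (x i) t - s (y i) t\<bar>) = (\<Sum>i<n. - (s (x i) t - s (y i) t))"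
        by (intro sum.cong) auto
      also have "\<dots> = - (\<Sum>i<n. s (x i) t - s (y i) t)" by (simp only: sum_negf)
      finally show ?thesis by (smt (verit) sum_nonneg abs_ge_zero)
    next
      assume "\<forall>i<n. s (y i) t \<le> s (x i) t"
      then have "(\<Sum>i<n. \<bar>s (x i) t - s (y i) t\<bar>) = (\<Sum>i<n. s (x i) t - s (y i) t)"
        by (intro sum.cong) auto
      then show ?thesis by (smt (verit) sum_nonneg abs_ge_zero)
    qed
    \<comment> \<open>The signed sum does not notice the cyclic shift of the targets; for the
      shifted pairs the triangle inequality is enough.\<close>
    also have "(\<Sum>i<n. s (x i) t - s (y i) t) = (\<Sum>i<n. s (x i) t - s (y (Suc i mod n)) t)"
      unfolding sum_subtractf cyc[of "\<lambda>i. s (y i) t"] ..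
    also have "\<bar>\<dots>\<bar> \<le> (\<Sum>i<n. \<bar>s (x i) t - s (y (Suc i mod n)) t\<bar>)" by (rule sum_abs)
    finally show ?thesis .
  qed
  have "(\<Sum>i<n. \<bar>y i - x i\<bar>) = (\<Sum>i<n. \<integral>t. \<bar>s (x i) t - s (y i) t\<bar> \<partial>lborel)"
    by (rule sum.cong[OF refl eq])
  also have "\<dots> = (\<integral>t. (\<Sum>i<n. \<bar>s (x i) t - s (y i) t\<bar>) \<partial>lborel)"
    by (rule Bochner_Integration.integral_sum[symmetric]) (rule int)
  also have "\<dots> \<le> (\<integral>t. (\<Sum>i<n. \<bar>s (x i) t - s (y (Suc i mod n)) t\<bar>) \<partial>lborel)"
    by (intro integral_mono Bochner_Integration.integrable_sum int le)
  also have "\<dots> = (\<Sum>i<n. \<integral>t. \<bar>s (x i) t - s (y (Suc i mod n)) t\<bar> \<partial>lborel)"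
    by (rule Bochner_Integration.integral_sum) (rule int)
  also have "\<dots> = (\<Sum>i<n. \<bar>y (Suc i mod n) - x i\<bar>)"
    by (rule sum.cong[OF refl eq[symmetric]])
  finally show "(\<Sum>i<n. \<bar>y i - x i\<bar>) \<le> (\<Sum>i<n. \<bar>y (Suc i mod n) - x i\<bar>)" .
qed

section \<open>Components\<close>

text \<open>Openness keeps a component away from its infimum and supremum, finite or not, and
  connectedness fills everything between them.\<close>

lemma component_eq_einterval:
  assumes "open S" and C: "C \<in> components S"
  shows "C = {x. lep C < ereal x \<and> ereal x < rep C}" and "C \<noteq> {}" and "lep C < rep C"
proof -
  have op: "open C" using assms by (rule open_components)
  have conn: "is_interval C" using C in_components_connected is_interval_connected_1 by blast
  show ne: "C \<noteq> {}" using C by (rule in_components_nonempty)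
  show eq: "C = {x. lep C < ereal x \<and> ereal x < rep C}"
  proof (intro set_eqI iffI)
    fix x assume x: "x \<in> C"
    then obtain e where e: "e > 0" "ball x e \<subseteq> C" using op open_contains_ball by blast
    then have "x - e/2 \<in> C" "x + e/2 \<in> C" by (auto simp: dist_real_def subset_iff)
    then have "lep C \<le> ereal (x - e/2)" "ereal (x + e/2) \<le> rep C"
      by (auto simp: lep_def rep_def intro: Inf_lower Sup_upper)
    moreover have "ereal (x - e/2) < ereal x" "ereal x < ereal (x + e/2)" using e(1) by auto
    ultimately have "lep C < ereal x" "ereal x < rep C"
      using le_less_trans less_le_trans by blast+
    then show "x \<in> {x. lep C < ereal x \<and> ereal x < rep C}" by simp
  next
    fix x assume "x \<in> {x. lep C < ereal x \<and> ereal x < rep C}"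
    then obtain u v where "u \<in> C" "u < x" "v \<in> C" "x < v"
      by (auto simp: lep_def rep_def Inf_less_iff less_Sup_iff)
    then show "x \<in> C" using conn mem_is_interval_1_I[of C u v x] by auto
  qed
  show "lep C < rep C" using ne eq by (metis (mono_tags, lifting) empty_Collect_eq less_trans)
qed

text \<open>If the endpoint lay in \<open>S\<close>, a ball around it inside \<open>S\<close> would
  meet \<open>C\<close> and, being connected, be swallowed by \<open>C\<close> through
  maximality.\<close>

lemma component_endpoint_notin:
  assumes "open S" "C \<in> components S" "ereal x = lep C \<or> ereal x = rep C"
  shows "x \<notin> S"
proof
  assume x: "x \<in> S"
  then obtain e where e: "e > 0" "ball x e \<subseteq> S" using assms(1) open_contains_ball by blast
  note eq = component_eq_einterval[OF assms(1,2)]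
  have "C \<inter> ball x e \<noteq> {}"
  proof -
    have "\<exists>y. y \<in> C \<and> \<bar>y - x\<bar> < e"
      using assms(3)
    proof
      assume x: "ereal x = lep C"
      have "ereal x < min (rep C) (ereal (x + e))"
        using eq(3)[folded x] e(1) by auto
      then obtain y where y: "ereal x < ereal y" "ereal y < min (rep C) (ereal (x + e))"
        using ereal_dense2 by blast
      then have "y \<in> C" by (subst eq(1)) (simp add: x[symmetric])
      then show ?thesis using y by (intro exI[of _ y]) auto
    next
      assume x: "ereal x = rep C"
      have "max (lep C) (ereal (x - e)) < ereal x"
        using eq(3)[folded x] e(1) by auto
      then obtain y where y: "max (lep C) (ereal (x - e)) < ereal y" "ereal y < ereal x"
        using ereal_dense2 by blast
      then have "y \<in> C" by (subst eq(1)) (simp add: x[symmetric])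
      then show ?thesis using y by (intro exI[of _ y]) auto
    qed
    then show ?thesis by (auto simp: dist_real_def abs_minus_commute)
  qed
  then have "ball x e \<subseteq> C"
    using components_maximal[OF assms(2) _ e(2)] by (simp add: connected_ball Int_commute)
  then have "x \<in> C" using e(1) by auto
  then have "lep C < ereal x" "ereal x < rep C" by (subst (asm) eq(1), simp)+
  then show False using assms(3) by auto
qed

text \<open>For a pair x < y moved by a plan this finds the component whose region contains it. Both
  x and y may be ends of that component, hence the weak inequalities.\<close>

lemma interval_subset_component:
  fixes x y :: real
  assumes "x < y" "{x<..<y} \<subseteq> S"
  obtains C where "C \<in> components S" "{x<..<y} \<subseteq> C" "lep C \<le> ereal x" "ereal y \<le> rep C"
proof -
  obtain C where C: "C \<in> components S" "{x<..<y} \<subseteq> C"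
    using exists_component_superset[of "{x<..<y}" S] assms by (metis connected_Ioo greaterThanLessThan_empty_iff not_le subset_empty)
  have "lep C \<le> ereal x"
  proof (rule ccontr)
    assume "\<not> ?thesis"
    then have "ereal x < min (lep C) (ereal y)" using assms(1) by auto
    then obtain z where z: "ereal x < ereal z" "ereal z < min (lep C) (ereal y)"
      using ereal_dense2 by blast
    then have "z \<in> C" using C(2) by auto
    then have "lep C \<le> ereal z" unfolding lep_def by (auto intro: Inf_lower)
    then show False using z by auto
  qed
  moreover have "ereal y \<le> rep C"
  proof (rule ccontr)
    assume "\<not> ?thesis"
    then have "max (rep C) (ereal x) < ereal y" using assms(1) by auto
    then obtain z where z: "max (rep C) (ereal x) < ereal z" "ereal z < ereal y"
      using ereal_dense2 by blast
    then have "z \<in> C" using C(2) by auto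
    then have "ereal z \<le> rep C" unfolding rep_def by (auto intro: Sup_upper)
    then show False using z by auto
  qed
  ultimately show ?thesis using C that by blast
qed

lemma countable_components:
  fixes S :: "real set"
  assumes "open S"
  shows "countable (components S)"
  by (rule countable_disjoint_open_subsets)
     (use assms pairwise_disjoint_components[of S] in \<open>auto simp: open_components disjnt_def pairwise_def\<close>)

lemma components_disjoint:
  "C \<in> components S \<Longrightarrow> C' \<in> components S \<Longrightarrow> x \<in> C \<Longrightarrow> x \<in> C' \<Longrightarrow> C = C'"
  using components_nonoverlap by blast

section \<open>One-sided distribution functions and openness of \<open>E_plus\<close>\<close>

lemma cdf_left_le_cdf:
  assumes "finite_borel_measure M"
  shows "cdf_left M x \<le> cdf M x"
proof -
  interpret finite_borel_measure M by fact
  show ?thesis unfolding cdf_left_def cdf_def by (intro finite_measure_mono) auto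
qed

lemma cdf_le_cdf_left:
  assumes "finite_borel_measure M" "x < y"
  shows "cdf M x \<le> cdf_left M y"
proof -
  interpret finite_borel_measure M by fact
  show ?thesis unfolding cdf_left_def cdf_def using assms(2) by (intro finite_measure_mono) auto
qed

lemma cdf_less_right:
  assumes "finite_borel_measure M" "cdf M x < c"
  obtains b where "x < b" "cdf M b < c"
proof -
  have "(cdf M \<longlongrightarrow> cdf M x) (at_right x)"
    using finite_borel_measure.cdf_is_right_cont[OF assms(1), of x] by (simp add: continuous_within)
  then have "eventually (\<lambda>t. cdf M t < c) (at_right x)"
    using assms(2) by (rule order_tendstoD(2))
  then obtain b where b: "b > x" "\<And>y. x < y \<Longrightarrow> y < b \<Longrightarrow> cdf M y < c"
    by (auto simp: eventually_at_right_field)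
  have "x < (x + b) / 2" "cdf M ((x + b) / 2) < c" using b(1) b(2)[of "(x + b) / 2"] by auto
  then show ?thesis using that by blast
qed

lemma less_cdf_left:
  assumes "finite_borel_measure M" "c < cdf_left M x"
  obtains a where "a < x" "c < cdf M a"
proof -
  have "eventually (\<lambda>t. c < cdf M t) (at_left x)"
    using finite_borel_measure.cdf_at_left[OF assms(1), of x] assms(2)
    by (intro order_tendstoD(1)) (auto simp: cdf_left_def)
  then obtain a where b: "a < x" "\<And>y. a < y \<Longrightarrow> y < x \<Longrightarrow> c < cdf M y"
    by (auto simp: eventually_at_left_field)
  have "(x + a) / 2 < x" "c < cdf M ((x + a) / 2)" using b(1) b(2)[of "(x + a) / 2"] by auto
  then show ?thesis using that by blast
qed

text \<open>Each inequality opens one side: right continuity of F+ carries the first one to the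
  right of t, and the left limits F- carry the second one to the left; monotonicity then gives both
  inequalities at the neighbouring points.\<close>

lemma open_E_plus:
  assumes M: "finite_borel_measure \<mu>" and N: "finite_borel_measure \<nu>"
  shows "open (E_plus \<mu> \<nu>)"
  unfolding open_subopen[of "E_plus \<mu> \<nu>"]
proof
  fix t assume "t \<in> E_plus \<mu> \<nu>"
  then have t: "cdf \<nu> t < cdf \<mu> t" "cdf_left \<nu> t < cdf_left \<mu> t" by (auto simp: E_plus_def)
  obtain b where b: "t < b" "cdf \<nu> b < cdf \<mu> t" using cdf_less_right[OF N t(1)] by blast
  obtain a where a: "a < t" "cdf_left \<nu> t < cdf \<mu> a" using less_cdf_left[OF M t(2)] by blast
  have "{a<..<b} \<subseteq> E_plus \<mu> \<nu>"
  proof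
    fix u assume u: "u \<in> {a<..<b}"
    note mono = finite_borel_measure.cdf_nondecreasing
    consider "u < t" | "u = t" | "t < u" by linarith
    then show "u \<in> E_plus \<mu> \<nu>"
    proof cases
      case 1
      have "cdf \<nu> u \<le> cdf_left \<nu> t" "cdf \<mu> a \<le> cdf_left \<mu> u" "cdf_left \<nu> u \<le> cdf \<nu> u"
        "cdf_left \<mu> u \<le> cdf \<mu> u"
        using u 1 M N by (auto intro: cdf_le_cdf_left cdf_left_le_cdf)
      then show ?thesis using a by (auto simp: E_plus_def)
    next
      case 2 then show ?thesis using t by (auto simp: E_plus_def)
    next
      case 3
      have "cdf \<mu> t \<le> cdf_left \<mu> u" "cdf_left \<mu> u \<le> cdf \<mu> u" "cdf_left \<nu> u \<le> cdf \<nu> u"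
        "cdf \<nu> u \<le> cdf \<nu> b"
        using u 3 M N by (auto intro: cdf_le_cdf_left cdf_left_le_cdf mono)
      then show ?thesis using b by (auto simp: E_plus_def)
    qed
  qed
  moreover have "open {a<..<b}" "t \<in> {a<..<b}" using a b by auto
  ultimately show "\<exists>T. open T \<and> t \<in> T \<and> T \<subseteq> E_plus \<mu> \<nu>" by blast
qed

text \<open>By this symmetry the facts about the minus side follow from those about the plus side,
  with marginals and coordinates exchanged.\<close>

lemma E_minus_eq: "E_minus \<mu> \<nu> = E_plus \<nu> \<mu>"
  by (auto simp: E_minus_def E_plus_def)

lemma E_eq_commute: "E_eq \<mu> \<nu> = E_eq \<nu> \<mu>"
  by (auto simp: E_eq_def E_minus_eq)

lemma E_plus_disjoint: "x \<in> E_plus \<mu> \<nu> \<Longrightarrow> x \<notin> E_plus \<nu> \<mu>"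
  by (auto simp: E_plus_def)

text \<open>Makes the weight of the atom at the left endpoint nonnegative, so that
  \<open>ennreal\<close> does not truncate it. Otherwise right continuity would reverse the
  inequality just to the right of a, that is, inside C.\<close>

lemma component_E_plus_left:
  assumes M: "finite_borel_measure \<mu>" and N: "finite_borel_measure \<nu>"
    and C: "C \<in> components (E_plus \<mu> \<nu>)" and a: "ereal a = lep C"
  shows "cdf \<nu> a \<le> cdf \<mu> a"
proof (rule ccontr)
  assume "\<not> ?thesis"
  then obtain b where b: "a < b" "cdf \<mu> b < cdf \<nu> a"
    using cdf_less_right[OF M, of a "cdf \<nu> a"] by (auto simp: not_le)
  note eq = component_eq_einterval[OF open_E_plus[OF M N] C]
  have "ereal a < min (rep C) (ereal b)" using b eq(3)[folded a] by auto
  then obtain u where u: "ereal a < ereal u" "ereal u < min (rep C) (ereal b)"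
    using ereal_dense2 by blast
  then have "u \<in> C" by (subst eq(1)) (use a in auto)
  then have "cdf \<nu> u < cdf \<mu> u" using in_components_subset[OF C] by (auto simp: E_plus_def)
  also have "cdf \<mu> u \<le> cdf \<mu> b" using u M by (auto intro: finite_borel_measure.cdf_nondecreasing)
  also have "\<dots> < cdf \<nu> a" by (rule b)
  also have "\<dots> \<le> cdf \<nu> u" using u N by (auto intro: finite_borel_measure.cdf_nondecreasing)
  finally show False by simp
qed

lemma component_E_plus_right:
  assumes M: "finite_borel_measure \<mu>" and N: "finite_borel_measure \<nu>"
    and C: "C \<in> components (E_plus \<mu> \<nu>)" and b: "ereal b = rep C"
  shows "cdf_left \<nu> b \<le> cdf_left \<mu> b"
proof (rule ccontr)
  assume "\<not> ?thesis"
  then obtain a where a: "a < b" "cdf_left \<mu> b < cdf \<nu> a"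
    using less_cdf_left[OF N, of "cdf_left \<mu> b" b] by (auto simp: not_le)
  note eq = component_eq_einterval[OF open_E_plus[OF M N] C]
  have "max (lep C) (ereal a) < ereal b" using a eq(3)[folded b] by auto
  then obtain u where u: "max (lep C) (ereal a) < ereal u" "ereal u < ereal b"
    using ereal_dense2 by blast
  then have "u \<in> C" by (subst eq(1)) (use b in auto)
  then have "cdf_left \<nu> u < cdf_left \<mu> u" using in_components_subset[OF C] by (auto simp: E_plus_def)
  also have "\<dots> \<le> cdf \<mu> u" by (rule cdf_left_le_cdf[OF M])
  also have "\<dots> \<le> cdf_left \<mu> b" using u M by (auto intro: cdf_le_cdf_left)
  also have "\<dots> < cdf \<nu> a" by (rule a)
  also have "\<dots> \<le> cdf_left \<nu> u" using u N by (auto intro: cdf_le_cdf_left)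
  finally show False by simp
qed

section \<open>Noncrossing plans\<close>

text \<open>Mass may leave from the left endpoint and arrive at the right one, but not conversely.
  This matches the atoms of \<open>mu_plus\<close> and \<open>nu_plus\<close> at opposite ends and
  keeps the regions of adjacent components disjoint.\<close>

definition plus_region :: "real set \<Rightarrow> (real \<times> real) set" where
  "plus_region C = {(x, y). x \<le> y \<and> lep C \<le> ereal x \<and> ereal x < rep C \<and>
     lep C < ereal y \<and> ereal y \<le> rep C}"

definition minus_region :: "real set \<Rightarrow> (real \<times> real) set" where
  "minus_region C = prod.swap -` plus_region C"

definition diag_region :: "real measure \<Rightarrow> real measure \<Rightarrow> (real \<times> real) set" where
  "diag_region \<mu> \<nu> = {(x, y). x = y \<and> x \<in> E_eq \<mu> \<nu>}"

definition plan_support :: "real measure \<Rightarrow> real measure \<Rightarrow> (real \<times> real) set" where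
  "plan_support \<mu> \<nu> = \<Union> (plus_region ` components (E_plus \<mu> \<nu>)) \<union>
     \<Union> (minus_region ` components (E_minus \<mu> \<nu>)) \<union> diag_region \<mu> \<nu>"

lemma plus_region_measurable [measurable]: "plus_region C \<in> sets borel"
proof -
  have "{z \<in> space (borel \<Otimes>\<^sub>M borel). fst z \<le> (snd z :: real) \<and> lep C \<le> ereal (fst z) \<and>
      ereal (fst z) < rep C \<and> lep C < ereal (snd z) \<and> ereal (snd z) \<le> rep C} \<in> sets (borel \<Otimes>\<^sub>M borel)"
    by measurable
  then show ?thesis
    unfolding plus_region_def case_prod_unfold borel_prod[symmetric] by (simp add: space_pair_measure)
qed

lemma swap_measurable [measurable]:
  "prod.swap \<in> measurable (borel :: (real \<times> real) measure) (borel :: (real \<times> real) measure)"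
proof -
  have "(\<lambda>p. (snd p, fst p)) \<in> measurable (borel \<Otimes>\<^sub>M borel) (borel \<Otimes>\<^sub>M borel :: (real \<times> real) measure)"
    by measurable
  then show ?thesis by (simp add: prod.swap_def[abs_def] borel_prod)
qed

lemma minus_region_measurable [measurable]: "minus_region C \<in> sets borel"
  unfolding minus_region_def
  using measurable_sets[OF swap_measurable plus_region_measurable[of C]] by simp

lemma minus_region_iff: "(x, y) \<in> minus_region C \<longleftrightarrow> (y, x) \<in> plus_region C"
  by (simp add: minus_region_def)

lemma plan_support_swap: "(x, y) \<in> plan_support \<mu> \<nu> \<longleftrightarrow> (y, x) \<in> plan_support \<nu> \<mu>"
  by (auto simp: plan_support_def minus_region_iff E_minus_eq diag_region_def E_eq_commute[of \<mu>])

section \<open>Plans with given marginals and the exchange of coordinates\<close>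

lemma MargD:
  assumes "\<pi> \<in> Marg \<mu> \<nu>"
  shows "finite_measure \<pi>" "sets \<pi> = sets borel" "sets \<mu> = sets borel" "sets \<nu> = sets borel"
    and "X \<in> sets borel \<Longrightarrow> emeasure \<mu> X = emeasure \<pi> (X \<times> UNIV)"
    and "X \<in> sets borel \<Longrightarrow> emeasure \<nu> X = emeasure \<pi> (UNIV \<times> X)"
    and "finite_measure \<mu>" "finite_measure \<nu>"
proof -
  show \<pi>: "finite_measure \<pi>" "sets \<pi> = sets borel" using assms by (auto simp: Marg_def)
  have sp: "space \<pi> = UNIV" using sets_eq_imp_space_eq[OF \<pi>(2)] by simp
  have \<mu>: "\<mu> = distr \<pi> borel fst" and \<nu>: "\<nu> = distr \<pi> borel snd" using assms by (auto simp: Marg_def)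
  show "sets \<mu> = sets borel" "sets \<nu> = sets borel" by (auto simp: \<mu> \<nu>)
  have m: "fst \<in> measurable \<pi> borel" "snd \<in> measurable \<pi> borel"
    unfolding measurable_cong_sets[OF \<pi>(2) refl] borel_prod[symmetric] by auto
  show "finite_measure \<mu>" "finite_measure \<nu>"
    unfolding \<mu> \<nu> using \<pi>(1) m by (auto intro: finite_measure.finite_measure_distr)
  show "X \<in> sets borel \<Longrightarrow> emeasure \<mu> X = emeasure \<pi> (X \<times> UNIV)"
    unfolding \<mu> using m by (subst emeasure_distr) (auto simp: sp intro!: arg_cong[where f="emeasure \<pi>"])
  show "X \<in> sets borel \<Longrightarrow> emeasure \<nu> X = emeasure \<pi> (UNIV \<times> X)"
    unfolding \<nu> using m by (subst emeasure_distr) (auto simp: sp intro!: arg_cong[where f="emeasure \<pi>"])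
qed

lemma MargI:
  assumes "finite_measure \<pi>" and \<pi>: "sets \<pi> = sets borel"
    and s: "sets \<mu> = sets borel" "sets \<nu> = sets borel"
    and e: "\<And>X. X \<in> sets borel \<Longrightarrow> emeasure \<pi> (X \<times> UNIV) = emeasure \<mu> X"
      "\<And>X. X \<in> sets borel \<Longrightarrow> emeasure \<pi> (UNIV \<times> X) = emeasure \<nu> X"
  shows "\<pi> \<in> Marg \<mu> \<nu>"
proof -
  have sp: "space \<pi> = UNIV" using sets_eq_imp_space_eq[OF \<pi>] by simp
  have m: "fst \<in> measurable \<pi> borel" "snd \<in> measurable \<pi> borel"
    unfolding measurable_cong_sets[OF \<pi> refl] borel_prod[symmetric] by auto
  have "distr \<pi> borel fst = \<mu>"
    by (rule measure_eqI, simp add: s, subst emeasure_distr)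
       (auto simp: m sp e(1)[symmetric] intro!: arg_cong[where f="emeasure \<pi>"])
  moreover have "distr \<pi> borel snd = \<nu>"
    by (rule measure_eqI, simp add: s, subst emeasure_distr)
       (auto simp: m sp e(2)[symmetric] intro!: arg_cong[where f="emeasure \<pi>"])
  ultimately show ?thesis using assms by (auto simp: Marg_def)
qed

lemma Marg_finite_borel_measure:
  assumes "\<pi> \<in> Marg \<mu> \<nu>" shows "finite_borel_measure \<mu>" "finite_borel_measure \<nu>"
  using MargD[OF assms] by (auto simp: finite_borel_measure_def finite_borel_measure_axioms_def)

lemma Marg_swap:
  assumes "\<pi> \<in> Marg \<mu> \<nu>"
  shows "distr \<pi> borel prod.swap \<in> Marg \<nu> \<mu>"
proof (rule MargI)
  note D = MargD[OF assms]
  have m: "prod.swap \<in> measurable \<pi> borel"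
    unfolding measurable_cong_sets[OF D(2) refl] by (rule swap_measurable)
  have sp: "space \<pi> = UNIV" using sets_eq_imp_space_eq[OF D(2)] by simp
  show "finite_measure (distr \<pi> borel prod.swap)" using D(1) m by (rule finite_measure.finite_measure_distr)
  show "sets \<nu> = sets borel" "sets \<mu> = sets borel" by (fact D)+
  have X: "X \<times> UNIV \<in> sets (borel :: (real\<times>real) measure)" "UNIV \<times> X \<in> sets (borel :: (real\<times>real) measure)"
    if "X \<in> sets borel" for X :: "real set"
    unfolding borel_prod[symmetric] using that by auto
  show "emeasure (distr \<pi> borel prod.swap) (X \<times> UNIV) = emeasure \<nu> X" if "X \<in> sets borel" for X
    using that X[OF that] m by (subst emeasure_distr) (auto simp: D(6) sp intro!: arg_cong[where f="emeasure \<pi>"])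
  show "emeasure (distr \<pi> borel prod.swap) (UNIV \<times> X) = emeasure \<mu> X" if "X \<in> sets borel" for X
    using that X[OF that] m by (subst emeasure_distr) (auto simp: D(5) sp intro!: arg_cong[where f="emeasure \<pi>"])
qed simp

lemma swap_image_iff: "(x, y) \<in> prod.swap ` \<Gamma> \<longleftrightarrow> (y, x) \<in> \<Gamma>"
  by force

text \<open>Instantiated with every competitor, with the quantile coupling, with exchanged
  coordinates for the minus side, and with the restriction of a plan to a region, which yields the
  distribution functions of the component marginals.\<close>

locale noncrossing_plan =
  fixes \<mu> \<nu> :: "real measure" and \<pi> :: "(real \<times> real) measure" and \<Gamma> :: "(real \<times> real) set"
  assumes Marg: "\<pi> \<in> Marg \<mu> \<nu>" and nc: "noncrossing \<Gamma>" and conc: "AE z in \<pi>. z \<in> \<Gamma>"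
begin

lemma sets_\<pi> [simp, measurable_cong]: "sets \<pi> = sets borel" by (rule MargD[OF Marg])
lemma space_\<pi> [simp]: "space \<pi> = UNIV" using sets_eq_imp_space_eq[OF sets_\<pi>] by simp

sublocale \<pi>: finite_measure \<pi> by (rule MargD[OF Marg])

lemma fb: "finite_borel_measure \<mu>" "finite_borel_measure \<nu>"
  using Marg_finite_borel_measure[OF Marg] by auto

sublocale \<mu>: finite_borel_measure \<mu> by (rule fb)
sublocale \<nu>: finite_borel_measure \<nu> by (rule fb)

lemma swap: "noncrossing_plan \<nu> \<mu> (distr \<pi> borel prod.swap) (prod.swap ` \<Gamma>)"
proof
  show "distr \<pi> borel prod.swap \<in> Marg \<nu> \<mu>" by (rule Marg_swap[OF Marg])
  show "noncrossing (prod.swap ` \<Gamma>)"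
  proof (rule noncrossingI)
    fix x y x' y' assume "(x, y) \<in> prod.swap ` \<Gamma>" "(x', y') \<in> prod.swap ` \<Gamma>"
    then have "min x' y \<le> max y' x"
      unfolding swap_image_iff by (intro noncrossingD[OF nc])
    then show "min y x' \<le> max x y'" by (simp only: max.commute min.commute)
  qed
  show "AE z in distr \<pi> borel prod.swap. z \<in> prod.swap ` \<Gamma>"
  proof -
    have m: "prod.swap \<in> measurable \<pi> borel"
      unfolding measurable_cong_sets[OF sets_\<pi> refl] by (rule swap_measurable)
    \<comment> \<open>\<open>\<Gamma>\<close> may fail to be Borel, so the almost-everywhere
      statement is transported through a measurable null set.\<close>
    obtain N where N: "N \<in> sets \<pi>" "emeasure \<pi> N = 0" "{z \<in> space \<pi>. z \<notin> \<Gamma>} \<subseteq> N"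
      using conc by (auto elim: AE_E)
    have N': "prod.swap -` N \<in> sets borel"
      using measurable_sets[OF swap_measurable, of N] N(1) by simp
    show ?thesis
    proof (rule AE_I)
      show "prod.swap -` N \<in> sets (distr \<pi> borel prod.swap)" using N' by simp
      show "emeasure (distr \<pi> borel prod.swap) (prod.swap -` N) = 0"
        using m N' N(2) by (subst emeasure_distr) (auto simp: vimage_def)
      show "{z \<in> space (distr \<pi> borel prod.swap). z \<notin> prod.swap ` \<Gamma>} \<subseteq> prod.swap -` N"
      proof
        fix z assume "z \<in> {z \<in> space (distr \<pi> borel prod.swap). z \<notin> prod.swap ` \<Gamma>}"
        then have "prod.swap z \<notin> \<Gamma>" by (cases z) (simp add: swap_image_iff)
        then show "z \<in> prod.swap -` N" using N(3) by auto
      qed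
    qed
  qed
qed

lemma pair_sets [measurable]:
  "{z. P (fst z) (snd z)} \<in> sets borel" if "Measurable.pred (borel \<Otimes>\<^sub>M borel) (\<lambda>z. P (fst z) (snd z))"
  for P :: "real \<Rightarrow> real \<Rightarrow> bool"
  using that unfolding borel_prod pred_def by simp

text \<open>Unless one of the two events is null, each contains a point of \<open>\<Gamma>\<close>,
  and these two points cross. This turns the noncrossing property of a set into a statement about
  the measure.\<close>

lemma cross_null:
  assumes "\<And>x y x' y'. P x y \<Longrightarrow> Q x' y' \<Longrightarrow> max x y' < min y x'"
  shows "(AE z in \<pi>. \<not> P (fst z) (snd z)) \<or> (AE z in \<pi>. \<not> Q (fst z) (snd z))"
proof (rule ccontr)
  assume neg: "\<not> ?thesis"
  have ex: "\<exists>z\<in>\<Gamma>. R z" if "\<not> (AE z in \<pi>. \<not> R z)" for R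
  proof (rule ccontr)
    assume "\<not> ?thesis"
    then have "AE z in \<pi>. \<not> R z" using conc by (auto elim: eventually_mono)
    then show False using that by simp
  qed
  obtain z where z: "z \<in> \<Gamma>" "P (fst z) (snd z)"
    using ex[of "\<lambda>z. P (fst z) (snd z)"] neg by auto
  obtain z' where z': "z' \<in> \<Gamma>" "Q (fst z') (snd z')"
    using ex[of "\<lambda>z. Q (fst z) (snd z)"] neg by auto
  have "min (snd z) (fst z') \<le> max (fst z) (snd z')"
    using noncrossingD[OF nc, of "fst z" "snd z" "fst z'" "snd z'"] z z' by simp
  then show False using assms[OF z(2) z'(2)] by simp
qed

lemma measure_pair_eq:
  assumes "X \<in> sets borel"
  shows "measure \<mu> X = measure \<pi> {z. fst z \<in> X}" "measure \<nu> X = measure \<pi> {z. snd z \<in> X}"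
proof -
  have "X \<times> UNIV = {z :: real \<times> real. fst z \<in> X}" "UNIV \<times> X = {z :: real \<times> real. snd z \<in> X}" by auto
  then show "measure \<mu> X = measure \<pi> {z. fst z \<in> X}" "measure \<nu> X = measure \<pi> {z. snd z \<in> X}"
    using MargD(5,6)[OF Marg assms] by (auto simp: measure_def)
qed

lemma measure_null: "AE z in \<pi>. \<not> P z \<Longrightarrow> measure \<pi> {z. P z} = 0"
  using emeasure_eq_0_AE[of P \<pi>] by (simp add: measure_def)

lemma AE_measure_null:
  "{z. P z} \<in> sets borel \<Longrightarrow> measure \<pi> {z. P z} = 0 \<Longrightarrow> AE z in \<pi>. \<not> P z"
  by (rule AE_I[of _ _ "{z. P z}"]) (auto simp: \<pi>.emeasure_eq_measure)

text \<open>The pairs with both coordinates up to t cancel between the two marginals; what remains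
  is the net flow across t.\<close>

lemma cdf_diff:
  "cdf \<mu> t - cdf \<nu> t = measure \<pi> {z. fst z \<le> t \<and> t < snd z} - measure \<pi> {z. snd z \<le> t \<and> t < fst z}"
proof -
  have "measure \<pi> {z. fst z \<in> {..t}} =
      measure \<pi> {z. fst z \<le> t \<and> snd z \<le> t} + measure \<pi> {z. fst z \<le> t \<and> t < snd z}"
    by (subst \<pi>.finite_measure_Union[symmetric]) (auto intro!: arg_cong[where f="measure \<pi>"])
  moreover have "measure \<pi> {z. snd z \<in> {..t}} =
      measure \<pi> {z. fst z \<le> t \<and> snd z \<le> t} + measure \<pi> {z. snd z \<le> t \<and> t < fst z}"
    by (subst \<pi>.finite_measure_Union[symmetric]) (auto intro!: arg_cong[where f="measure \<pi>"])
  ultimately show ?thesis by (simp add: cdf_def measure_pair_eq)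
qed

lemma cdf_left_diff:
  "cdf_left \<mu> t - cdf_left \<nu> t = measure \<pi> {z. fst z < t \<and> t \<le> snd z} - measure \<pi> {z. snd z < t \<and> t \<le> fst z}"
proof -
  have "measure \<pi> {z. fst z \<in> {..<t}} =
      measure \<pi> {z. fst z < t \<and> snd z < t} + measure \<pi> {z. fst z < t \<and> t \<le> snd z}"
    by (subst \<pi>.finite_measure_Union[symmetric]) (auto intro!: arg_cong[where f="measure \<pi>"])
  moreover have "measure \<pi> {z. snd z \<in> {..<t}} =
      measure \<pi> {z. fst z < t \<and> snd z < t} + measure \<pi> {z. snd z < t \<and> t \<le> fst z}"
    by (subst \<pi>.finite_measure_Union[symmetric]) (auto intro!: arg_cong[where f="measure \<pi>"])
  ultimately show ?thesis by (simp add: cdf_left_def measure_pair_eq)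
qed

text \<open>Of the rightward and the leftward flow across t one vanishes, so the net flow determines
  both. The right-hand sides depend on the marginals only, hence all noncrossing plans agree
  here.\<close>

lemma cross_measure:
  "measure \<pi> {z. fst z \<le> t \<and> t < snd z} = max 0 (cdf \<mu> t - cdf \<nu> t)"
  "measure \<pi> {z. fst z < t \<and> t \<le> snd z} = max 0 (cdf_left \<mu> t - cdf_left \<nu> t)"
proof -
  have "(AE z in \<pi>. \<not> (fst z \<le> t \<and> t < snd z)) \<or> (AE z in \<pi>. \<not> (snd z \<le> t \<and> t < fst z))"
    by (rule cross_null[of "\<lambda>x y. x \<le> t \<and> t < y" "\<lambda>x y. y \<le> t \<and> t < x"]) auto
  then have "measure \<pi> {z. fst z \<le> t \<and> t < snd z} = 0 \<or> measure \<pi> {z. snd z \<le> t \<and> t < fst z} = 0"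
    using measure_null[of "\<lambda>z. fst z \<le> t \<and> t < snd z"] measure_null[of "\<lambda>z. snd z \<le> t \<and> t < fst z"]
    by argo
  then show "measure \<pi> {z. fst z \<le> t \<and> t < snd z} = max 0 (cdf \<mu> t - cdf \<nu> t)"
    unfolding cdf_diff
    by (smt (verit) measure_nonneg)
  have "(AE z in \<pi>. \<not> (fst z < t \<and> t \<le> snd z)) \<or> (AE z in \<pi>. \<not> (snd z < t \<and> t \<le> fst z))"
    by (rule cross_null[of "\<lambda>x y. x < t \<and> t \<le> y" "\<lambda>x y. y < t \<and> t \<le> x"]) auto
  then have "measure \<pi> {z. fst z < t \<and> t \<le> snd z} = 0 \<or> measure \<pi> {z. snd z < t \<and> t \<le> fst z} = 0"
    using measure_null[of "\<lambda>z. fst z < t \<and> t \<le> snd z"] measure_null[of "\<lambda>z. snd z < t \<and> t \<le> fst z"]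
    by argo
  then show "measure \<pi> {z. fst z < t \<and> t \<le> snd z} = max 0 (cdf_left \<mu> t - cdf_left \<nu> t)"
    unfolding cdf_left_diff
    by (smt (verit) measure_nonneg)
qed

text \<open>A strict crossing of t is a crossing in both half-open senses, and outside
  \<open>E_plus\<close> at least one of these two has mass zero.\<close>

lemma AE_not_crossing:
  assumes "t \<notin> E_plus \<mu> \<nu>"
  shows "AE z in \<pi>. \<not> (fst z < t \<and> t < snd z)"
proof -
  have "measure \<pi> {z. fst z \<le> t \<and> t < snd z} = 0 \<or> measure \<pi> {z. fst z < t \<and> t \<le> snd z} = 0"
    using assms unfolding cross_measure by (auto simp: E_plus_def)
  then have "(AE z in \<pi>. \<not> (fst z \<le> t \<and> t < snd z)) \<or> (AE z in \<pi>. \<not> (fst z < t \<and> t \<le> snd z))"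
    using AE_measure_null[of "\<lambda>z. fst z \<le> t \<and> t < snd z"]
      AE_measure_null[of "\<lambda>z. fst z < t \<and> t \<le> snd z"] by (auto)
  then show ?thesis by (auto elim: eventually_mono)
qed

text \<open>Uncountably many points have to be avoided at once. An open interval that misses a
  countable dense subset of the complement of \<open>E_plus\<close> misses its closure, hence the
  whole complement.\<close>

lemma AE_between_subset_E_plus: "AE z in \<pi>. {fst z<..<snd z} \<subseteq> E_plus \<mu> \<nu>"
proof -
  obtain T where T: "countable T" "T \<subseteq> - E_plus \<mu> \<nu>" "- E_plus \<mu> \<nu> \<subseteq> closure T"
    using separable by blast
  have "AE z in \<pi>. \<forall>t\<in>T. \<not> (fst z < t \<and> t < snd z)"
    using T by (intro AE_ball_countable' AE_not_crossing) auto
  then show ?thesis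
  proof (rule AE_mp, intro AE_I2 impI subsetI)
    fix z u assume z: "\<forall>t\<in>T. \<not> (fst z < t \<and> t < snd z)" and u: "u \<in> {fst z<..<snd z}"
    have "{fst z<..<snd z} \<inter> T = {}" using z by auto
    then have "{fst z<..<snd z} \<inter> closure T = {}"
      by (subst open_Int_closure_eq_empty) auto
    then show "u \<in> E_plus \<mu> \<nu>" using u T(3) by auto
  qed
qed

lemma AE_plan_support_less:
  "AE z in \<pi>. fst z < snd z \<longrightarrow> z \<in> plan_support \<mu> \<nu>"
  using AE_between_subset_E_plus
proof (rule AE_mp, intro AE_I2 impI)
  fix z assume z: "{fst z<..<snd z} \<subseteq> E_plus \<mu> \<nu>" "fst z < snd z"
  obtain C where C: "C \<in> components (E_plus \<mu> \<nu>)" "{fst z<..<snd z} \<subseteq> C" "lep C \<le> ereal (fst z)" "ereal (snd z) \<le> rep C"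
    using interval_subset_component[OF z(2,1)] by blast
  have "ereal (fst z) < ereal (snd z)" using z(2) by simp
  then have "ereal (fst z) < rep C" "lep C < ereal (snd z)"
    using C(3,4) less_le_trans le_less_trans by blast+
  then have "z \<in> plus_region C" using C z(2) by (auto simp: plus_region_def case_prod_unfold)
  then show "z \<in> plan_support \<mu> \<nu>" using C(1) by (auto simp: plan_support_def)
qed

lemma AE_plan_support: "AE z in \<pi>. z \<in> plan_support \<mu> \<nu>"
proof -
  interpret S: noncrossing_plan \<nu> \<mu> "distr \<pi> borel prod.swap" "prod.swap ` \<Gamma>" by (rule swap)
  have "AE z in \<pi>. fst (prod.swap z) < snd (prod.swap z) \<longrightarrow> prod.swap z \<in> plan_support \<nu> \<mu>"
    using S.AE_plan_support_less by (rule AE_distrD[rotated]) simp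
  with AE_plan_support_less show ?thesis
  proof eventually_elim
    case (elim z)
    obtain x y where z: "z = (x, y)" by (cases z)
    consider "x < y" | "y < x" | "x = y" by linarith
    then show ?case
    proof cases
      \<comment> \<open>Crossings say nothing about a diagonal pair; the position of x alone decides
        its region.\<close>
      case 3
      have fbs: "open (E_plus \<mu> \<nu>)" "open (E_plus \<nu> \<mu>)" using open_E_plus fb by auto
      have diag: "(x, x) \<in> plus_region C" if "C \<in> components S" "open S" "x \<in> C" for C S
      proof -
        have "lep C < ereal x" "ereal x < rep C"
          using that(3) by (subst (asm) component_eq_einterval(1)[OF that(2,1)], simp)+
        then show ?thesis by (simp add: plus_region_def less_imp_le)
      qed
      have un: "\<exists>C\<in>components S. x \<in> C" if "x \<in> S" for S :: "real set"
        using that Union_components[of S] by blast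
      consider "x \<in> E_plus \<mu> \<nu>" | "x \<in> E_plus \<nu> \<mu>" | "x \<in> E_eq \<mu> \<nu>"
        by (auto simp: E_eq_def E_minus_eq)
      then show ?thesis
      proof cases
        case 1
        then obtain C where "C \<in> components (E_plus \<mu> \<nu>)" "x \<in> C" using un by blast
        then show ?thesis using diag fbs unfolding z 3[symmetric] plan_support_def by blast
      next
        case 2
        then obtain C where "C \<in> components (E_minus \<mu> \<nu>)" "x \<in> C" using un E_minus_eq by blast
        moreover from this have "(x, x) \<in> minus_region C"
          unfolding minus_region_iff by (metis diag fbs(2) E_minus_eq)
        ultimately show ?thesis unfolding z 3[symmetric] plan_support_def by blast
      next
        case x: 3
        then show ?thesis unfolding z 3[symmetric] plan_support_def by (simp add: diag_region_def)
      qed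
    qed (use elim z plan_support_swap in auto)
  qed
qed

end

text \<open>The coordinates of a pair may be ends of the component, but the midpoint always lies in
  it. It therefore identifies the component, and disjointness of the regions reduces to disjointness
  of the components.\<close>

lemma plus_region_midpoint:
  assumes "open S" "C \<in> components S" "(x, y) \<in> plus_region C"
  shows "(x + y) / 2 \<in> C"
proof -
  have z: "x \<le> y" "lep C \<le> ereal x" "ereal x < rep C" "lep C < ereal y" "ereal y \<le> rep C"
    using assms(3) by (auto simp: plus_region_def)
  have "lep C < ereal ((x + y) / 2) \<and> ereal ((x + y) / 2) < rep C"
  proof (cases "x = y")
    case False
    then have "ereal x < ereal ((x + y) / 2)" "ereal ((x + y) / 2) < ereal y" using z(1) by auto
    then show ?thesis using z by (meson le_less_trans less_le_trans)
  qed (use z in auto)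
  then show ?thesis by (subst component_eq_einterval(1)[OF assms(1,2)]) simp
qed

lemma plus_region_between:
  assumes "open S" "C \<in> components S" "(x, y) \<in> plus_region C"
  shows "{x<..<y} \<subseteq> C"
proof
  fix u assume "u \<in> {x<..<y}"
  then have "ereal x < ereal u" "ereal u < ereal y" by auto
  moreover have "lep C \<le> ereal x" "ereal y \<le> rep C" using assms(3) by (auto simp: plus_region_def)
  ultimately have "lep C < ereal u" "ereal u < rep C" by (meson le_less_trans less_le_trans)+
  then show "u \<in> C" by (subst component_eq_einterval(1)[OF assms(1,2)]) simp
qed

lemma component_mem_iff:
  assumes "open S" "C \<in> components S"
  shows "x \<in> C \<longleftrightarrow> lep C < ereal x \<and> ereal x < rep C"
  by (subst component_eq_einterval(1)[OF assms]) simp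

context
  fixes \<mu> \<nu> :: "real measure"
  assumes M: "finite_borel_measure \<mu>" and N: "finite_borel_measure \<nu>"
begin

lemmas opens = open_E_plus[OF M N] open_E_plus[OF N M]

lemma plan_support_cases:
  assumes "(x, y) \<in> plan_support \<mu> \<nu>"
  obtains (plus) C where "C \<in> components (E_plus \<mu> \<nu>)" "(x, y) \<in> plus_region C"
    | (minus) C where "C \<in> components (E_plus \<nu> \<mu>)" "(y, x) \<in> plus_region C"
    | (diag) "x = y" "x \<in> E_eq \<mu> \<nu>"
  using assms by (auto simp: plan_support_def minus_region_iff E_minus_eq diag_region_def)

text \<open>A point strictly inside a rightward arrow lies in \<open>E_plus\<close>, one strictly
  inside a leftward arrow in \<open>E_minus\<close>, and these sets are disjoint. This will make the
  generalized Kellerer plan cyclically monotone.\<close>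

lemma noncrossing_plan_support: "noncrossing (plan_support \<mu> \<nu>)"
proof (rule noncrossingI, rule ccontr)
  fix x y x' y'
  assume z: "(x, y) \<in> plan_support \<mu> \<nu>" "(x', y') \<in> plan_support \<mu> \<nu>" and "\<not> min y x' \<le> max x y'"
  then have "max x y' < min y x'" by (simp only: not_le)
  then obtain t where "max x y' < t" "t < min y x'" using dense by blast
  then have t: "x < t" "y' < t" "t < y" "t < x'" by auto
  have "t \<in> E_plus \<mu> \<nu>"
    using z(1)
  proof (cases rule: plan_support_cases)
    case (plus C)
    then show ?thesis using plus_region_between[OF opens(1) plus] in_components_subset[OF plus(1)] t by auto
  qed (use t in \<open>auto simp: plus_region_def\<close>)
  moreover have "t \<in> E_plus \<nu> \<mu>"
    using z(2)
  proof (cases rule: plan_support_cases)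
    case (minus C)
    then show ?thesis using plus_region_between[OF opens(2) minus] in_components_subset[OF minus(1)] t by auto
  qed (use t in \<open>auto simp: plus_region_def\<close>)
  ultimately show False using E_plus_disjoint by blast
qed

lemma plus_region_disjoint:
  assumes "C \<in> components (E_plus \<mu> \<nu>)" "C' \<in> components (E_plus \<mu> \<nu>)"
    "z \<in> plus_region C" "z \<in> plus_region C'"
  shows "C = C'"
  using components_disjoint[OF assms(1,2)] plus_region_midpoint[OF opens(1)] assms
  by (metis surj_pair)

lemma plus_minus_region_disjoint:
  assumes "C \<in> components (E_plus \<mu> \<nu>)" "C' \<in> components (E_minus \<mu> \<nu>)"
    "z \<in> plus_region C" "z \<in> minus_region C'"
  shows False
proof -
  obtain x y where z: "z = (x, y)" by (cases z)
  have C': "C' \<in> components (E_plus \<nu> \<mu>)" using assms(2) by (simp add: E_minus_eq)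
  have "(x + y) / 2 \<in> E_plus \<mu> \<nu>" "(y + x) / 2 \<in> E_plus \<nu> \<mu>"
    using assms(3,4) plus_region_midpoint[OF opens(1) assms(1), of x y] plus_region_midpoint[OF opens(2) C', of y x]
      in_components_subset[OF assms(1)] in_components_subset[OF C'] by (auto simp: z minus_region_iff)
  then show False using E_plus_disjoint by (metis add.commute)
qed

lemma plus_diag_region_disjoint:
  assumes "C \<in> components (E_plus \<mu> \<nu>)" "z \<in> plus_region C" "z \<in> diag_region \<mu> \<nu>"
  shows False
proof -
  obtain x where z: "z = (x, x)" "x \<in> E_eq \<mu> \<nu>" using assms(3) by (auto simp: diag_region_def)
  have "x \<in> E_plus \<mu> \<nu>"
    using plus_region_midpoint[OF opens(1) assms(1), of x x] assms(2) z in_components_subset[OF assms(1)] by auto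
  then show False using z by (auto simp: E_eq_def)
qed

text \<open>Inside the support the first coordinate tells the region, except at the left endpoint of
  C: pairs that stay or move left may start there too, and only x < y separates them. This is why
  the first marginal of the part over C is the same for all plans.\<close>

lemma plan_support_fst_iff:
  assumes C: "C \<in> components (E_plus \<mu> \<nu>)" and z: "(x, y) \<in> plan_support \<mu> \<nu>"
  shows "(x, y) \<in> plus_region C \<longleftrightarrow> x \<in> C \<or> ereal x = lep C \<and> x < y"
proof
  assume "(x, y) \<in> plus_region C"
  then have z: "x \<le> y" "lep C \<le> ereal x" "ereal x < rep C" "lep C < ereal y"
    by (auto simp: plus_region_def)
  then show "x \<in> C \<or> ereal x = lep C \<and> x < y"
    unfolding component_mem_iff[OF opens(1) C] by (auto simp: order.order_iff_strict)
next
  assume "x \<in> C \<or> ereal x = lep C \<and> x < y"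
  then show "(x, y) \<in> plus_region C"
  proof
    assume x: "x \<in> C"
    then have xE: "x \<in> E_plus \<mu> \<nu>" using in_components_subset[OF C] by auto
    from z show ?thesis
    proof (cases rule: plan_support_cases)
      case (plus C')
      have "ereal x \<noteq> lep C'" using component_endpoint_notin[OF opens(1) plus(1), of x] xE by blast
      then have "x \<in> C'"
        using plus(2) unfolding component_mem_iff[OF opens(1) plus(1)] by (auto simp: plus_region_def)
      then show ?thesis using components_disjoint[OF C plus(1) x] plus by simp
    next
      case (minus C')
      have "x \<notin> C'" using E_plus_disjoint[OF xE] in_components_subset[OF minus(1)] by auto
      \<comment> \<open>In a pair that moves left within the region of \<open>C'\<close>, x can only
        be the right endpoint, where F- of \<mu> is at most that of \<nu>; this excludes x from
        \<open>E_plus\<close>.\<close>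
      then have "ereal x = rep C'"
        using minus(2) unfolding component_mem_iff[OF opens(2) minus(1)] by (auto simp: plus_region_def)
      then have "cdf_left \<mu> x \<le> cdf_left \<nu> x" by (rule component_E_plus_right[OF N M minus(1)])
      then show ?thesis using xE by (auto simp: E_plus_def)
    next
      case diag
      then show ?thesis using xE by (auto simp: E_eq_def)
    qed
  next
    assume x: "ereal x = lep C \<and> x < y"
    from z show ?thesis
    proof (cases rule: plan_support_cases)
      case (plus C')
      have "x \<notin> E_plus \<mu> \<nu>" using component_endpoint_notin[OF opens(1) C] x by auto
      then have "x \<notin> C'" using in_components_subset[OF plus(1)] by auto
      then have x': "ereal x = lep C'"
        using plus(2) unfolding component_mem_iff[OF opens(1) plus(1)] by (auto simp: plus_region_def)
      have "ereal x < min (rep C) (rep C')"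
        using component_eq_einterval(3)[OF opens(1) C] component_eq_einterval(3)[OF opens(1) plus(1)] x x' by auto
      then obtain u where u: "ereal x < ereal u" "ereal u < min (rep C) (rep C')"
        using ereal_dense2 by blast
      then have "u \<in> C" "u \<in> C'"
        unfolding component_mem_iff[OF opens(1) plus(1)] component_mem_iff[OF opens(1) C]
        using x x' by auto
      then show ?thesis using components_disjoint[OF C plus(1)] plus by auto
    qed (use x in \<open>auto simp: plus_region_def\<close>)
  qed
qed

lemma plan_support_snd_iff:
  assumes C: "C \<in> components (E_plus \<mu> \<nu>)" and z: "(x, y) \<in> plan_support \<mu> \<nu>"
  shows "(x, y) \<in> plus_region C \<longleftrightarrow> y \<in> C \<or> ereal y = rep C \<and> x < y"
proof
  assume "(x, y) \<in> plus_region C"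
  then have z: "x \<le> y" "ereal x < rep C" "lep C < ereal y" "ereal y \<le> rep C"
    by (auto simp: plus_region_def)
  then show "y \<in> C \<or> ereal y = rep C \<and> x < y"
    unfolding component_mem_iff[OF opens(1) C] by (auto simp: order.order_iff_strict)
next
  assume "y \<in> C \<or> ereal y = rep C \<and> x < y"
  then show "(x, y) \<in> plus_region C"
  proof
    assume y: "y \<in> C"
    then have yE: "y \<in> E_plus \<mu> \<nu>" using in_components_subset[OF C] by auto
    from z show ?thesis
    proof (cases rule: plan_support_cases)
      case (plus C')
      have "ereal y \<noteq> rep C'" using component_endpoint_notin[OF opens(1) plus(1), of y] yE by blast
      then have "y \<in> C'"
        using plus(2) unfolding component_mem_iff[OF opens(1) plus(1)] by (auto simp: plus_region_def)
      then show ?thesis using components_disjoint[OF C plus(1) y] plus by simp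
    next
      case (minus C')
      have "y \<notin> C'" using E_plus_disjoint[OF yE] in_components_subset[OF minus(1)] by auto
      then have "ereal y = lep C'"
        using minus(2) unfolding component_mem_iff[OF opens(2) minus(1)] by (auto simp: plus_region_def)
      then have "cdf \<mu> y \<le> cdf \<nu> y" by (rule component_E_plus_left[OF N M minus(1)])
      then show ?thesis using yE by (auto simp: E_plus_def)
    next
      case diag
      then show ?thesis using yE by (auto simp: E_eq_def)
    qed
  next
    assume y: "ereal y = rep C \<and> x < y"
    from z show ?thesis
    proof (cases rule: plan_support_cases)
      case (plus C')
      have "y \<notin> E_plus \<mu> \<nu>" using component_endpoint_notin[OF opens(1) C] y by auto
      then have "y \<notin> C'" using in_components_subset[OF plus(1)] by auto
      then have y': "ereal y = rep C'"
        using plus(2) unfolding component_mem_iff[OF opens(1) plus(1)] by (auto simp: plus_region_def)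
      have "max (lep C) (lep C') < ereal y"
        using component_eq_einterval(3)[OF opens(1) C] component_eq_einterval(3)[OF opens(1) plus(1)] y y' by auto
      then obtain u where u: "max (lep C) (lep C') < ereal u" "ereal u < ereal y"
        using ereal_dense2 by blast
      then have "u \<in> C" "u \<in> C'"
        unfolding component_mem_iff[OF opens(1) plus(1)] component_mem_iff[OF opens(1) C]
        using y y' by auto
      then show ?thesis using components_disjoint[OF C plus(1)] plus by auto
    qed (use y in \<open>auto simp: plus_region_def\<close>)
  qed
qed

end

section \<open>Marginals of the restriction of a plan to a region\<close>

context noncrossing_plan begin

lemma cylinder_sets [measurable]:
  "X \<in> sets borel \<Longrightarrow> X \<times> (UNIV :: real set) \<in> sets (borel :: (real \<times> real) measure)"
  "X \<in> sets borel \<Longrightarrow> (UNIV :: real set) \<times> X \<in> sets (borel :: (real \<times> real) measure)" for X :: "real set"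
  unfolding borel_prod[symmetric] by auto

text \<open>All of \<mu> on C belongs to the region. From the left endpoint a only the mass moving
  right belongs to it, and this is the flow across a, given by the difference of the distribution
  functions.\<close>

lemma emeasure_fst_plus_region:
  assumes C: "C \<in> components (E_plus \<mu> \<nu>)" and X: "X \<in> sets borel"
  shows "emeasure \<pi> (plus_region C \<inter> X \<times> UNIV) = emeasure (mu_plus \<mu> \<nu> C) X"
proof -
  note [measurable] = X
  have oC: "open C" using open_components[OF open_E_plus[OF fb] C] .
  then have [measurable]: "C \<in> sets borel" by simp
  let ?A = "{z. fst z \<in> X \<and> ereal (fst z) = lep C \<and> fst z < snd z}"
  have "emeasure \<pi> (plus_region C \<inter> X \<times> UNIV) = emeasure \<pi> ({z. fst z \<in> C \<inter> X} \<union> ?A)"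
  proof (rule emeasure_eq_AE)
    show "AE z in \<pi>. z \<in> plus_region C \<inter> X \<times> UNIV \<longleftrightarrow> z \<in> {z. fst z \<in> C \<inter> X} \<union> ?A"
      using AE_plan_support
    proof eventually_elim
      case (elim z)
      then show ?case using plan_support_fst_iff[OF fb C, of "fst z" "snd z"] by (cases z) auto
    qed
  qed measurable
  also have "\<dots> = emeasure \<pi> {z. fst z \<in> C \<inter> X} + emeasure \<pi> ?A"
    using component_eq_einterval(1)[OF open_E_plus[OF fb] C]
    by (intro plus_emeasure[symmetric]) (auto simp: component_mem_iff[OF open_E_plus[OF fb] C])
  also have "{z. fst z \<in> C \<inter> X} = (C \<inter> X) \<times> (UNIV :: real set)" by auto
  also have "emeasure \<pi> ((C \<inter> X) \<times> UNIV) = emeasure \<mu> (C \<inter> X)"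
    by (rule MargD(5)[OF Marg, symmetric]) simp
  also have "emeasure \<pi> ?A = emeasure (atom_at (lep C) (\<lambda>a. cdf \<mu> a - cdf \<nu> a)) X"
  proof (cases "\<bar>lep C\<bar> \<noteq> \<infinity> \<and> real_of_ereal (lep C) \<in> X")
    case True
    then obtain a where a: "lep C = ereal a" "a \<in> X" by (cases "lep C") auto
    have aE: "a \<notin> E_plus \<mu> \<nu>" using component_endpoint_notin[OF open_E_plus[OF fb] C, of a] a by simp
    \<comment> \<open>Almost no pair passes strictly over a, so the flow across a starts at a
      itself.\<close>
    have "emeasure \<pi> ?A = emeasure \<pi> {z. fst z \<le> a \<and> a < snd z}"
    proof (rule emeasure_eq_AE)
      show "AE z in \<pi>. z \<in> ?A \<longleftrightarrow> z \<in> {z. fst z \<le> a \<and> a < snd z}"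
        using AE_not_crossing[OF aE] by eventually_elim (use a in auto)
    qed measurable
    also have "\<dots> = ennreal (cdf \<mu> a - cdf \<nu> a)"
      using component_E_plus_left[OF fb C, of a] a
      by (simp add: \<pi>.emeasure_eq_measure cross_measure)
    finally show ?thesis using a X by (simp add: emeasure_atom_at)
  next
    case False
    then have A: "?A = {}" by (auto simp: eq_commute[of _ "lep C"])
    show ?thesis unfolding A using X False by (auto simp: emeasure_atom_at)
  qed
  finally show ?thesis
    using X \<open>C \<in> sets borel\<close> MargD(3)[OF Marg]
    by (simp add: mu_plus_def emeasure_add_measure emeasure_restr add.commute)
qed

lemma emeasure_snd_plus_region:
  assumes C: "C \<in> components (E_plus \<mu> \<nu>)" and X: "X \<in> sets borel"
  shows "emeasure \<pi> (plus_region C \<inter> UNIV \<times> X) = emeasure (nu_plus \<mu> \<nu> C) X"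
proof -
  note [measurable] = X
  have oC: "open C" using open_components[OF open_E_plus[OF fb] C] .
  then have [measurable]: "C \<in> sets borel" by simp
  let ?A = "{z. snd z \<in> X \<and> ereal (snd z) = rep C \<and> fst z < snd z}"
  have "emeasure \<pi> (plus_region C \<inter> UNIV \<times> X) = emeasure \<pi> ({z. snd z \<in> C \<inter> X} \<union> ?A)"
  proof (rule emeasure_eq_AE)
    show "AE z in \<pi>. z \<in> plus_region C \<inter> UNIV \<times> X \<longleftrightarrow> z \<in> {z. snd z \<in> C \<inter> X} \<union> ?A"
      using AE_plan_support
    proof eventually_elim
      case (elim z)
      then show ?case using plan_support_snd_iff[OF fb C, of "fst z" "snd z"] by (cases z) auto
    qed
  qed measurable
  also have "\<dots> = emeasure \<pi> {z. snd z \<in> C \<inter> X} + emeasure \<pi> ?A"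
    by (intro plus_emeasure[symmetric]) (auto simp: component_mem_iff[OF open_E_plus[OF fb] C])
  also have "{z. snd z \<in> C \<inter> X} = (UNIV :: real set) \<times> (C \<inter> X)" by auto
  also have "emeasure \<pi> (UNIV \<times> (C \<inter> X)) = emeasure \<nu> (C \<inter> X)"
    by (rule MargD(6)[OF Marg, symmetric]) simp
  also have "emeasure \<pi> ?A = emeasure (atom_at (rep C) (\<lambda>b. cdf_left \<mu> b - cdf_left \<nu> b)) X"
  proof (cases "\<bar>rep C\<bar> \<noteq> \<infinity> \<and> real_of_ereal (rep C) \<in> X")
    case True
    then obtain b where b: "rep C = ereal b" "b \<in> X" by (cases "rep C") auto
    have bE: "b \<notin> E_plus \<mu> \<nu>" using component_endpoint_notin[OF open_E_plus[OF fb] C, of b] b by simp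
    have "emeasure \<pi> ?A = emeasure \<pi> {z. fst z < b \<and> b \<le> snd z}"
    proof (rule emeasure_eq_AE)
      show "AE z in \<pi>. z \<in> ?A \<longleftrightarrow> z \<in> {z. fst z < b \<and> b \<le> snd z}"
        using AE_not_crossing[OF bE] by eventually_elim (use b in auto)
    qed measurable
    also have "\<dots> = ennreal (cdf_left \<mu> b - cdf_left \<nu> b)"
      using component_E_plus_right[OF fb C, of b] b
      by (simp add: \<pi>.emeasure_eq_measure cross_measure)
    finally show ?thesis using b X by (simp add: emeasure_atom_at)
  next
    case False
    then have A: "?A = {}" by (auto simp: eq_commute[of _ "rep C"])
    show ?thesis unfolding A using X False by (auto simp: emeasure_atom_at)
  qed
  finally show ?thesis
    using X \<open>C \<in> sets borel\<close> MargD(4)[OF Marg]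
    by (simp add: nu_plus_def emeasure_add_measure emeasure_restr)
qed

lemma restr_plus_region_Marg:
  assumes C: "C \<in> components (E_plus \<mu> \<nu>)"
  shows "restr \<pi> (plus_region C) \<in> Marg (mu_plus \<mu> \<nu> C) (nu_plus \<mu> \<nu> C)"
proof (rule MargI)
  show "finite_measure (restr \<pi> (plus_region C))"
    by (rule finite_measure_restr) (auto intro: \<pi>.finite_measure_axioms)
qed (auto simp: emeasure_restr emeasure_fst_plus_region[OF C] emeasure_snd_plus_region[OF C]
       cylinder_sets mu_plus_def nu_plus_def)

end

section \<open>Existence of Kellerer plans\<close>

text \<open>Compares an integral over a short interval with that of a constant. With
  \<open>c = 0\<close> it serves as a plain bound and as an integrability test.\<close>

lemma set_integral_approx:
  fixes f :: "real \<Rightarrow> real"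
  assumes M: "finite_borel_measure M" and S: "S \<in> sets borel" and f: "f \<in> borel_measurable borel"
    and le: "\<And>x. x \<in> S \<Longrightarrow> \<bar>f x - c\<bar> \<le> e"
  shows "set_integrable M S f" and "\<bar>(LINT x:S|M. f x) - c * measure M S\<bar> \<le> e * measure M S"
proof -
  interpret finite_borel_measure M by fact
  have [measurable]: "S \<in> sets M" "f \<in> borel_measurable M"
    using S f by (auto simp: measurable_cong_sets[OF M_is_borel refl])
  have bound: "\<bar>f x\<bar> \<le> \<bar>c\<bar> + \<bar>e\<bar>" if "x \<in> S" for x using le[OF that] by linarith
  show int: "set_integrable M S f"
    unfolding set_integrable_def
    by (rule integrable_const_bound[of _ "\<bar>c\<bar> + \<bar>e\<bar>"]) (use bound in \<open>auto simp: indicator_def\<close>)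
  have intc: "set_integrable M S (\<lambda>x. d)" for d :: real
    unfolding set_integrable_def by (rule integrable_const_bound[of _ "\<bar>d\<bar>"]) (auto simp: indicator_def)
  have const: "(LINT x:S|M. d) = d * measure M S" for d :: real
    by (simp add: set_lebesgue_integral_def mult.commute)
  have "\<bar>(LINT x:S|M. f x) - c * measure M S\<bar> = \<bar>LINT x:S|M. f x - c\<bar>"
    by (subst set_integral_diff) (auto simp: int intc const)
  also have "\<dots> \<le> (LINT x:S|M. \<bar>f x - c\<bar>)"
    using set_integral_norm_bound[OF set_integral_diff(1)[OF int intc], of c] by simp
  also have "\<dots> \<le> (LINT x:S|M. e)"
    using set_integrable_abs[OF set_integral_diff(1)[OF int intc], of c]
    by (intro set_integral_mono intc le) auto
  finally show "\<bar>(LINT x:S|M. f x) - c * measure M S\<bar> \<le> e * measure M S" by (simp add: const)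
qed

text \<open>Atoms at the left end \<open>s\<close> are invisible to \<open>{s<..<t}\<close>: a function with increments of
  second order in \<open>\<lambda>\<close> cannot jump at an atom, and elsewhere its increments are negligible.\<close>

lemma constant_if_quadratic_increments:
  fixes Z :: "real \<Rightarrow> real"
  assumes L: "finite_borel_measure L" and "s\<^sub>0 \<le> t\<^sub>0"
    and Z: "\<And>s t. s\<^sub>0 \<le> s \<Longrightarrow> s < t \<Longrightarrow> t \<le> t\<^sub>0 \<Longrightarrow> \<bar>Z t - Z s\<bar> \<le> K * (measure L {s<..<t})\<^sup>2"
  shows "Z t\<^sub>0 = Z s\<^sub>0"
proof -
  interpret finite_borel_measure L by fact
  define K' where "K' = max K 0 + 1"
  have K': "K' > 0" "K \<le> K'" by (auto simp: K'_def)
  have Z': "\<bar>Z t - Z s\<bar> \<le> K' * (measure L {s<..<t})\<^sup>2" if "s\<^sub>0 \<le> s" "s < t" "t \<le> t\<^sub>0" for s t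
    using Z[OF that] K'(2) mult_right_mono[OF K'(2), of "(measure L {s<..<t})\<^sup>2"] by simp
  have main: "\<bar>Z t\<^sub>0 - Z s\<^sub>0\<bar> \<le> \<epsilon> * measure L {s\<^sub>0..<t\<^sub>0}" if \<epsilon>: "\<epsilon> > 0" for \<epsilon>
  proof -
    \<comment> \<open>The half-open interval includes the left end, which makes the bound additive
      under subdivision, while each increment is charged with the open interval only.\<close>
    define P where "P s t \<longleftrightarrow> (s\<^sub>0 \<le> s \<longrightarrow> s \<le> t \<longrightarrow> t \<le> t\<^sub>0 \<longrightarrow> \<bar>Z t - Z s\<bar> \<le> \<epsilon> * measure L {s..<t})" for s t
    have add: "measure L {s..<t} = measure L {s..<x} + measure L {x..<t}" if "s \<le> x" "x \<le> t" for s x t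
    proof -
      have eq: "{s..<t} = {s..<x} \<union> {x..<t}" using that by auto
      show ?thesis unfolding eq by (rule finite_measure_Union) auto
    qed
    have "P s\<^sub>0 t\<^sub>0"
    proof (rule Bolzano)
      fix a b c assume "P a b" "P b c" "a \<le> b" "b \<le> c"
      then show "P a c" unfolding P_def using add[of a b c] by (auto simp: algebra_simps)
    next
      fix x
      define \<eta> where "\<eta> = \<epsilon> / K'"
      have \<eta>: "\<eta> > 0" using \<epsilon> K' by (simp add: \<eta>_def)
      \<comment> \<open>Both punctured one-sided neighbourhoods of x get mass at most
        \<open>\<eta>\<close>, however large the atom at x is.\<close>
      obtain b where b: "x < b" "cdf L b < cdf L x + \<eta>" using cdf_less_right[OF L, of x "cdf L x + \<eta>"] \<eta> by auto
      obtain a where a: "a < x" "cdf_left L x - \<eta> < cdf L a" using less_cdf_left[OF L, of "cdf_left L x - \<eta>" x] \<eta> by auto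
      have right: "measure L {x<..<t} \<le> \<eta>" if "t \<le> b" for t
      proof -
        have "measure L {x<..<t} \<le> measure L {x<..b}" using that by (intro finite_measure_mono) auto
        also have "\<dots> = cdf L b - cdf L x" using cdf_diff_eq[of x b] b(1) by simp
        finally show ?thesis using b by simp
      qed
      have left: "measure L {s<..<x} \<le> \<eta>" if "a \<le> s" for s
      proof -
        have eq: "{..<x} = {..a} \<union> {a<..<x}" using a(1) by auto
        have "cdf_left L x = cdf L a + measure L {a<..<x}"
          unfolding cdf_left_def cdf_def eq by (rule finite_measure_Union) auto
        moreover have "measure L {s<..<x} \<le> measure L {a<..<x}" using that by (intro finite_measure_mono) auto
        ultimately show ?thesis using a by simp
      qed
      \<comment> \<open>One factor of the square is at most \<open>\<eta>\<close> and pays for the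
        constant, since \<open>K' * \<eta> = \<epsilon>\<close>; the other is kept, because it adds
        up.\<close>
      have small: "\<bar>Z t - Z s\<bar> \<le> \<epsilon> * measure L {s..<t}" if "s\<^sub>0 \<le> s" "s \<le> t" "t \<le> t\<^sub>0" "measure L {s<..<t} \<le> \<eta>" for s t
      proof (cases "s = t")
        case False
        have "\<bar>Z t - Z s\<bar> \<le> K' * (measure L {s<..<t})\<^sup>2" using Z' that False by simp
        also have "\<dots> = (K' * measure L {s<..<t}) * measure L {s<..<t}" by (simp add: power2_eq_square)
        also have "\<dots> \<le> \<epsilon> * measure L {s..<t}"
        proof (rule mult_mono)
          show "K' * measure L {s<..<t} \<le> \<epsilon>" using that(4) K' by (simp add: \<eta>_def field_simps)
          show "measure L {s<..<t} \<le> measure L {s..<t}" by (rule finite_measure_mono) auto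
        qed (use \<epsilon> in auto)
        finally show ?thesis .
      qed simp
      show "\<exists>d>0. \<forall>s t. s \<le> x \<and> x \<le> t \<and> t - s < d \<longrightarrow> P s t"
      proof (intro exI[of _ "min (b - x) (x - a)"] conjI allI impI)
        fix s t assume st: "s \<le> x \<and> x \<le> t \<and> t - s < min (b - x) (x - a)"
        show "P s t" unfolding P_def
        proof (intro impI)
          assume "s\<^sub>0 \<le> s" "s \<le> t" "t \<le> t\<^sub>0"
          then have "\<bar>Z x - Z s\<bar> \<le> \<epsilon> * measure L {s..<x}" "\<bar>Z t - Z x\<bar> \<le> \<epsilon> * measure L {x..<t}"
            using st by (auto intro!: small left right)
          then show "\<bar>Z t - Z s\<bar> \<le> \<epsilon> * measure L {s..<t}"
            using add[of s x t] st by (auto simp: algebra_simps)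
        qed
      qed (use a b in auto)
    qed (fact)
    then show ?thesis using \<open>s\<^sub>0 \<le> t\<^sub>0\<close> by (simp add: P_def)
  qed
  have "\<bar>Z t\<^sub>0 - Z s\<^sub>0\<bar> \<le> 0"
  proof (rule field_le_epsilon)
    fix e :: real assume "e > 0"
    have aux: "e / (m + 1) * m \<le> e" if "0 \<le> m" for m :: real
      using that \<open>e > 0\<close> by (auto simp: divide_simps algebra_simps)
    have "\<bar>Z t\<^sub>0 - Z s\<^sub>0\<bar> \<le> (e / (measure L {s\<^sub>0..<t\<^sub>0} + 1)) * measure L {s\<^sub>0..<t\<^sub>0}"
      using \<open>e > 0\<close> by (intro main divide_pos_pos) (auto intro: add_nonneg_pos)
    also have "\<dots> \<le> e"
      by (rule aux) simp
    finally show "\<bar>Z t\<^sub>0 - Z s\<^sub>0\<bar> \<le> 0 + e" by simp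
  qed
  then show ?thesis by simp
qed

text \<open>Collects what the construction uses about a component. The ends may be infinite, and a
  finite end may carry an atom of \<open>\<gamma>\<^sub>1\<close> at a or of
  \<open>\<gamma>\<^sub>2\<close> at b. The crossing mass is positive inside but may tend to 0 at
  the ends.\<close>

locale kellerer_pair =
  fixes \<gamma>\<^sub>1 \<gamma>\<^sub>2 :: "real measure" and a b :: ereal
  assumes fb1: "finite_borel_measure \<gamma>\<^sub>1" and fb2: "finite_borel_measure \<gamma>\<^sub>2" and ab: "a < b"
    and conc1: "AE x in \<gamma>\<^sub>1. a \<le> ereal x \<and> ereal x < b"
    and conc2: "AE y in \<gamma>\<^sub>2. a < ereal y \<and> ereal y \<le> b"
    and mass: "measure \<gamma>\<^sub>1 UNIV = measure \<gamma>\<^sub>2 UNIV"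
    and pos: "\<And>t. a < ereal t \<Longrightarrow> ereal t < b \<Longrightarrow> cdf \<gamma>\<^sub>2 t < cdf \<gamma>\<^sub>1 t"
    and pos_left: "\<And>t. a < ereal t \<Longrightarrow> ereal t < b \<Longrightarrow> cdf_left \<gamma>\<^sub>2 t < cdf_left \<gamma>\<^sub>1 t"
begin

sublocale g1: finite_borel_measure \<gamma>\<^sub>1 by (rule fb1)
sublocale g2: finite_borel_measure \<gamma>\<^sub>2 by (rule fb2)

definition "C = {x. a < ereal x \<and> ereal x < b}"
text \<open>For a coupling concentrated on F, \<open>D_left t\<close> is the mass of x < t \<le> y
  and \<open>D_right t\<close> the mass of x \<le> t < y.\<close>

definition "D_left t = cdf_left \<gamma>\<^sub>1 t - cdf_left \<gamma>\<^sub>2 t"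
definition "D_right t = cdf \<gamma>\<^sub>1 t - cdf \<gamma>\<^sub>2 t"

lemma D_pos: "t \<in> C \<Longrightarrow> D_left t > 0" "t \<in> C \<Longrightarrow> D_right t > 0"
  using pos pos_left by (auto simp: C_def D_left_def D_right_def)

lemma C_between: "s \<in> C \<Longrightarrow> t \<in> C \<Longrightarrow> s \<le> x \<Longrightarrow> x \<le> t \<Longrightarrow> x \<in> C"
proof -
  assume "s \<in> C" "t \<in> C" "s \<le> x" "x \<le> t"
  then have "a < ereal s" "ereal s \<le> ereal x" "ereal x \<le> ereal t" "ereal t < b" by (auto simp: C_def)
  then show "x \<in> C" unfolding C_def using less_le_trans le_less_trans by blast
qed

lemma C_measurable [measurable]: "C \<in> sets borel"
  unfolding C_def by measurable

lemma cdf_split: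
  assumes "finite_borel_measure M"
  shows "cdf M t = cdf_left M t + measure M {t}"
    and "s < t \<Longrightarrow> cdf_left M t = cdf M s + measure M {s<..<t}"
proof -
  interpret finite_borel_measure M by fact
  have eq: "{..t} = {..<t} \<union> {t}" by auto
  show "cdf M t = cdf_left M t + measure M {t}"
    unfolding cdf_left_def cdf_def eq by (rule finite_measure_Union) auto
  assume "s < t"
  then have eq: "{..<t} = {..s} \<union> {s<..<t}" by auto
  show "cdf_left M t = cdf M s + measure M {s<..<t}"
    unfolding cdf_left_def cdf_def eq by (rule finite_measure_Union) auto
qed

lemma D_right_eq: "D_right t = D_left t + measure \<gamma>\<^sub>1 {t} - measure \<gamma>\<^sub>2 {t}"
  unfolding D_left_def D_right_def by (simp add: cdf_split(1)[OF fb1] cdf_split(1)[OF fb2])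

lemma D_left_eq: "s < t \<Longrightarrow> D_left t = D_right s + measure \<gamma>\<^sub>1 {s<..<t} - measure \<gamma>\<^sub>2 {s<..<t}"
  unfolding D_left_def D_right_def by (simp add: cdf_split(2)[OF fb1] cdf_split(2)[OF fb2])

lemma cdf_measurable [measurable]:
  assumes "finite_borel_measure M"
  shows "cdf M \<in> borel_measurable borel" "cdf_left M \<in> borel_measurable borel"
proof -
  interpret finite_borel_measure M by fact
  show "cdf M \<in> borel_measurable borel"
    by (intro borel_measurable_mono monoI cdf_nondecreasing)
  show "cdf_left M \<in> borel_measurable borel"
    unfolding cdf_left_def by (intro borel_measurable_mono monoI finite_measure_mono) auto
qed

lemma D_measurable [measurable]: "D_left \<in> borel_measurable borel" "D_right \<in> borel_measurable borel"
  unfolding D_left_def[abs_def] D_right_def[abs_def]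
  using cdf_measurable[OF fb1] cdf_measurable[OF fb2] by measurable

lemma atom_measurable [measurable]: "(\<lambda>x. measure \<gamma>\<^sub>1 {x}) \<in> borel_measurable borel"
proof -
  have "(\<lambda>x. measure \<gamma>\<^sub>1 {x}) = (\<lambda>x. cdf \<gamma>\<^sub>1 x - cdf_left \<gamma>\<^sub>1 x)"
    by (simp add: cdf_split(1)[OF fb1])
  then show ?thesis using cdf_measurable[OF fb1] by simp
qed

text \<open>The two functions jump, so positivity on a compact interval does not bound them below by
  continuity. Near each x, however, the values on the right are at least half of
  \<open>D_right x\<close> and those on the left at least half of \<open>D_left x\<close>; bisection
  glues these local bounds.\<close>

lemma D_lower_bound:
  assumes "s \<in> C" "t \<in> C" "s \<le> t"
  obtains \<delta> where "\<delta> > 0" "\<And>x. s \<le> x \<Longrightarrow> x \<le> t \<Longrightarrow> \<delta> \<le> D_left x \<and> \<delta> \<le> D_right x"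
proof -
  define P where "P u v \<longleftrightarrow> (s \<le> u \<longrightarrow> v \<le> t \<longrightarrow> (\<exists>\<delta>>0. \<forall>x\<in>{u..v}. \<delta> \<le> D_left x \<and> \<delta> \<le> D_right x))" for u v
  have "P s t"
  proof (rule Bolzano)
    fix u v w assume "P u v" "P v w" and le: "u \<le> v" "v \<le> w"
    show "P u w" unfolding P_def
    proof (intro impI)
      assume "s \<le> u" "w \<le> t"
      then obtain \<delta> \<delta>' where d: "\<delta> > 0" "\<forall>x\<in>{u..v}. \<delta> \<le> D_left x \<and> \<delta> \<le> D_right x"
        "\<delta>' > 0" "\<forall>x\<in>{v..w}. \<delta>' \<le> D_left x \<and> \<delta>' \<le> D_right x"
        using \<open>P u v\<close> \<open>P v w\<close> le unfolding P_def by (meson order_trans)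
      show "\<exists>\<delta>>0. \<forall>x\<in>{u..w}. \<delta> \<le> D_left x \<and> \<delta> \<le> D_right x"
      proof (intro exI[of _ "min \<delta> \<delta>'"] conjI ballI)
        fix x assume "x \<in> {u..w}"
        then have "x \<in> {u..v} \<or> x \<in> {v..w}" by auto
        then show "min \<delta> \<delta>' \<le> D_left x" "min \<delta> \<delta>' \<le> D_right x" using d by (auto simp: min_le_iff_disj)
      qed (use d in auto)
    qed
  next
    fix x assume x: "s \<le> x" "x \<le> t"
    have xC: "x \<in> C" using C_between assms x by blast
    note D = D_pos[OF xC]
    obtain v where v: "x < v" "cdf \<gamma>\<^sub>2 v < cdf \<gamma>\<^sub>2 x + D_right x / 2"
      using cdf_less_right[OF fb2, of x "cdf \<gamma>\<^sub>2 x + D_right x / 2"] D by auto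
    obtain u where u: "u < x" "cdf_left \<gamma>\<^sub>1 x - D_left x / 2 < cdf \<gamma>\<^sub>1 u"
      using less_cdf_left[OF fb1, of "cdf_left \<gamma>\<^sub>1 x - D_left x / 2" x] D by auto
    have right: "D_right x / 2 \<le> D_left y \<and> D_right x / 2 \<le> D_right y" if "x < y" "y < v" for y
    proof -
      have "cdf \<gamma>\<^sub>1 x \<le> cdf_left \<gamma>\<^sub>1 y" "cdf_left \<gamma>\<^sub>1 y \<le> cdf \<gamma>\<^sub>1 y" "cdf_left \<gamma>\<^sub>2 y \<le> cdf \<gamma>\<^sub>2 y" "cdf \<gamma>\<^sub>2 y \<le> cdf \<gamma>\<^sub>2 v"
        using that fb1 fb2 by (auto intro: cdf_le_cdf_left cdf_left_le_cdf g2.cdf_nondecreasing)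
      then show ?thesis using v(2) unfolding D_left_def D_right_def by (simp add: field_simps)
    qed
    have left: "D_left x / 2 \<le> D_left y \<and> D_left x / 2 \<le> D_right y" if "u < y" "y < x" for y
    proof -
      have "cdf \<gamma>\<^sub>1 u \<le> cdf_left \<gamma>\<^sub>1 y" "cdf_left \<gamma>\<^sub>1 y \<le> cdf \<gamma>\<^sub>1 y" "cdf_left \<gamma>\<^sub>2 y \<le> cdf \<gamma>\<^sub>2 y" "cdf \<gamma>\<^sub>2 y \<le> cdf_left \<gamma>\<^sub>2 x"
        using that fb1 fb2 by (auto intro: cdf_le_cdf_left cdf_left_le_cdf)
      then show ?thesis using u(2) unfolding D_left_def D_right_def by (simp add: field_simps)
    qed
    show "\<exists>d>0. \<forall>u v. u \<le> x \<and> x \<le> v \<and> v - u < d \<longrightarrow> P u v"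
    proof (intro exI[of _ "min (v - x) (x - u)"] conjI allI impI)
      fix u' v' assume *: "u' \<le> x \<and> x \<le> v' \<and> v' - u' < min (v - x) (x - u)"
      define \<delta> where "\<delta> = min (D_left x / 2) (D_right x / 2)"
      have "\<delta> \<le> D_left y \<and> \<delta> \<le> D_right y" if y: "y \<in> {u'..v'}" for y
      proof -
        consider "y < x" "u < y" | "y = x" | "x < y" "y < v" using y * by fastforce
        then show ?thesis using left[of y] right[of y] D by cases (auto simp: \<delta>_def min_le_iff_disj)
      qed
      moreover have "\<delta> > 0" using D by (simp add: \<delta>_def)
      ultimately show "P u' v'" unfolding P_def by blast
    qed (use u v in auto)
  qed (fact)
  then show ?thesis using that unfolding P_def by auto
qed

end

section \<open>The product integral \<open>A_left\<close> and its partner \<open>B\<close>\<close>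

lemma exp_minus_one_le: "exp x - 1 \<le> x * exp (x :: real)"
proof -
  have "(1 - x) * exp x \<le> exp (- x) * exp x"
    using exp_ge_add_one_self[of "- x"] by (intro mult_right_mono) auto
  then show ?thesis by (simp add: exp_minus_inverse algebra_simps mult_exp_exp)
qed

lemma inverse_diff_le:
  fixes u v \<delta> :: real
  assumes "0 < \<delta>" "\<delta> \<le> u" "\<delta> \<le> v" "\<bar>u - v\<bar> \<le> l"
  shows "\<bar>1 / u - 1 / v\<bar> \<le> l / \<delta>\<^sup>2"
proof -
  have "\<bar>1 / u - 1 / v\<bar> = \<bar>u - v\<bar> / (u * v)"
    using assms by (simp add: divide_simps abs_mult abs_minus_commute)
  also have "\<dots> \<le> l / \<delta>\<^sup>2"
    using assms by (intro frac_le) (auto simp: power2_eq_square intro!: mult_mono)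
  finally show ?thesis .
qed

context kellerer_pair begin

definition "atom x = measure \<gamma>\<^sub>1 {x}"

text \<open>The exponent is chosen such that \<open>exp (ell x * atom x) = 1 + atom x / D_left x\<close>, which is the
  factor by which \<open>A\<close> has to jump at an atom of \<open>\<gamma>\<^sub>1\<close>.\<close>

definition "ell x = (if atom x = 0 then 1 / D_left x else ln (1 + atom x / D_left x) / atom x)"
text \<open>An interior starting point is chosen because \<open>ell\<close> may fail to be
  integrable up to the ends of C, where D can vanish. Another choice multiplies
  \<open>A_left\<close> on C by a constant and \<open>B\<close> by its inverse.\<close>

definition "base = (SOME x. x \<in> C)"
definition "Lam t = (\<integral>x. ell x * (indicator {base..<t} x - indicator {t..<base} x) \<partial>\<gamma>\<^sub>1)"
text \<open>On C, up to scaling, \<open>A_left t\<close>, \<open>A t\<close> and \<open>B t\<close>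
  are the future masses \<open>\<eta>\<^sub>1\<close> of ]-\<infinity>,
  t[, \<open>\<eta>\<^sub>1\<close> of ]-\<infinity>, t] and \<open>\<eta>\<^sub>2\<close> of [t,
  \<infinity>[. The default 1 outside C keeps \<open>A_left\<close> positive everywhere.\<close>

definition "A_left t = (if t \<in> C then exp (Lam t) else 1)"
definition "A t = A_left t * (1 + atom t / D_left t)"
definition "B t = D_left t / A_left t"

lemma atom_nonneg [simp]: "0 \<le> atom x" by (simp add: atom_def)

lemma base_in_C: "base \<in> C"
proof -
  obtain x where "a < ereal x" "ereal x < b" using ereal_dense2[OF ab] by blast
  then have "x \<in> C" by (simp add: C_def)
  then show ?thesis unfolding base_def by (rule someI)
qed

lemma A_left_pos [simp]: "0 < A_left t" by (simp add: A_left_def)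

lemma A_pos: "t \<in> C \<Longrightarrow> 0 < A t"
  unfolding A_def using D_pos(1)[of t] by (intro mult_pos_pos) (auto intro!: add_pos_nonneg)

lemma B_pos: "t \<in> C \<Longrightarrow> 0 < B t"
  unfolding B_def using D_pos(1)[of t] by (intro divide_pos_pos) auto

lemma ell_measurable [measurable]: "ell \<in> borel_measurable borel"
  unfolding ell_def[abs_def] atom_def by measurable

lemma meas1: "f \<in> borel_measurable borel \<Longrightarrow> f \<in> borel_measurable \<gamma>\<^sub>1"
  by (auto simp: measurable_cong_sets[OF g1.M_is_borel refl])

lemma meas2: "f \<in> borel_measurable borel \<Longrightarrow> f \<in> borel_measurable \<gamma>\<^sub>2"
  by (auto simp: measurable_cong_sets[OF g2.M_is_borel refl])

text \<open>With z = \<open>atom x / D_left x\<close> this is z / (1 + z) \<le> ln (1 + z) \<le> z.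
  The two bounds are the inverses of the crossing mass before and after the atom of
  \<open>\<gamma>\<^sub>1\<close>, so \<open>ell\<close> is close to 1 / D wherever D varies
  little.\<close>

lemma ell_bounds:
  assumes "x \<in> C"
  shows "1 / (D_left x + atom x) \<le> ell x" "ell x \<le> 1 / D_left x"
    "exp (ell x * atom x) = 1 + atom x / D_left x"
proof -
  note D = D_pos(1)[OF assms]
  have "1 / (D_left x + atom x) \<le> ell x \<and> ell x \<le> 1 / D_left x \<and> exp (ell x * atom x) = 1 + atom x / D_left x"
  proof (cases "atom x = 0")
    case False
    then have at: "atom x > 0" using atom_nonneg[of x] by linarith
    define z where "z = atom x / D_left x"
    have z: "z > 0" using at D by (simp add: z_def)
    have up: "ln (1 + z) \<le> z" using z by (intro ln_add_one_self_le_self) simp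
    have "ln (1 / (1 + z)) \<le> 1 / (1 + z) - 1" using z by (intro ln_le_minus_one) simp
    then have lo: "z / (1 + z) \<le> ln (1 + z)" using z by (simp add: ln_div field_simps)
    have ell: "ell x = ln (1 + z) / atom x" using False by (simp add: ell_def z_def)
    have "1 / (D_left x + atom x) = (z / (1 + z)) / atom x"
      using at D by (simp add: z_def divide_simps)
    also have "\<dots> \<le> ell x" unfolding ell using lo at by (intro divide_right_mono) auto
    finally have 1: "1 / (D_left x + atom x) \<le> ell x" .
    have "ell x \<le> z / atom x" unfolding ell using up at by (intro divide_right_mono) auto
    also have "\<dots> = 1 / D_left x" using at by (simp add: z_def)
    finally have 2: "ell x \<le> 1 / D_left x" .
    have "exp (ell x * atom x) = 1 + z" unfolding ell using at z by simp
    with 1 2 show ?thesis by (simp add: z_def)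
  qed (auto simp: ell_def)
  then show "1 / (D_left x + atom x) \<le> ell x" "ell x \<le> 1 / D_left x"
    "exp (ell x * atom x) = 1 + atom x / D_left x" by auto
qed

lemma ell_nonneg: "x \<in> C \<Longrightarrow> 0 \<le> ell x"
  using ell_bounds(1)[of x] D_pos(1)[of x] atom_nonneg[of x]
  by (smt (verit) divide_nonneg_nonneg)

lemma ell_integrable:
  assumes "u \<in> C" "v \<in> C"
  shows "set_integrable \<gamma>\<^sub>1 {u..<v} ell"
proof (cases "u \<le> v")
  case True
  obtain \<delta> where \<delta>: "\<delta> > 0" "\<And>x. u \<le> x \<Longrightarrow> x \<le> v \<Longrightarrow> \<delta> \<le> D_left x \<and> \<delta> \<le> D_right x"
    using D_lower_bound[OF assms True] by blast
  show ?thesis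
  proof (rule set_integral_approx(1)[OF fb1])
    fix x assume x: "x \<in> {u..<v}"
    then have xC: "x \<in> C" using C_between[OF assms] by auto
    have "ell x \<le> 1 / D_left x" by (rule ell_bounds[OF xC])
    also have "\<dots> \<le> 1 / \<delta>" using \<delta>(1) \<delta>(2)[of x] x by (intro frac_le) auto
    finally show "\<bar>ell x - 0\<bar> \<le> 1 / \<delta>" using ell_nonneg[OF xC] by simp
  qed auto
qed (simp add: set_integrable_def)

lemma Lam_diff:
  assumes "s \<in> C" "t \<in> C" "s \<le> t"
  shows "Lam t - Lam s = (LINT x:{s..<t}|\<gamma>\<^sub>1. ell x)"
proof -
  have int: "integrable \<gamma>\<^sub>1 (\<lambda>x. ell x * (indicator {base..<u} x - indicator {u..<base} x))" if "u \<in> C" for u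
    using Bochner_Integration.integrable_diff[OF ell_integrable[OF base_in_C that, unfolded set_integrable_def]
        ell_integrable[OF that base_in_C, unfolded set_integrable_def]]
    by (simp add: algebra_simps)
  have "Lam t - Lam s = (\<integral>x. ell x * (indicator {base..<t} x - indicator {t..<base} x)
      - ell x * (indicator {base..<s} x - indicator {s..<base} x) \<partial>\<gamma>\<^sub>1)"
    unfolding Lam_def by (rule Bochner_Integration.integral_diff[symmetric]) (use assms int in auto)
  also have "\<dots> = (LINT x:{s..<t}|\<gamma>\<^sub>1. ell x)"
    unfolding set_lebesgue_integral_def using assms(3)
    by (intro Bochner_Integration.integral_cong) (auto simp: indicator_def)
  finally show ?thesis .
qed

lemma set_integral_split_left:
  fixes f :: "real \<Rightarrow> real"
  assumes M: "finite_borel_measure M" and "set_integrable M {s..<t} f" "s < t"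
  shows "(LINT x:{s..<t}|M. f x) = f s * measure M {s} + (LINT x:{s<..<t}|M. f x)"
proof -
  interpret finite_borel_measure M by fact
  have eq: "{s..<t} = {s} \<union> {s<..<t}" using assms(3) by auto
  have "(LINT x:{s..<t}|M. f x) = (LINT x:{s}|M. f x) + (LINT x:{s<..<t}|M. f x)"
    unfolding eq by (rule set_integral_Un) (use assms(3) in \<open>auto intro!: set_integrable_subset[OF assms(2)]\<close>)
  also have "(LINT x:{s}|M. f x) = (LINT x:{s}|M. f s)"
    unfolding set_lebesgue_integral_def by (intro Bochner_Integration.integral_cong) (auto simp: indicator_def)
  also have "\<dots> = f s * measure M {s}"
    using sets_eq_imp_space_eq[OF M_is_borel] by (simp add: set_lebesgue_integral_def mult.commute)
  finally show ?thesis .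
qed

text \<open>The jump at s is absorbed in \<open>A s\<close>, which leaves an open interval whose
  mass is small when t is close to s.\<close>

lemma A_left_step:
  assumes "s \<in> C" "t \<in> C" "s < t"
  shows "A_left t = A s * exp (LINT x:{s<..<t}|\<gamma>\<^sub>1. ell x)"
proof -
  have "Lam t = Lam s + ell s * atom s + (LINT x:{s<..<t}|\<gamma>\<^sub>1. ell x)"
    using Lam_diff[of s t] set_integral_split_left[OF fb1 ell_integrable[OF assms(1,2)] assms(3)] assms
    by (simp add: atom_def)
  then have "exp (Lam t) = exp (Lam s) * exp (ell s * atom s) * exp (LINT x:{s<..<t}|\<gamma>\<^sub>1. ell x)"
    by (simp add: exp_add)
  then show ?thesis using assms by (simp add: A_left_def A_def ell_bounds(3))
qed

lemma ell_integral_nonneg: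
  assumes "s \<in> C" "t \<in> C"
  shows "0 \<le> (LINT x:{s<..<t}|\<gamma>\<^sub>1. ell x)"
  unfolding set_lebesgue_integral_def
  by (rule Bochner_Integration.integral_nonneg)
     (use C_between[OF assms] ell_nonneg in \<open>auto simp: indicator_def\<close>)

lemma A_left_le_A: "s \<in> C \<Longrightarrow> A_left s \<le> A s"
  unfolding A_def using D_pos(1)[of s] mult_left_mono[of 1 "1 + atom s / D_left s" "A_left s"] A_left_pos[of s]
  by (simp add: less_imp_le)

lemma A_le_A_left:
  assumes "s \<in> C" "t \<in> C" "s < t"
  shows "A s \<le> A_left t"
  unfolding A_left_step[OF assms] using A_pos[OF assms(1)] ell_integral_nonneg[OF assms(1,2)]
  by (simp add: mult_le_cancel_left1)

lemma A_left_mono: "s \<in> C \<Longrightarrow> t \<in> C \<Longrightarrow> s \<le> t \<Longrightarrow> A_left s \<le> A_left t"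
  using A_left_le_A[of s] A_le_A_left[of s t] by (cases "s = t") auto

lemma A_left_measurable [measurable]: "A_left \<in> borel_measurable borel"
proof -
  have "A_left \<in> borel_measurable (restrict_space borel {x. x \<in> C})"
    by (intro borel_measurable_mono_on_fnc) (auto simp: mono_on_def intro: A_left_mono)
  then have "(\<lambda>x. if x \<in> C then A_left x else 1) \<in> borel_measurable borel"
    by (subst measurable_If_restrict_space_iff) auto
  also have "(\<lambda>x. if x \<in> C then A_left x else 1) = A_left" by (auto simp: A_left_def)
  finally show ?thesis .
qed

lemma A_measurable [measurable]: "A \<in> borel_measurable borel" "B \<in> borel_measurable borel"
  unfolding A_def[abs_def] B_def[abs_def] atom_def by measurable

section \<open>Second-order estimates where the crossing mass is at least \<delta>\<close>

definition "E \<delta> = exp (measure \<gamma>\<^sub>1 UNIV / \<delta>)" for \<delta> :: real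
text \<open>The small parameter of all estimates: it excludes both ends and therefore tends to 0 as
  t decreases to s, even at an atom.\<close>

definition "lam s t = measure \<gamma>\<^sub>1 {s<..<t} + measure \<gamma>\<^sub>2 {s<..<t}"

context
  fixes s\<^sub>0 t\<^sub>0 \<delta> :: real
  assumes st0: "s\<^sub>0 \<in> C" "t\<^sub>0 \<in> C" "s\<^sub>0 \<le> t\<^sub>0" and \<delta>: "\<delta> > 0"
    and D_ge: "\<And>x. s\<^sub>0 \<le> x \<Longrightarrow> x \<le> t\<^sub>0 \<Longrightarrow> \<delta> \<le> D_left x \<and> \<delta> \<le> D_right x"
begin

lemma E_ge: "1 \<le> E \<delta>" unfolding E_def using \<delta> by simp

lemma lam_nonneg: "0 \<le> lam s t" by (simp add: lam_def)

lemma inC: "s\<^sub>0 \<le> x \<Longrightarrow> x \<le> t\<^sub>0 \<Longrightarrow> x \<in> C" by (rule C_between[OF st0(1,2)])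

text \<open>Inside the interval D departs from its value just after s only through masses in the
  open interval; the atoms at s are already counted in \<open>D_right s\<close>. The second form
  includes the atom at x, hence needs x < t.\<close>

lemma D_near:
  assumes "s < x" "x \<le> t"
  shows "\<bar>D_left x - D_right s\<bar> \<le> lam s t" "x < t \<Longrightarrow> \<bar>D_left x + atom x - D_right s\<bar> \<le> lam s t"
proof -
  have m: "measure \<gamma>\<^sub>1 {s<..<x} \<le> measure \<gamma>\<^sub>1 {s<..<t}" "measure \<gamma>\<^sub>2 {s<..<x} \<le> measure \<gamma>\<^sub>2 {s<..<t}"
    using assms by (auto intro!: g1.finite_measure_mono g2.finite_measure_mono)
  have n: "0 \<le> measure \<gamma>\<^sub>1 {s<..<x}" "0 \<le> measure \<gamma>\<^sub>2 {s<..<x}" by auto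
  show "\<bar>D_left x - D_right s\<bar> \<le> lam s t"
    unfolding D_left_eq[OF assms(1)] lam_def using m n by linarith
  assume "x < t"
  have eq: "{s<..x} = {s<..<x} \<union> {x}" using assms by auto
  have "measure \<gamma>\<^sub>1 {s<..x} = measure \<gamma>\<^sub>1 {s<..<x} + atom x"
    unfolding eq atom_def by (rule g1.finite_measure_Union) auto
  moreover have "measure \<gamma>\<^sub>1 {s<..x} \<le> measure \<gamma>\<^sub>1 {s<..<t}"
    using \<open>x < t\<close> by (intro g1.finite_measure_mono) auto
  ultimately show "\<bar>D_left x + atom x - D_right s\<bar> \<le> lam s t"
    unfolding D_left_eq[OF assms(1)] lam_def using m n atom_nonneg[of x] by linarith
qed

context
  fixes s t :: real
  assumes st: "s\<^sub>0 \<le> s" "s < t" "t \<le> t\<^sub>0"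
begin

text \<open>\<open>ell x\<close> lies between two inverses of crossing masses, and both masses are
  within \<open>lam s t\<close> of \<open>D_right s\<close>.\<close>

lemma ell_near:
  assumes x: "s < x" "x < t"
  shows "\<bar>ell x - 1 / D_right s\<bar> \<le> lam s t / \<delta>\<^sup>2"
proof -
  have xC: "x \<in> C" using inC st x by auto
  have d: "\<delta> \<le> D_left x" "\<delta> \<le> D_right s" using D_ge[of x] D_ge[of s] st x by auto
  have "\<bar>1 / D_left x - 1 / D_right s\<bar> \<le> lam s t / \<delta>\<^sup>2"
    using D_near(1)[of s x t] x d \<delta> by (intro inverse_diff_le) auto
  moreover have "\<bar>1 / (D_left x + atom x) - 1 / D_right s\<bar> \<le> lam s t / \<delta>\<^sup>2"
    using D_near(2)[of s x t] x d \<delta> by (intro inverse_diff_le) (auto intro: add_increasing2)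
  ultimately show ?thesis using ell_bounds(1,2)[OF xC] by (auto simp: abs_le_iff)
qed

definition "I u = (LINT x:{s<..<u}|\<gamma>\<^sub>1. ell x)"

lemma I_bounds:
  assumes "s < u" "u \<le> t"
  shows "0 \<le> I u" "I u \<le> lam s t / \<delta>" "exp (I u) \<le> E \<delta>"
proof -
  have C: "s \<in> C" "u \<in> C" using inC st assms by auto
  show "0 \<le> I u" unfolding I_def using ell_integral_nonneg[OF C] .
  have "\<bar>I u - 0 * measure \<gamma>\<^sub>1 {s<..<u}\<bar> \<le> (1 / \<delta>) * measure \<gamma>\<^sub>1 {s<..<u}"
    unfolding I_def
  proof (rule set_integral_approx(2)[OF fb1])
    fix x assume x: "x \<in> {s<..<u}"
    then have xC: "x \<in> C" using C_between[OF C] by auto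
    have "ell x \<le> 1 / D_left x" by (rule ell_bounds[OF xC])
    also have "\<dots> \<le> 1 / \<delta>" using \<delta> D_ge[of x] x st assms by (intro frac_le) auto
    finally show "\<bar>ell x - 0\<bar> \<le> 1 / \<delta>" using ell_nonneg[OF xC] by simp
  qed auto
  then have le: "I u \<le> measure \<gamma>\<^sub>1 {s<..<u} / \<delta>" by simp
  have "measure \<gamma>\<^sub>1 {s<..<u} \<le> measure \<gamma>\<^sub>1 {s<..<t}" using assms by (intro g1.finite_measure_mono) auto
  also have "\<dots> \<le> lam s t" by (simp add: lam_def)
  finally have "measure \<gamma>\<^sub>1 {s<..<u} / \<delta> \<le> lam s t / \<delta>" using \<delta> by (simp add: divide_right_mono)
  then show "I u \<le> lam s t / \<delta>" using le by simp
  have "measure \<gamma>\<^sub>1 {s<..<u} \<le> measure \<gamma>\<^sub>1 UNIV" by (intro g1.finite_measure_mono) auto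
  then have "I u \<le> measure \<gamma>\<^sub>1 UNIV / \<delta>" using le \<delta> by (meson divide_right_mono less_imp_le order_trans)
  then show "exp (I u) \<le> E \<delta>" by (simp add: E_def)
qed

lemma exp_I_bound:
  assumes "s < u" "u \<le> t"
  shows "exp (I u) - 1 \<le> lam s t / \<delta> * E \<delta>"
proof -
  have "exp (I u) - 1 \<le> I u * exp (I u)" by (rule exp_minus_one_le)
  also have "\<dots> \<le> lam s t / \<delta> * E \<delta>" using I_bounds[OF assms] \<delta> lam_nonneg[of s t] by (intro mult_mono) auto
  finally show ?thesis .
qed

lemma A_left_near:
  assumes "s < u" "u \<le> t"
  shows "A s \<le> A_left u" "A_left u - A s \<le> A s * (lam s t / \<delta> * E \<delta>)"
proof -
  have C: "s \<in> C" "u \<in> C" using inC st assms by auto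
  show "A s \<le> A_left u" using A_le_A_left[OF C assms(1)] .
  have "A_left u - A s = A s * (exp (I u) - 1)"
    unfolding A_left_step[OF C assms(1)] I_def by (simp add: algebra_simps)
  also have "\<dots> \<le> A s * (lam s t / \<delta> * E \<delta>)"
    using exp_I_bound[OF assms] A_pos[OF C(1)] by (intro mult_left_mono) auto
  finally show "A_left u - A s \<le> A s * (lam s t / \<delta> * E \<delta>)" .
qed

lemma density1_near:
  "set_integrable \<gamma>\<^sub>1 {s<..<t} (\<lambda>x. 1 / B x)"
  "\<bar>(LINT x:{s<..<t}|\<gamma>\<^sub>1. 1 / B x) - A s / D_right s * measure \<gamma>\<^sub>1 {s<..<t}\<bar>
     \<le> A s * (E \<delta> + 1) / \<delta>\<^sup>2 * (lam s t)\<^sup>2"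
proof -
  have sC: "s \<in> C" using inC st by auto
  have b: "\<bar>1 / B x - A s / D_right s\<bar> \<le> A s * (lam s t * (E \<delta> + 1) / \<delta>\<^sup>2)" if x: "x \<in> {s<..<t}" for x
  proof -
    have d: "\<delta> \<le> D_left x" "\<delta> \<le> D_right s" using D_ge[of x] D_ge[of s] st x by auto
    have near: "A s \<le> A_left x" "A_left x - A s \<le> A s * (lam s t / \<delta> * E \<delta>)" using A_left_near[of x] x by auto
    \<comment> \<open>Two errors: the growth of \<open>A_left\<close> since s contributes the term
      with \<open>E \<delta>\<close>, the variation of \<open>D_left\<close> the term with
      1.\<close>
    have "1 / B x - A s / D_right s = (A_left x - A s) / D_left x + A s * (1 / D_left x - 1 / D_right s)"
      using d \<delta> by (simp add: B_def diff_divide_distrib algebra_simps)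
    also have "\<bar>\<dots>\<bar> \<le> \<bar>(A_left x - A s) / D_left x\<bar> + \<bar>A s * (1 / D_left x - 1 / D_right s)\<bar>"
      by (rule abs_triangle_ineq)
    also have "\<bar>(A_left x - A s) / D_left x\<bar> = (A_left x - A s) / D_left x"
      using near d \<delta> by (intro abs_of_nonneg divide_nonneg_nonneg) auto
    also have "\<dots> \<le> A s * (lam s t / \<delta> * E \<delta>) / \<delta>"
      using near d \<delta> by (intro frac_le) linarith+
    also have "\<bar>A s * (1 / D_left x - 1 / D_right s)\<bar> \<le> A s * (lam s t / \<delta>\<^sup>2)"
      unfolding abs_mult using A_pos[OF sC] D_near(1)[of s x t] x d \<delta>
      by (intro mult_mono inverse_diff_le) auto
    finally show ?thesis by (simp add: power2_eq_square field_simps add_divide_distrib)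
  qed
  show "set_integrable \<gamma>\<^sub>1 {s<..<t} (\<lambda>x. 1 / B x)"
    by (rule set_integral_approx(1)[OF fb1 _ _ b]) auto
  have "\<bar>(LINT x:{s<..<t}|\<gamma>\<^sub>1. 1 / B x) - A s / D_right s * measure \<gamma>\<^sub>1 {s<..<t}\<bar>
      \<le> A s * (lam s t * (E \<delta> + 1) / \<delta>\<^sup>2) * measure \<gamma>\<^sub>1 {s<..<t}"
    by (rule set_integral_approx(2)[OF fb1 _ _ b]) auto
  also have "\<dots> \<le> A s * (lam s t * (E \<delta> + 1) / \<delta>\<^sup>2) * lam s t"
    using A_pos[OF sC] lam_nonneg[of s t] E_ge \<delta> by (intro mult_left_mono) (auto simp: lam_def)
  finally show "\<bar>(LINT x:{s<..<t}|\<gamma>\<^sub>1. 1 / B x) - A s / D_right s * measure \<gamma>\<^sub>1 {s<..<t}\<bar>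
      \<le> A s * (E \<delta> + 1) / \<delta>\<^sup>2 * (lam s t)\<^sup>2" by (simp add: power2_eq_square field_simps)
qed

text \<open>To first order both \<open>A_left t - A s\<close> and the integral equal
  \<open>A s / D_right s\<close> times the \<open>\<gamma>\<^sub>1\<close>-mass of the open
  interval. The errors come from replacing \<open>ell\<close> by a constant, exp by its linear part
  and 1 / B by a constant, and each is quadratic in \<open>lam s t\<close>.\<close>

lemma A_left_increment:
  "\<bar>A_left t - A s - (LINT x:{s<..<t}|\<gamma>\<^sub>1. 1 / B x)\<bar> \<le> 2 * A_left t\<^sub>0 * (E \<delta> + 1) / \<delta>\<^sup>2 * (lam s t)\<^sup>2"
proof -
  have C: "s \<in> C" "t \<in> C" using inC st by auto
  define l where "l = lam s t"
  define g where "g = measure \<gamma>\<^sub>1 {s<..<t}"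
  have l: "0 \<le> g" "g \<le> l" "0 \<le> l" by (auto simp: l_def g_def lam_def)
  have "\<bar>I t - 1 / D_right s * g\<bar> \<le> l / \<delta>\<^sup>2 * g"
    unfolding I_def g_def l_def by (rule set_integral_approx(2)[OF fb1]) (use ell_near in auto)
  also have "\<dots> \<le> l / \<delta>\<^sup>2 * l" using l \<delta> by (intro mult_left_mono) auto
  finally have 1: "\<bar>I t - g / D_right s\<bar> \<le> l\<^sup>2 / \<delta>\<^sup>2" by (simp add: power2_eq_square)
  have I: "0 \<le> I t" "I t \<le> l / \<delta>" "exp (I t) \<le> E \<delta>" using I_bounds[of t] st by (auto simp: l_def)
  have "exp (I t) - 1 - I t \<le> I t * (exp (I t) - 1)"
    using exp_minus_one_le[of "I t"] by (simp add: algebra_simps)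
  also have "\<dots> \<le> l / \<delta> * (l / \<delta> * E \<delta>)"
    using I exp_I_bound[of t] st by (intro mult_mono) (auto simp: l_def)
  also have "\<dots> = l\<^sup>2 * E \<delta> / \<delta>\<^sup>2" by (simp add: power2_eq_square)
  finally have 2: "\<bar>exp (I t) - 1 - I t\<bar> \<le> l\<^sup>2 * E \<delta> / \<delta>\<^sup>2"
    using exp_ge_add_one_self[of "I t"] by linarith
  have "\<bar>exp (I t) - 1 - g / D_right s\<bar> \<le> l\<^sup>2 * E \<delta> / \<delta>\<^sup>2 + l\<^sup>2 / \<delta>\<^sup>2"
    using 1 2 by linarith
  then have "A s * \<bar>exp (I t) - 1 - g / D_right s\<bar> \<le> A s * (l\<^sup>2 * E \<delta> / \<delta>\<^sup>2 + l\<^sup>2 / \<delta>\<^sup>2)"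
    using A_pos[OF C(1)] by (intro mult_left_mono) auto
  moreover have "A s * \<bar>exp (I t) - 1 - g / D_right s\<bar> = \<bar>A_left t - A s - A s / D_right s * g\<bar>"
    using A_pos[OF C(1)] unfolding A_left_step[OF C st(2)] I_def[symmetric]
    by (simp add: abs_mult_pos' right_diff_distrib)
  ultimately have "\<bar>A_left t - A s - (LINT x:{s<..<t}|\<gamma>\<^sub>1. 1 / B x)\<bar>
      \<le> A s * (l\<^sup>2 * E \<delta> / \<delta>\<^sup>2 + l\<^sup>2 / \<delta>\<^sup>2) + A s * (E \<delta> + 1) / \<delta>\<^sup>2 * l\<^sup>2"
    using density1_near(2) unfolding l_def[symmetric] g_def[symmetric] by linarith
  also have "\<dots> = A s * (2 * (E \<delta> + 1) / \<delta>\<^sup>2 * l\<^sup>2)" using \<delta> by (simp add: field_simps)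
  also have "\<dots> \<le> A_left t\<^sub>0 * (2 * (E \<delta> + 1) / \<delta>\<^sup>2 * l\<^sup>2)"
  proof (rule mult_right_mono)
    show "A s \<le> A_left t\<^sub>0" using A_le_A_left[OF C(1) st0(2)] st by simp
  qed (use E_ge \<delta> in auto)
  finally show ?thesis by (simp add: l_def field_simps)
qed

end

end

end

lemma finite_borel_measure_add:
  assumes "finite_borel_measure M" "finite_borel_measure N"
  shows "finite_borel_measure (M \<oplus>\<^sub>m N)"
    and "X \<in> sets borel \<Longrightarrow> measure (M \<oplus>\<^sub>m N) X = measure M X + measure N X"
proof -
  interpret M: finite_borel_measure M by fact
  interpret N: finite_borel_measure N by fact
  have e: "emeasure (M \<oplus>\<^sub>m N) X = ennreal (measure M X + measure N X)" if "X \<in> sets borel" for X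
    using that by (simp add: emeasure_add_measure M.M_is_borel N.M_is_borel M.emeasure_eq_measure N.emeasure_eq_measure)
  show "finite_borel_measure (M \<oplus>\<^sub>m N)"
    unfolding finite_borel_measure_def finite_borel_measure_axioms_def
    using e[of UNIV] by (auto intro!: finite_measureI simp: sets_eq_imp_space_eq[OF sets_add_measure])
  show "X \<in> sets borel \<Longrightarrow> measure (M \<oplus>\<^sub>m N) X = measure M X + measure N X"
    unfolding measure_def[of "M \<oplus>\<^sub>m N"]
    by (simp only: e enn2real_ennreal add_nonneg_nonneg measure_nonneg)
qed

section \<open>Integral equations for \<open>A_left\<close> and \<open>B\<close>\<close>

context kellerer_pair begin

lemma A_left_nonneg [simp]: "0 \<le> A_left t"
  using A_left_pos[of t] by (rule less_imp_le)

text \<open>The equation d\<open>\<gamma>\<^sub>1\<close> = B dA holds exactly at an atom, so atoms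
  at left ends of intervals cause no error.\<close>

lemma density1_jump: "s \<in> C \<Longrightarrow> A_left s + 1 / B s * atom s = A s"
  using D_pos(1)[of s] by (simp add: A_def B_def field_simps)

text \<open>The atom of \<open>\<gamma>\<^sub>2\<close> at s lowers B to
  \<open>D_right s / A s\<close>, the value it takes just after s.\<close>

lemma density2_jump:
  assumes "s \<in> C"
  shows "B s - 1 / A s * measure \<gamma>\<^sub>2 {s} = D_right s / A s"
proof -
  have "B s = (D_left s + atom s) / A s"
  proof -
    have "0 < D_left s + atom s" using D_pos(1)[OF assms] atom_nonneg[of s] by linarith
    moreover have "A s = A_left s * ((D_left s + atom s) / D_left s)"
      using D_pos(1)[OF assms] by (simp add: A_def field_simps)
    ultimately show ?thesis using D_pos(1)[OF assms] by (simp add: B_def)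
  qed
  then show ?thesis using D_right_eq[of s] by (simp add: atom_def diff_divide_distrib)
qed

lemma density1_integrable:
  assumes "s \<in> C" "t \<in> C" "s \<le> t"
  shows "set_integrable \<gamma>\<^sub>1 {s..<t} (\<lambda>x. 1 / B x)"
proof -
  obtain \<delta> where \<delta>: "\<delta> > 0" "\<And>x. s \<le> x \<Longrightarrow> x \<le> t \<Longrightarrow> \<delta> \<le> D_left x \<and> \<delta> \<le> D_right x"
    using D_lower_bound[OF assms] by blast
  show ?thesis
  proof (rule set_integral_approx(1)[OF fb1])
    fix x assume x: "x \<in> {s..<t}"
    then have xC: "x \<in> C" using C_between[OF assms(1,2)] by auto
    have "1 / B x = A_left x / D_left x" by (simp add: B_def)
    also have "\<dots> \<le> A_left t / \<delta>"
      using A_left_mono[OF xC assms(2)] x \<delta>(1) \<delta>(2)[of x] A_left_pos[of t]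
      by (intro frac_le) (auto simp del: A_left_pos)
    finally show "\<bar>1 / B x - 0\<bar> \<le> A_left t / \<delta>" using B_pos[OF xC] by simp
  qed auto
qed

lemma density2_integrable:
  assumes "s \<in> C" "t \<in> C" "s \<le> t"
  shows "set_integrable \<gamma>\<^sub>2 {s..<t} (\<lambda>x. 1 / A x)"
proof (rule set_integral_approx(1)[OF fb2])
  fix x assume x: "x \<in> {s..<t}"
  then have xC: "x \<in> C" using C_between[OF assms(1,2)] by auto
  have "A_left s \<le> A x" using A_left_mono[OF assms(1) xC] A_left_le_A[OF xC] x by auto
  then have "1 / A x \<le> 1 / A_left s" by (intro frac_le) auto
  then show "\<bar>1 / A x - 0\<bar> \<le> 1 / A_left s" using A_pos[OF xC] by simp
qed auto

lemma set_integral_split: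
  fixes f :: "real \<Rightarrow> real"
  assumes M: "finite_borel_measure M" and "set_integrable M {r..<t} f" "r \<le> s" "s \<le> t"
  shows "(LINT x:{r..<t}|M. f x) = (LINT x:{r..<s}|M. f x) + (LINT x:{s..<t}|M. f x)"
proof -
  interpret finite_borel_measure M by fact
  have eq: "{r..<t} = {r..<s} \<union> {s..<t}" using assms(3,4) by auto
  show ?thesis
    unfolding eq by (rule set_integral_Un) (use assms(3,4) in \<open>auto intro!: set_integrable_subset[OF assms(2)]\<close>)
qed

text \<open>The defect \<open>Z\<close> changes only to second order: the atom at the left end
  cancels by \<open>density1_jump\<close>, and the rest is bounded by
  \<open>A_left_increment\<close>. The sum of both marginals controls it, because D varies with
  both.\<close>

lemma density1_integral:
  assumes "s \<in> C" "t \<in> C" "s \<le> t"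
  shows "(LINT x:{s..<t}|\<gamma>\<^sub>1. 1 / B x) = A_left t - A_left s"
proof -
  obtain \<delta> where \<delta>: "\<delta> > 0" "\<And>x. s \<le> x \<Longrightarrow> x \<le> t \<Longrightarrow> \<delta> \<le> D_left x \<and> \<delta> \<le> D_right x"
    using D_lower_bound[OF assms] by blast
  define Z where "Z u = A_left u - (LINT x:{s..<u}|\<gamma>\<^sub>1. 1 / B x)" for u
  have "Z t = Z s"
  proof (rule constant_if_quadratic_increments[OF finite_borel_measure_add(1)[OF fb1 fb2] assms(3)])
    fix u v assume uv: "s \<le> u" "u < v" "v \<le> t"
    have C: "u \<in> C" "v \<in> C" using C_between[OF assms(1,2)] uv by auto
    have "Z v - Z u = A_left v - A_left u - (LINT x:{u..<v}|\<gamma>\<^sub>1. 1 / B x)"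
      unfolding Z_def using uv set_integral_split[OF fb1 density1_integrable, of s v u] C assms(1) by simp
    also have "\<dots> = A_left v - A u - (LINT x:{u<..<v}|\<gamma>\<^sub>1. 1 / B x)"
      using set_integral_split_left[OF fb1 density1_integrable uv(2)] C uv density1_jump[OF C(1)]
      by (simp add: atom_def)
    finally show "\<bar>Z v - Z u\<bar> \<le> 2 * A_left t * (E \<delta> + 1) / \<delta>\<^sup>2 * (measure (\<gamma>\<^sub>1 \<oplus>\<^sub>m \<gamma>\<^sub>2) {u<..<v})\<^sup>2"
      using A_left_increment[OF assms \<delta> uv] by (simp add: finite_borel_measure_add(2)[OF fb1 fb2] lam_def)
  qed
  then show ?thesis by (simp add: Z_def set_lebesgue_integral_def)
qed

lemma density1_integral_open:
  assumes "s \<in> C" "t \<in> C" "s < t"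
  shows "(LINT x:{s<..<t}|\<gamma>\<^sub>1. 1 / B x) = A_left t - A s"
  using density1_integral[of s t] set_integral_split_left[OF fb1 density1_integrable[of s t] assms(3)]
    density1_jump[of s] assms by (simp add: atom_def)

text \<open>Formally d(D / A) = (d\<open>\<gamma>\<^sub>1\<close> -
  d\<open>\<gamma>\<^sub>2\<close>) / A - D dA / A^2, and D dA = A d\<open>\<gamma>\<^sub>1\<close>.
  The parts with \<open>\<gamma>\<^sub>1\<close> cancel and - d\<open>\<gamma>\<^sub>2\<close> / A
  remains.\<close>

lemma B_increment:
  assumes st0: "s\<^sub>0 \<in> C" "t\<^sub>0 \<in> C" "s\<^sub>0 \<le> t\<^sub>0" and \<delta>: "\<delta> > 0"
    and D_ge: "\<And>x. s\<^sub>0 \<le> x \<Longrightarrow> x \<le> t\<^sub>0 \<Longrightarrow> \<delta> \<le> D_left x \<and> \<delta> \<le> D_right x"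
    and st: "s\<^sub>0 \<le> s" "s < t" "t \<le> t\<^sub>0"
  shows "\<bar>B t - D_right s / A s + (LINT x:{s<..<t}|\<gamma>\<^sub>2. 1 / A x)\<bar>
    \<le> (measure \<gamma>\<^sub>1 UNIV * (E \<delta> + 1) / \<delta>\<^sup>2 + E \<delta> / \<delta>) / A_left s\<^sub>0 * (lam s t)\<^sup>2"
proof -
  define l where "l = lam s t"
  define d1 where "d1 = measure \<gamma>\<^sub>1 {s<..<t}"
  define d2 where "d2 = measure \<gamma>\<^sub>2 {s<..<t}"
  define J where "J = (LINT x:{s<..<t}|\<gamma>\<^sub>1. 1 / B x)"
  define k where "k = (LINT x:{s<..<t}|\<gamma>\<^sub>2. 1 / A x)"
  have C: "s \<in> C" "t \<in> C" using C_between[OF st0(1,2)] st by auto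
  have J: "A_left t = A s + J" unfolding J_def using density1_integral_open[OF C st(2)] by simp
  have E: "1 \<le> E \<delta>" using E_ge[OF st0 \<delta> D_ge] .
  have l: "0 \<le> d2" "d2 \<le> l" "0 \<le> l" by (auto simp: l_def d2_def lam_def)
  have pos: "0 < A s" "0 < A_left t" "0 < A_left s\<^sub>0" using A_pos[OF C(1)] by auto
  have le: "A_left s\<^sub>0 \<le> A_left t" using A_left_mono[OF st0(1) C(2)] st by auto
  have Dr: "\<delta> \<le> D_right s" using D_ge[of s] st by auto
  have "cdf \<gamma>\<^sub>1 s \<le> measure \<gamma>\<^sub>1 UNIV" "0 \<le> cdf \<gamma>\<^sub>2 s"
    using g1.cdf_bounded[of s] g2.cdf_nonneg by (auto simp: g1.borel_UNIV)
  then have DM: "D_right s \<le> measure \<gamma>\<^sub>1 UNIV" by (simp add: D_right_def)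
  have D: "D_left t = D_right s + d1 - d2" unfolding d1_def d2_def by (rule D_left_eq[OF st(2)])
  \<comment> \<open>The quotient is split so that \<open>d1 * A s\<close> and
    \<open>D_right s * J\<close>, which cancel to first order, stand together.\<close>
  have eq: "B t - D_right s / A s = (d1 * A s - D_right s * J) / (A s * A_left t) - d2 / A_left t"
  proof -
    have "(D + d1 - d2) / y - D / x = (d1 * x - D * (y - x)) / (x * y) - d2 / y"
      if "0 < x" "0 < y" for D x y :: real
      using that by (simp add: divide_simps) (simp add: algebra_simps)
    then show ?thesis using pos J unfolding B_def D by simp
  qed
  have "\<bar>J - A s / D_right s * d1\<bar> \<le> A s * (E \<delta> + 1) / \<delta>\<^sup>2 * l\<^sup>2"
    using density1_near(2)[OF st0 \<delta> D_ge st] by (simp add: J_def d1_def l_def)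
  then have "D_right s * \<bar>J - A s / D_right s * d1\<bar> \<le> measure \<gamma>\<^sub>1 UNIV * (A s * (E \<delta> + 1) / \<delta>\<^sup>2 * l\<^sup>2)"
    using DM Dr \<delta> by (intro mult_mono) auto
  moreover have "D_right s * \<bar>J - A s / D_right s * d1\<bar> = \<bar>d1 * A s - D_right s * J\<bar>"
    using Dr \<delta> abs_mult[of "D_right s" "J - A s / D_right s * d1"]
    by (simp add: right_diff_distrib abs_minus_commute mult.commute)
  ultimately have "\<bar>d1 * A s - D_right s * J\<bar> / (A s * A_left t)
      \<le> measure \<gamma>\<^sub>1 UNIV * (A s * (E \<delta> + 1) / \<delta>\<^sup>2 * l\<^sup>2) / (A s * A_left t)"
    using pos by (intro divide_right_mono) (auto intro!: mult_nonneg_nonneg less_imp_le)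
  also have "\<dots> = measure \<gamma>\<^sub>1 UNIV * (E \<delta> + 1) / \<delta>\<^sup>2 * l\<^sup>2 / A_left t"
    using pos by simp
  also have "\<dots> \<le> measure \<gamma>\<^sub>1 UNIV * (E \<delta> + 1) / \<delta>\<^sup>2 * l\<^sup>2 / A_left s\<^sub>0"
  proof (rule divide_left_mono[OF le])
    show "0 \<le> measure \<gamma>\<^sub>1 UNIV * (E \<delta> + 1) / \<delta>\<^sup>2 * l\<^sup>2"
      using E by (intro mult_nonneg_nonneg divide_nonneg_nonneg) auto
  qed (use pos in simp)
  finally have 1: "\<bar>(d1 * A s - D_right s * J) / (A s * A_left t)\<bar>
      \<le> measure \<gamma>\<^sub>1 UNIV * (E \<delta> + 1) / \<delta>\<^sup>2 * l\<^sup>2 / A_left s\<^sub>0"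
    unfolding abs_divide abs_of_pos[OF mult_pos_pos[OF pos(1,2)]] .
  have "\<bar>k - 1 / A_left t * d2\<bar> \<le> l / \<delta> * E \<delta> / A_left s\<^sub>0 * d2"
    unfolding k_def d2_def
  proof (rule set_integral_approx(2)[OF fb2])
    fix x assume x: "x \<in> {s<..<t}"
    then have xC: "x \<in> C" using C_between[OF C] by auto
    have Ax: "A s \<le> A x" "A x \<le> A_left t"
      using A_le_A_left[OF C(1) xC] A_left_le_A[OF xC] A_le_A_left[OF xC C(2)] x by auto
    have "1 / A_left t \<le> 1 / A x" "1 / A x \<le> 1 / A s" using Ax pos A_pos[OF xC] by (auto intro!: frac_le)
    then have "\<bar>1 / A x - 1 / A_left t\<bar> \<le> 1 / A s - 1 / A_left t" by linarith
    also have "\<dots> = (A_left t - A s) / (A s * A_left t)"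
      using diff_frac_eq[of "A s" "A_left t" 1 1] pos by simp
    also have "\<dots> \<le> (A s * (l / \<delta> * E \<delta>)) / (A s * A_left t)"
      using A_left_near(2)[OF st0 \<delta> D_ge st st(2)] pos
      by (intro divide_right_mono mult_nonneg_nonneg) (auto simp: l_def)
    also have "\<dots> = l / \<delta> * E \<delta> / A_left t" using pos by simp
    also have "\<dots> \<le> l / \<delta> * E \<delta> / A_left s\<^sub>0"
    proof (rule divide_left_mono[OF le])
      show "0 \<le> l / \<delta> * E \<delta>"
        using E l(3) \<delta> by (intro mult_nonneg_nonneg divide_nonneg_nonneg) auto
    qed (use pos in simp)
    finally show "\<bar>1 / A x - 1 / A_left t\<bar> \<le> l / \<delta> * E \<delta> / A_left s\<^sub>0" .
  qed auto
  also have "\<dots> \<le> l / \<delta> * E \<delta> / A_left s\<^sub>0 * l"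
  proof (rule mult_left_mono[OF l(2)])
    show "0 \<le> l / \<delta> * E \<delta> / A_left s\<^sub>0"
      using E l(3) \<delta> pos(3) by (intro mult_nonneg_nonneg divide_nonneg_nonneg) auto
  qed
  finally have 2: "\<bar>k - 1 / A_left t * d2\<bar> \<le> E \<delta> / \<delta> * l\<^sup>2 / A_left s\<^sub>0"
    by (simp add: power2_eq_square field_simps)
  have "B t - D_right s / A s + k
      = (d1 * A s - D_right s * J) / (A s * A_left t) + (k - 1 / A_left t * d2)"
    unfolding eq by simp
  then have "\<bar>B t - D_right s / A s + k\<bar>
      \<le> \<bar>(d1 * A s - D_right s * J) / (A s * A_left t)\<bar> + \<bar>k - 1 / A_left t * d2\<bar>"
    by (simp only: abs_triangle_ineq)
  also have "\<dots> \<le> measure \<gamma>\<^sub>1 UNIV * (E \<delta> + 1) / \<delta>\<^sup>2 * l\<^sup>2 / A_left s\<^sub>0 + E \<delta> / \<delta> * l\<^sup>2 / A_left s\<^sub>0"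
    using 1 2 by (rule add_mono)
  finally show ?thesis by (simp add: k_def l_def add_divide_distrib distrib_right)
qed

lemma density2_integral:
  assumes "s \<in> C" "t \<in> C" "s \<le> t"
  shows "(LINT x:{s..<t}|\<gamma>\<^sub>2. 1 / A x) = B s - B t"
proof -
  obtain \<delta> where \<delta>: "\<delta> > 0" "\<And>x. s \<le> x \<Longrightarrow> x \<le> t \<Longrightarrow> \<delta> \<le> D_left x \<and> \<delta> \<le> D_right x"
    using D_lower_bound[OF assms] by blast
  define Z where "Z u = B u + (LINT x:{s..<u}|\<gamma>\<^sub>2. 1 / A x)" for u
  have "Z t = Z s"
  proof (rule constant_if_quadratic_increments[OF finite_borel_measure_add(1)[OF fb1 fb2] assms(3)])
    fix u v assume uv: "s \<le> u" "u < v" "v \<le> t"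
    have C: "u \<in> C" "v \<in> C" using C_between[OF assms(1,2)] uv by auto
    have "Z v - Z u = B v - B u + (LINT x:{u..<v}|\<gamma>\<^sub>2. 1 / A x)"
      unfolding Z_def using uv set_integral_split[OF fb2 density2_integrable, of s v u] C assms(1) by simp
    also have "\<dots> = B v - D_right u / A u + (LINT x:{u<..<v}|\<gamma>\<^sub>2. 1 / A x)"
      using set_integral_split_left[OF fb2 density2_integrable uv(2)] C uv density2_jump[OF C(1)]
      by simp
    finally show "\<bar>Z v - Z u\<bar> \<le> (measure \<gamma>\<^sub>1 UNIV * (E \<delta> + 1) / \<delta>\<^sup>2 + E \<delta> / \<delta>) / A_left s *
        (measure (\<gamma>\<^sub>1 \<oplus>\<^sub>m \<gamma>\<^sub>2) {u<..<v})\<^sup>2"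
      using B_increment[OF assms \<delta> uv] by (simp add: finite_borel_measure_add(2)[OF fb1 fb2] lam_def)
  qed
  then show ?thesis by (simp add: Z_def set_lebesgue_integral_def)
qed

text \<open>Not visible from B = D / A, since D need not be monotone; the decrements of B are
  integrals of a positive function.\<close>

lemma B_antimono:
  assumes "s \<in> C" "t \<in> C" "s \<le> t"
  shows "B t \<le> B s"
proof -
  have "0 \<le> (LINT x:{s..<t}|\<gamma>\<^sub>2. 1 / A x)"
    unfolding set_lebesgue_integral_def
    by (rule Bochner_Integration.integral_nonneg)
       (use C_between[OF assms(1,2)] A_pos in \<open>auto simp: indicator_def less_imp_le\<close>)
  then show ?thesis by (simp add: density2_integral[OF assms])
qed

end

section \<open>Limits at the ends of a component\<close>

lemma cdf_left_lim_upper: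
  assumes M: "finite_borel_measure M" and u: "incseq u" "\<And>n. ereal (u n) < b" "(\<lambda>n. ereal (u n)) \<longlonglongrightarrow> b"
  shows "(\<lambda>n. cdf_left M (u n)) \<longlonglongrightarrow> measure M {x. ereal x < b}"
proof -
  interpret finite_borel_measure M by fact
  have "(\<lambda>n. measure M {..<u n}) \<longlonglongrightarrow> measure M (\<Union>n. {..<u n})"
    using u(1) by (intro finite_Lim_measure_incseq) (auto simp: incseq_def intro: less_le_trans)
  also have "(\<Union>n. {..<u n}) = {x. ereal x < b}"
  proof safe
    fix x n assume "x < u n"
    then have "ereal x < ereal (u n)" by simp
    then show "ereal x < b" using u(2)[of n] by (rule less_trans)
  next
    fix x assume "ereal x < b"
    then have "eventually (\<lambda>n. ereal x < ereal (u n)) sequentially" by (rule order_tendstoD(1)[OF u(3)])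
    then show "x \<in> (\<Union>n. {..<u n})" by (auto simp: eventually_sequentially)
  qed
  finally show ?thesis by (simp add: cdf_left_def)
qed

lemma cdf_left_lim_lower:
  assumes M: "finite_borel_measure M" and l: "decseq l" "\<And>n. a < ereal (l n)" "(\<lambda>n. ereal (l n)) \<longlonglongrightarrow> a"
  shows "(\<lambda>n. cdf_left M (l n)) \<longlonglongrightarrow> measure M {x. ereal x \<le> a}"
proof -
  interpret finite_borel_measure M by fact
  have "(\<lambda>n. measure M {..<l n}) \<longlonglongrightarrow> measure M (\<Inter>n. {..<l n})"
    using l(1) by (intro finite_Lim_measure_decseq) (auto simp: decseq_def intro: less_le_trans)
  also have "(\<Inter>n. {..<l n}) = {x. ereal x \<le> a}"
  proof safe
    fix x assume x: "x \<in> (\<Inter>n. {..<l n})"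
    show "ereal x \<le> a"
    proof (rule ccontr)
      assume "\<not> ?thesis"
      then have "a < ereal x" by simp
      then have "eventually (\<lambda>n. ereal (l n) < ereal x) sequentially" by (rule order_tendstoD(2)[OF l(3)])
      then obtain n where "l n < x" by (auto simp: eventually_sequentially)
      then show False using x by (auto dest: less_trans)
    qed
  next
    fix x n assume "ereal x \<le> a"
    then have "ereal x < ereal (l n)" using l(2)[of n] by (rule le_less_trans)
    then show "x < l n" by simp
  qed
  finally show ?thesis by (simp add: cdf_left_def)
qed

context kellerer_pair begin

text \<open>At an infinite end the set is empty and the weight is 0, so finite and infinite ends
  need no distinction below.\<close>

definition "end1 = measure \<gamma>\<^sub>1 {x. ereal x = a}"
definition "end2 = measure \<gamma>\<^sub>2 {y. ereal y = b}"

lemma end_nonneg [simp]: "0 \<le> end1" "0 \<le> end2" by (auto simp: end1_def end2_def)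

lemma cdf_left_mono: "finite_borel_measure M \<Longrightarrow> s \<le> t \<Longrightarrow> cdf_left M s \<le> cdf_left M t"
  using cdf_le_cdf_left[of M s t] cdf_left_le_cdf[of M s] by (cases "s = t") auto

lemma ereal_sets [measurable]:
  "{x. ereal x < e} \<in> sets borel" "{x. ereal x \<le> e} \<in> sets borel" "{x. ereal x = e} \<in> sets borel"
  by measurable

lemma measure2_below: "measure \<gamma>\<^sub>2 {y. ereal y < b} = measure \<gamma>\<^sub>1 UNIV - end2"
proof -
  have "AE y in \<gamma>\<^sub>2. y \<in> UNIV \<longleftrightarrow> y \<in> {y. ereal y < b} \<union> {y. ereal y = b}"
    using conc2 by eventually_elim (auto simp: le_less)
  then have "measure \<gamma>\<^sub>2 UNIV = measure \<gamma>\<^sub>2 ({y. ereal y < b} \<union> {y. ereal y = b})"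
    by (rule g2.finite_measure_eq_AE) (auto simp: g2.M_is_borel)
  also have "\<dots> = measure \<gamma>\<^sub>2 {y. ereal y < b} + end2"
    unfolding end2_def by (rule g2.finite_measure_Union) auto
  finally show ?thesis using mass by simp
qed

lemma measure1_below: "measure \<gamma>\<^sub>1 {x. ereal x < b} = measure \<gamma>\<^sub>1 UNIV"
  by (rule g1.finite_measure_eq_AE) (use conc1 in \<open>auto elim!: eventually_mono\<close>)

lemma measure1_upto: "measure \<gamma>\<^sub>1 {x. ereal x \<le> a} = end1"
  unfolding end1_def by (rule g1.finite_measure_eq_AE) (use conc1 in \<open>auto elim!: eventually_mono\<close>)

lemma measure2_upto: "measure \<gamma>\<^sub>2 {x. ereal x \<le> a} = 0"
proof -
  have "measure \<gamma>\<^sub>2 {x. ereal x \<le> a} = measure \<gamma>\<^sub>2 {}"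
    by (rule g2.finite_measure_eq_AE) (use conc2 in \<open>auto elim!: eventually_mono\<close>)
  then show ?thesis by simp
qed

lemma D_left_le_mass: "D_left t \<le> measure \<gamma>\<^sub>1 UNIV"
proof -
  have "cdf_left \<gamma>\<^sub>1 t \<le> measure \<gamma>\<^sub>1 UNIV" "0 \<le> cdf_left \<gamma>\<^sub>2 t"
    unfolding cdf_left_def by (auto intro!: g1.finite_measure_mono simp: g1.M_is_borel)
  then show ?thesis by (simp add: D_left_def)
qed

lemma A_left_growth:
  assumes "s \<in> C" "t \<in> C" "s \<le> t" "\<delta> > 0" "\<And>x. s \<le> x \<Longrightarrow> x < t \<Longrightarrow> \<delta> \<le> D_left x"
  shows "A_left t \<le> A_left s * exp (measure \<gamma>\<^sub>1 UNIV / \<delta>)"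
proof -
  have "\<bar>(LINT x:{s..<t}|\<gamma>\<^sub>1. ell x) - 0 * measure \<gamma>\<^sub>1 {s..<t}\<bar> \<le> (1 / \<delta>) * measure \<gamma>\<^sub>1 {s..<t}"
  proof (rule set_integral_approx(2)[OF fb1])
    fix x assume x: "x \<in> {s..<t}"
    then have xC: "x \<in> C" using C_between[OF assms(1,2)] by auto
    have "ell x \<le> 1 / D_left x" by (rule ell_bounds[OF xC])
    also have "\<dots> \<le> 1 / \<delta>" using assms(4,5) x by (intro frac_le) auto
    finally show "\<bar>ell x - 0\<bar> \<le> 1 / \<delta>" using ell_nonneg[OF xC] by simp
  qed auto
  also have "\<dots> \<le> (1 / \<delta>) * measure \<gamma>\<^sub>1 UNIV"
    using assms(4) by (intro mult_left_mono g1.finite_measure_mono) auto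
  finally have "Lam t - Lam s \<le> measure \<gamma>\<^sub>1 UNIV / \<delta>" using Lam_diff[OF assms(1-3)] by simp
  then have "exp (Lam t) \<le> exp (Lam s + measure \<gamma>\<^sub>1 UNIV / \<delta>)" by simp
  then show ?thesis using assms(1,2) by (simp add: A_left_def exp_add)
qed

context
  fixes l u :: "nat \<Rightarrow> real"
  assumes u: "incseq u" "\<And>n. ereal (u n) < b" "(\<lambda>n. ereal (u n)) \<longlonglongrightarrow> b"
    and l: "decseq l" "\<And>n. a < ereal (l n)" "(\<lambda>n. ereal (l n)) \<longlonglongrightarrow> a"
    and lu: "\<And>n. l n < u n"
begin

lemma lu_in_C: "l n \<in> C" "u n \<in> C"
proof -
  have "ereal (l n) < ereal (u n)" using lu by simp
  then have "ereal (l n) < b" "a < ereal (u n)" using u(2)[of n] l(2)[of n] less_trans by blast+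
  then show "l n \<in> C" "u n \<in> C" using u(2)[of n] l(2)[of n] by (simp_all add: C_def)
qed

text \<open>Near b all of \<open>\<gamma>\<^sub>1\<close> has been passed and
  \<open>\<gamma>\<^sub>2\<close> lacks only its atom at b; near a only the atom of
  \<open>\<gamma>\<^sub>1\<close> at a has been passed.\<close>

lemma D_left_lim: "(\<lambda>n. D_left (u n)) \<longlonglongrightarrow> end2" "(\<lambda>n. D_left (l n)) \<longlonglongrightarrow> end1"
  unfolding D_left_def
  using tendsto_diff[OF cdf_left_lim_upper[OF fb1 u] cdf_left_lim_upper[OF fb2 u]]
    tendsto_diff[OF cdf_left_lim_lower[OF fb1 l] cdf_left_lim_lower[OF fb2 l]]
  by (auto simp: measure1_below measure2_below measure1_upto measure2_upto)

text \<open>The limit \<open>end2 / w\<close> is the mass that \<open>\<eta>\<^sub>2\<close> will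
  have at b. With an atom at b, D stays away from 0, so \<open>A_left\<close> is bounded and w is
  its limit. Without one, \<open>A_left\<close> may blow up, but B is at most D divided by a fixed
  value of \<open>A_left\<close> and tends to 0; then w = 1 is an arbitrary choice.\<close>

lemma right_end:
  obtains w where "0 < w" "(\<lambda>n. B (u n)) \<longlonglongrightarrow> end2 / w" "0 < end2 \<Longrightarrow> (\<lambda>n. A_left (u n)) \<longlonglongrightarrow> w"
proof (cases "end2 = 0")
  case True
  have "(\<lambda>n. D_left (u n) / A_left (u 0)) \<longlonglongrightarrow> end2 / A_left (u 0)"
    by (intro tendsto_divide D_left_lim tendsto_const) (simp add: less_imp_neq[symmetric])
  then have lim: "(\<lambda>n. D_left (u n) / A_left (u 0)) \<longlonglongrightarrow> 0" using True by simp
  have "(\<lambda>n. B (u n)) \<longlonglongrightarrow> 0"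
  proof (rule tendsto_sandwich[OF _ _ tendsto_const lim])
    show "\<forall>\<^sub>F n in sequentially. 0 \<le> B (u n)" using B_pos[OF lu_in_C(2)] by (simp add: less_imp_le)
    have "B (u n) \<le> D_left (u n) / A_left (u 0)" for n
      unfolding B_def using A_left_mono[OF lu_in_C(2) lu_in_C(2), of 0 n] u(1) D_pos(1)[OF lu_in_C(2)[of n]]
      by (intro divide_left_mono) (auto simp: incseq_def)
    then show "\<forall>\<^sub>F n in sequentially. B (u n) \<le> D_left (u n) / A_left (u 0)" by simp
  qed
  then show ?thesis using that[of 1] True by simp
next
  case False
  then have pos: "0 < end2" using end_nonneg(2) by linarith
  have "(\<lambda>n. cdf_left \<gamma>\<^sub>1 (u n)) \<longlonglongrightarrow> measure \<gamma>\<^sub>1 UNIV"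
    using cdf_left_lim_upper[OF fb1 u] by (simp add: measure1_below)
  then have "eventually (\<lambda>n. measure \<gamma>\<^sub>1 UNIV - end2 / 2 < cdf_left \<gamma>\<^sub>1 (u n)) sequentially"
    by (rule order_tendstoD(1)) (use pos in simp)
  then obtain N where N: "measure \<gamma>\<^sub>1 UNIV - end2 / 2 < cdf_left \<gamma>\<^sub>1 (u N)"
    by (auto simp: eventually_sequentially)
  have D: "end2 / 2 \<le> D_left t" if "t \<in> C" "u N \<le> t" for t
  proof -
    have "cdf_left \<gamma>\<^sub>1 (u N) \<le> cdf_left \<gamma>\<^sub>1 t" using cdf_left_mono[OF fb1 that(2)] .
    moreover have "cdf_left \<gamma>\<^sub>2 t \<le> measure \<gamma>\<^sub>2 {y. ereal y < b}"
      unfolding cdf_left_def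
    proof (rule g2.finite_measure_mono)
      show "{..<t} \<subseteq> {y. ereal y < b}"
      proof
        fix y assume "y \<in> {..<t}"
        then have "ereal y < ereal t" by simp
        also have "ereal t < b" using that(1) by (simp add: C_def)
        finally show "y \<in> {y. ereal y < b}" by simp
      qed
    qed (simp add: g2.M_is_borel)
    moreover have "end2 / 2 + end2 / 2 = end2" by simp
    ultimately show ?thesis using N unfolding D_left_def measure2_below by linarith
  qed
  let ?bd = "A_left (u N) * exp (measure \<gamma>\<^sub>1 UNIV / (end2 / 2))"
  have bound: "A_left (u n) \<le> ?bd" for n
  proof -
    have "A_left (u n) \<le> A_left (u (max n N))"
      using u(1) by (intro A_left_mono lu_in_C) (auto simp: incseq_def)
    also have "\<dots> \<le> ?bd"
    proof (rule A_left_growth[OF lu_in_C(2) lu_in_C(2)])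
      show "u N \<le> u (max n N)" using u(1) by (auto simp: incseq_def)
      fix x assume "u N \<le> x" "x < u (max n N)"
      then show "end2 / 2 \<le> D_left x"
        using C_between[OF lu_in_C(2)[of N] lu_in_C(2)[of "max n N"]] by (intro D) auto
    qed (use pos in simp)
    finally show ?thesis .
  qed
  have "incseq (\<lambda>n. A_left (u n))"
    using u(1) by (auto simp: incseq_def intro!: A_left_mono lu_in_C)
  then obtain w where w: "(\<lambda>n. A_left (u n)) \<longlonglongrightarrow> w" "\<forall>n. A_left (u n) \<le> w"
    using incseq_convergent[of "\<lambda>n. A_left (u n)" ?bd] bound by blast
  have wpos: "0 < w" using w(2)[rule_format, of 0] A_left_pos[of "u 0"] by linarith
  have "(\<lambda>n. B (u n)) \<longlonglongrightarrow> end2 / w"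
    unfolding B_def by (intro tendsto_divide D_left_lim w) (use wpos in simp)
  then show ?thesis using that wpos w(1) by blast
qed

text \<open>Mirror image at a: with an atom there B stays bounded and w is its limit, and without
  one \<open>A_left\<close> = D / B tends to 0 because B is antimonotone.\<close>

lemma left_end:
  obtains w where "0 < w" "(\<lambda>n. A_left (l n)) \<longlonglongrightarrow> end1 / w" "0 < end1 \<Longrightarrow> (\<lambda>n. B (l n)) \<longlonglongrightarrow> w"
proof (cases "end1 = 0")
  case True
  have B0: "0 < B (l 0)" using B_pos[OF lu_in_C(1)] .
  have "(\<lambda>n. D_left (l n) / B (l 0)) \<longlonglongrightarrow> end1 / B (l 0)"
    by (intro tendsto_divide D_left_lim tendsto_const) (use B0 in simp)
  then have lim: "(\<lambda>n. D_left (l n) / B (l 0)) \<longlonglongrightarrow> 0" using True by simp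
  have "(\<lambda>n. A_left (l n)) \<longlonglongrightarrow> 0"
  proof (rule tendsto_sandwich[OF _ _ tendsto_const lim])
    show "\<forall>\<^sub>F n in sequentially. 0 \<le> A_left (l n)" using A_left_pos by (simp add: less_imp_le)
    have "A_left (l n) \<le> D_left (l n) / B (l 0)" for n
    proof -
      have "A_left (l n) = D_left (l n) / B (l n)"
        using D_pos(1)[OF lu_in_C(1)[of n]] by (simp add: B_def)
      also have "\<dots> \<le> D_left (l n) / B (l 0)"
        using B_antimono[OF lu_in_C(1)[of n] lu_in_C(1)[of 0]] l(1) D_pos(1)[OF lu_in_C(1)[of n]] B0
          B_pos[OF lu_in_C(1)[of n]]
        by (intro divide_left_mono) (auto simp: decseq_def)
      finally show ?thesis .
    qed
    then show "\<forall>\<^sub>F n in sequentially. A_left (l n) \<le> D_left (l n) / B (l 0)" by simp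
  qed
  then show ?thesis using that[of 1] True by simp
next
  case False
  then have pos: "0 < end1" using end_nonneg(1) by linarith
  have "(\<lambda>n. cdf_left \<gamma>\<^sub>2 (l n)) \<longlonglongrightarrow> 0"
    using cdf_left_lim_lower[OF fb2 l] by (simp add: measure2_upto)
  then have "eventually (\<lambda>n. cdf_left \<gamma>\<^sub>2 (l n) < end1 / 2) sequentially"
    by (rule order_tendstoD(2)) (use pos in simp)
  then obtain N where N: "cdf_left \<gamma>\<^sub>2 (l N) < end1 / 2" by (auto simp: eventually_sequentially)
  have D: "end1 / 2 \<le> D_left t" if "t \<in> C" "t \<le> l N" for t
  proof -
    have "cdf_left \<gamma>\<^sub>2 t \<le> cdf_left \<gamma>\<^sub>2 (l N)" using cdf_left_mono[OF fb2 that(2)] .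
    moreover have "end1 \<le> cdf_left \<gamma>\<^sub>1 t"
      unfolding end1_def cdf_left_def
    proof (rule g1.finite_measure_mono)
      show "{x. ereal x = a} \<subseteq> {..<t}" using that(1) by (auto simp: C_def)
    qed (simp add: g1.M_is_borel)
    moreover have "end1 / 2 + end1 / 2 = end1" by simp
    ultimately show ?thesis using N unfolding D_left_def by linarith
  qed
  \<comment> \<open>The growth estimate read backwards: left of \<open>l N\<close>,
    \<open>A_left\<close> cannot fall below \<open>\<alpha>\<close> along the sequence, which bounds
    B = D / \<open>A_left\<close> from above.\<close>
  define \<alpha> where "\<alpha> = A_left (l N) / exp (measure \<gamma>\<^sub>1 UNIV / (end1 / 2))"
  have \<alpha>: "0 < \<alpha>" by (simp add: \<alpha>_def)
  have bound: "B (l n) \<le> measure \<gamma>\<^sub>1 UNIV / \<alpha>" for n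
  proof -
    let ?n = "max n N"
    have "B (l n) \<le> B (l ?n)" using l(1) by (intro B_antimono lu_in_C) (auto simp: decseq_def)
    also have "\<dots> \<le> measure \<gamma>\<^sub>1 UNIV / \<alpha>"
    proof -
      have "A_left (l N) \<le> A_left (l ?n) * exp (measure \<gamma>\<^sub>1 UNIV / (end1 / 2))"
      proof (rule A_left_growth[OF lu_in_C(1) lu_in_C(1)])
        show "l ?n \<le> l N" using l(1) by (auto simp: decseq_def)
        fix x assume "l ?n \<le> x" "x < l N"
        then show "end1 / 2 \<le> D_left x"
          using C_between[OF lu_in_C(1)[of ?n] lu_in_C(1)[of N]] by (intro D) auto
      qed (use pos in simp)
      then have "\<alpha> \<le> A_left (l ?n)" unfolding \<alpha>_def by (simp add: divide_le_eq)
      then show ?thesis unfolding B_def using \<alpha> D_left_le_mass by (intro frac_le) auto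
    qed
    finally show ?thesis .
  qed
  have "incseq (\<lambda>n. B (l n))"
    using l(1) by (auto simp: incseq_def decseq_def intro!: B_antimono lu_in_C)
  then obtain w where w: "(\<lambda>n. B (l n)) \<longlonglongrightarrow> w" "\<forall>n. B (l n) \<le> w"
    using incseq_convergent[of "\<lambda>n. B (l n)" "measure \<gamma>\<^sub>1 UNIV / \<alpha>"] bound by blast
  have wpos: "0 < w" using w(2)[rule_format, of 0] B_pos[OF lu_in_C(1), of 0] by linarith
  have "(\<lambda>n. D_left (l n) / B (l n)) \<longlonglongrightarrow> end1 / w"
    by (intro tendsto_divide D_left_lim w) (use wpos in simp)
  moreover have "D_left (l n) / B (l n) = A_left (l n)" for n
    using D_pos(1)[OF lu_in_C(1)[of n]] by (simp add: B_def)
  ultimately show ?thesis using that wpos w(1) by simp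
qed

end

end

section \<open>Slices of product measures over F\<close>

lemma F_set_measurable [measurable]: "F_set \<in> sets (borel \<Otimes>\<^sub>M borel)"
proof -
  have "{z \<in> space (borel \<Otimes>\<^sub>M borel). fst z \<le> (snd z :: real)} \<in> sets (borel \<Otimes>\<^sub>M borel)"
    by measurable
  then show ?thesis by (simp add: F_set_def case_prod_unfold space_pair_measure)
qed

text \<open>The slice of F over x is [x, \<infinity>[ and the slice under y is ]-\<infinity>, y];
  this is the source of the relations between \<open>A\<close>, \<open>B\<close> and the
  marginals.\<close>

lemma restr_F_prod_emeasure:
  assumes "sigma_finite_measure \<eta>\<^sub>1" "sigma_finite_measure \<eta>\<^sub>2"
    and s: "sets \<eta>\<^sub>1 = sets borel" "sets \<eta>\<^sub>2 = sets borel"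
    and X: "X \<in> sets borel"
  shows "emeasure (restr (\<eta>\<^sub>1 \<Otimes>\<^sub>M \<eta>\<^sub>2) F_set) (X \<times> UNIV) = (\<integral>\<^sup>+x. emeasure \<eta>\<^sub>2 {x..} * indicator X x \<partial>\<eta>\<^sub>1)"
    and "emeasure (restr (\<eta>\<^sub>1 \<Otimes>\<^sub>M \<eta>\<^sub>2) F_set) (UNIV \<times> X) = (\<integral>\<^sup>+y. emeasure \<eta>\<^sub>1 {..y} * indicator X y \<partial>\<eta>\<^sub>2)"
proof -
  interpret pair_sigma_finite \<eta>\<^sub>1 \<eta>\<^sub>2 using assms by (simp add: pair_sigma_finite_def)
  have sp: "sets (\<eta>\<^sub>1 \<Otimes>\<^sub>M \<eta>\<^sub>2) = sets (borel \<Otimes>\<^sub>M borel)" by (rule sets_pair_measure_cong[OF s])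
  have XU: "X \<times> UNIV \<in> sets (\<eta>\<^sub>1 \<Otimes>\<^sub>M \<eta>\<^sub>2)" "UNIV \<times> X \<in> sets (\<eta>\<^sub>1 \<Otimes>\<^sub>M \<eta>\<^sub>2)" "F_set \<in> sets (\<eta>\<^sub>1 \<Otimes>\<^sub>M \<eta>\<^sub>2)"
    unfolding sp using X by auto
  have "emeasure (restr (\<eta>\<^sub>1 \<Otimes>\<^sub>M \<eta>\<^sub>2) F_set) (X \<times> UNIV) = (\<integral>\<^sup>+x. emeasure \<eta>\<^sub>2 (Pair x -` (F_set \<inter> X \<times> UNIV)) \<partial>\<eta>\<^sub>1)"
    using XU by (simp add: emeasure_restr M2.emeasure_pair_measure_alt)
  also have "\<dots> = (\<integral>\<^sup>+x. emeasure \<eta>\<^sub>2 {x..} * indicator X x \<partial>\<eta>\<^sub>1)"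
  proof (rule nn_integral_cong)
    fix x
    have "Pair x -` (F_set \<inter> X \<times> UNIV) = (if x \<in> X then {x..} else {})" by (auto simp: F_set_def)
    then show "emeasure \<eta>\<^sub>2 (Pair x -` (F_set \<inter> X \<times> UNIV)) = emeasure \<eta>\<^sub>2 {x..} * indicator X x" by simp
  qed
  finally show "emeasure (restr (\<eta>\<^sub>1 \<Otimes>\<^sub>M \<eta>\<^sub>2) F_set) (X \<times> UNIV) = (\<integral>\<^sup>+x. emeasure \<eta>\<^sub>2 {x..} * indicator X x \<partial>\<eta>\<^sub>1)" .
  have "emeasure (restr (\<eta>\<^sub>1 \<Otimes>\<^sub>M \<eta>\<^sub>2) F_set) (UNIV \<times> X) = (\<integral>\<^sup>+y. emeasure \<eta>\<^sub>1 ((\<lambda>x. (x, y)) -` (F_set \<inter> UNIV \<times> X)) \<partial>\<eta>\<^sub>2)"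
    using XU by (simp add: emeasure_restr emeasure_pair_measure_alt2)
  also have "\<dots> = (\<integral>\<^sup>+y. emeasure \<eta>\<^sub>1 {..y} * indicator X y \<partial>\<eta>\<^sub>2)"
  proof (rule nn_integral_cong)
    fix y
    have "(\<lambda>x. (x, y)) -` (F_set \<inter> UNIV \<times> X) = (if y \<in> X then {..y} else {})" by (auto simp: F_set_def)
    then show "emeasure \<eta>\<^sub>1 ((\<lambda>x. (x, y)) -` (F_set \<inter> UNIV \<times> X)) = emeasure \<eta>\<^sub>1 {..y} * indicator X y" by simp
  qed
  finally show "emeasure (restr (\<eta>\<^sub>1 \<Otimes>\<^sub>M \<eta>\<^sub>2) F_set) (UNIV \<times> X) = (\<integral>\<^sup>+y. emeasure \<eta>\<^sub>1 {..y} * indicator X y \<partial>\<eta>\<^sub>2)" .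
qed

lemma measurable_emeasure_rays:
  assumes \<eta>: "sigma_finite_measure \<eta>\<^sub>1" "sigma_finite_measure \<eta>\<^sub>2" "sets \<eta>\<^sub>1 = sets borel" "sets \<eta>\<^sub>2 = sets borel"
  shows "(\<lambda>x. emeasure \<eta>\<^sub>2 {x :: real..}) \<in> borel_measurable borel"
    and "(\<lambda>y. emeasure \<eta>\<^sub>1 {..y :: real}) \<in> borel_measurable borel"
proof -
  interpret pair_sigma_finite \<eta>\<^sub>1 \<eta>\<^sub>2 using \<eta> by (simp add: pair_sigma_finite_def)
  have F: "F_set \<in> sets (\<eta>\<^sub>1 \<Otimes>\<^sub>M \<eta>\<^sub>2)" unfolding sets_pair_measure_cong[OF \<eta>(3,4)] by simp
  have "Pair x -` F_set = {x..}" "(\<lambda>x. (x, y)) -` F_set = {..y}" for x y by (auto simp: F_set_def)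
  then show "(\<lambda>x. emeasure \<eta>\<^sub>2 {x..}) \<in> borel_measurable borel" "(\<lambda>y. emeasure \<eta>\<^sub>1 {..y}) \<in> borel_measurable borel"
    using M2.measurable_emeasure_Pair[OF F] measurable_emeasure_Pair2[OF F]
    by (simp_all add: measurable_cong_sets[OF \<eta>(3) refl] measurable_cong_sets[OF \<eta>(4) refl])
qed

lemma emeasure_density_set_integral:
  fixes f g :: "real \<Rightarrow> real"
  assumes M: "finite_borel_measure M" and g: "g \<in> borel_measurable borel" and S: "S \<in> sets borel"
    and f: "set_integrable M S f" and eq: "\<And>x. x \<in> S \<Longrightarrow> g x = f x" "\<And>x. x \<in> S \<Longrightarrow> 0 \<le> f x"
  shows "emeasure (density M (\<lambda>x. ennreal (g x))) S = ennreal (LINT x:S|M. f x)"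
proof -
  interpret finite_borel_measure M by fact
  have [measurable]: "g \<in> borel_measurable M" "S \<in> sets M"
    using g S by (auto simp: measurable_cong_sets[OF M_is_borel refl] M_is_borel)
  have "emeasure (density M (\<lambda>x. ennreal (g x))) S = (\<integral>\<^sup>+x. ennreal (g x) * indicator S x \<partial>M)"
    by (rule emeasure_density) auto
  also have "\<dots> = (\<integral>\<^sup>+x. ennreal (indicator S x *\<^sub>R f x) \<partial>M)"
    by (intro nn_integral_cong) (auto simp: indicator_def eq)
  also have "\<dots> = ennreal (LINT x:S|M. f x)"
    unfolding set_lebesgue_integral_def
    by (rule nn_integral_eq_integral) (use f eq(2) in \<open>auto simp: set_integrable_def indicator_def\<close>)
  finally show ?thesis .
qed

context kellerer_pair begin

text \<open>On C take the densities 1 / B with respect to \<open>\<gamma>\<^sub>1\<close> and 1 / A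
  with respect to \<open>\<gamma>\<^sub>2\<close>; the atoms at the ends are weighted with the
  limits \<open>w\<^sub>1\<close> and \<open>w\<^sub>2\<close>. By the slice formula the marginals
  are correct as soon as the slices have the inverse masses.\<close>

lemma kellerer_exists:
  "\<exists>\<eta>\<^sub>1 \<eta>\<^sub>2 :: real measure. sigma_finite_measure \<eta>\<^sub>1 \<and> sets \<eta>\<^sub>1 = sets borel \<and>
     sigma_finite_measure \<eta>\<^sub>2 \<and> sets \<eta>\<^sub>2 = sets borel \<and>
     restr (\<eta>\<^sub>1 \<Otimes>\<^sub>M \<eta>\<^sub>2) F_set \<in> Marg \<gamma>\<^sub>1 \<gamma>\<^sub>2"
proof -
  obtain u l :: "nat \<Rightarrow> real" where seq: "einterval a b = (\<Union>i. {l i .. u i})"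
    "incseq u" "decseq l" "\<And>i. l i < u i" "\<And>i. a < ereal (l i)" "\<And>i. ereal (u i) < b"
    "(\<lambda>n. ereal (l n)) \<longlonglongrightarrow> a" "(\<lambda>n. ereal (u n)) \<longlonglongrightarrow> b"
    by (rule einterval_Icc_approximation[OF ab]) (rule that)
  note S = seq(2,6,8,3,5,7,4)
  note luC = lu_in_C[OF S]
  obtain w\<^sub>2 where w2: "0 < w\<^sub>2" "(\<lambda>n. B (u n)) \<longlonglongrightarrow> end2 / w\<^sub>2" "0 < end2 \<Longrightarrow> (\<lambda>n. A_left (u n)) \<longlonglongrightarrow> w\<^sub>2"
    using right_end[OF S] by blast
  obtain w\<^sub>1 where w1: "0 < w\<^sub>1" "(\<lambda>n. A_left (l n)) \<longlonglongrightarrow> end1 / w\<^sub>1" "0 < end1 \<Longrightarrow> (\<lambda>n. B (l n)) \<longlonglongrightarrow> w\<^sub>1"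
    using left_end[OF S] by blast
  define f1 where "f1 x = (if x \<in> C then 1 / B x else 1 / w\<^sub>1)" for x
  define f2 where "f2 y = (if y \<in> C then 1 / A y else 1 / w\<^sub>2)" for y
  have [measurable]: "f1 \<in> borel_measurable borel" "f2 \<in> borel_measurable borel"
    unfolding f1_def[abs_def] f2_def[abs_def] by measurable
  have fm: "(\<lambda>x. ennreal (f1 x)) \<in> borel_measurable \<gamma>\<^sub>1" "(\<lambda>x. ennreal (f2 x)) \<in> borel_measurable \<gamma>\<^sub>2"
    by (rule meas1, measurable) (rule meas2, measurable)
  define \<eta>\<^sub>1 where "\<eta>\<^sub>1 = density \<gamma>\<^sub>1 (\<lambda>x. ennreal (f1 x))"
  define \<eta>\<^sub>2 where "\<eta>\<^sub>2 = density \<gamma>\<^sub>2 (\<lambda>x. ennreal (f2 x))"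
  have s: "sets \<eta>\<^sub>1 = sets borel" "sets \<eta>\<^sub>2 = sets borel"
    by (auto simp: \<eta>\<^sub>1_def \<eta>\<^sub>2_def g1.M_is_borel g2.M_is_borel)
  have sf: "sigma_finite_measure \<eta>\<^sub>1" "sigma_finite_measure \<eta>\<^sub>2"
    unfolding \<eta>\<^sub>1_def \<eta>\<^sub>2_def using fm
    by (auto simp: g1.sigma_finite_iff_density_finite g2.sigma_finite_iff_density_finite)
  have conc1': "AE x in \<gamma>\<^sub>1. x \<in> C \<or> ereal x = a"
    using conc1 by eventually_elim (auto simp: C_def le_less)
  have conc2': "AE y in \<gamma>\<^sub>2. y \<in> C \<or> ereal y = b"
    using conc2 by eventually_elim (auto simp: C_def le_less)
  have AE1: "AE x in \<eta>\<^sub>1. x \<in> C \<or> ereal x = a"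
    unfolding \<eta>\<^sub>1_def using conc1' fm by (subst AE_density) auto
  have AE2: "AE y in \<eta>\<^sub>2. y \<in> C \<or> ereal y = b"
    unfolding \<eta>\<^sub>2_def using conc2' fm by (subst AE_density) auto
  have Icc1: "emeasure \<eta>\<^sub>1 {s..<t} = ennreal (A_left t - A_left s)" if "s \<in> C" "t \<in> C" "s \<le> t" for s t
    unfolding \<eta>\<^sub>1_def density1_integral[OF that, symmetric]
    by (rule emeasure_density_set_integral[OF fb1 _ _ density1_integrable[OF that]])
       (use C_between[OF that(1,2)] B_pos in \<open>auto simp: f1_def less_imp_le\<close>)
  have Icc2: "emeasure \<eta>\<^sub>2 {s..<t} = ennreal (B s - B t)" if "s \<in> C" "t \<in> C" "s \<le> t" for s t
    unfolding \<eta>\<^sub>2_def density2_integral[OF that, symmetric]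
    by (rule emeasure_density_set_integral[OF fb2 _ _ density2_integrable[OF that]])
       (use C_between[OF that(1,2)] A_pos in \<open>auto simp: f2_def less_imp_le\<close>)
  have u_gt: "eventually (\<lambda>n. x < u n) sequentially" if "x \<in> C" for x
    using order_tendstoD(1)[OF seq(8), of "ereal x"] that by (simp add: C_def)
  have l_lt: "eventually (\<lambda>n. l n < x) sequentially" if "x \<in> C" for x
    using order_tendstoD(2)[OF seq(7), of "ereal x"] that by (simp add: C_def)
  have in_lu: "\<exists>n. l n \<le> x \<and> x < u n" if "x \<in> C" for x
    using eventually_happens'[OF sequentially_bot eventually_conj[OF l_lt[OF that] u_gt[OF that]]]
    by (meson less_imp_le)
  have lu_C: "x \<in> C" if "l m \<le> x" "x \<le> u n" for x m n
    using C_between[OF luC(1)[of m] luC(2)[of n]] that by blast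
  have UnC: "(\<Union>n. {l n..<u n}) = C"
  proof (intro equalityI subsetI)
    fix x assume "x \<in> (\<Union>n. {l n..<u n})"
    then obtain n where "l n \<le> x" "x < u n" by auto
    then show "x \<in> C" using lu_C[of n x n] by simp
  next
    fix x assume "x \<in> C"
    then show "x \<in> (\<Union>n. {l n..<u n})" using in_lu[of x] by auto
  qed
  have incs: "incseq (\<lambda>n. {l n..<u n})"
    unfolding incseq_def
  proof (intro allI impI subsetI)
    fix m n x assume "m \<le> n" "x \<in> {l m..<u m}"
    moreover have "l n \<le> l m" "u m \<le> u n" if "m \<le> n"
      using that seq(2,3) by (auto simp: incseq_def decseq_def)
    ultimately show "x \<in> {l n..<u n}" by auto
  qed
  have end1_mass: "emeasure \<eta>\<^sub>1 {x. ereal x = a} = ennreal (end1 / w\<^sub>1)"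
  proof -
    have "emeasure \<eta>\<^sub>1 {x. ereal x = a} = (\<integral>\<^sup>+x. ennreal (1 / w\<^sub>1) * indicator {x. ereal x = a} x \<partial>\<gamma>\<^sub>1)"
      unfolding \<eta>\<^sub>1_def using fm by (subst emeasure_density)
        (auto simp: g1.M_is_borel f1_def C_def indicator_def intro!: nn_integral_cong)
    also have "\<dots> = ennreal (1 / w\<^sub>1) * emeasure \<gamma>\<^sub>1 {x. ereal x = a}"
      by (rule nn_integral_cmult_indicator) (simp add: g1.M_is_borel)
    finally show ?thesis
      using w1(1) by (simp add: g1.emeasure_eq_measure end1_def[symmetric] ennreal_mult'[symmetric])
  qed
  have end2_mass: "emeasure \<eta>\<^sub>2 {x. ereal x = b} = ennreal (end2 / w\<^sub>2)"
  proof -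
    have "emeasure \<eta>\<^sub>2 {x. ereal x = b} = (\<integral>\<^sup>+x. ennreal (1 / w\<^sub>2) * indicator {x. ereal x = b} x \<partial>\<gamma>\<^sub>2)"
      unfolding \<eta>\<^sub>2_def using fm by (subst emeasure_density)
        (auto simp: g2.M_is_borel f2_def C_def indicator_def intro!: nn_integral_cong)
    also have "\<dots> = ennreal (1 / w\<^sub>2) * emeasure \<gamma>\<^sub>2 {x. ereal x = b}"
      by (rule nn_integral_cmult_indicator) (simp add: g2.M_is_borel)
    finally show ?thesis
      using w2(1) by (simp add: g2.emeasure_eq_measure end2_def[symmetric] ennreal_mult'[symmetric])
  qed
  \<comment> \<open>Telescoping over C gives B x minus its limit at b, and the atom of
    \<open>\<eta>\<^sub>2\<close> at b restores exactly this limit.\<close>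
  have up: "emeasure \<eta>\<^sub>2 {x..} = ennreal (B x)" if x: "x \<in> C" for x
  proof -
    have "(\<lambda>n. emeasure \<eta>\<^sub>2 {x..<u n}) \<longlonglongrightarrow> emeasure \<eta>\<^sub>2 (\<Union>n. {x..<u n})"
      using seq(2) s by (intro Lim_emeasure_incseq) (auto simp: incseq_def intro: less_le_trans)
    moreover have "(\<Union>n. {x..<u n}) = C \<inter> {x..}"
    proof (intro equalityI subsetI)
      fix y assume "y \<in> (\<Union>n. {x..<u n})"
      then obtain n where "x \<le> y" "y < u n" by auto
      then show "y \<in> C \<inter> {x..}" using C_between[OF x luC(2), of y n] by simp
    next
      fix y assume "y \<in> C \<inter> {x..}"
      then show "y \<in> (\<Union>n. {x..<u n})" using in_lu[of y] by auto
    qed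
    moreover have "(\<lambda>n. emeasure \<eta>\<^sub>2 {x..<u n}) \<longlonglongrightarrow> ennreal (B x - end2 / w\<^sub>2)"
    proof (rule Lim_transform_eventually)
      show "(\<lambda>n. ennreal (B x - B (u n))) \<longlonglongrightarrow> ennreal (B x - end2 / w\<^sub>2)"
        by (intro tendsto_ennrealI tendsto_diff tendsto_const w2)
      show "\<forall>\<^sub>F n in sequentially. ennreal (B x - B (u n)) = emeasure \<eta>\<^sub>2 {x..<u n}"
        using u_gt[OF x] by eventually_elim (simp add: Icc2[OF x luC(2)])
    qed
    ultimately have 1: "emeasure \<eta>\<^sub>2 (C \<inter> {x..}) = ennreal (B x - end2 / w\<^sub>2)"
      using LIMSEQ_unique by metis
    have le: "end2 / w\<^sub>2 \<le> B x"
    proof (rule LIMSEQ_le_const2[OF w2(2)])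
      obtain N where N: "\<And>n. N \<le> n \<Longrightarrow> x < u n" using u_gt[OF x] by (auto simp: eventually_sequentially)
      show "\<exists>N. \<forall>n\<ge>N. B (u n) \<le> B x"
        using B_antimono[OF x luC(2) less_imp_le[OF N]] by blast
    qed
    have "emeasure \<eta>\<^sub>2 {x..} = emeasure \<eta>\<^sub>2 ((C \<inter> {x..}) \<union> {y. ereal y = b})"
      using AE2
    proof (intro emeasure_eq_AE, eventually_elim)
      case (elim y)
      have "ereal x < b" using x by (simp add: C_def)
      then show ?case using elim by (auto simp: less_imp_le)
    qed (auto simp: s)
    also have "\<dots> = emeasure \<eta>\<^sub>2 (C \<inter> {x..}) + emeasure \<eta>\<^sub>2 {y. ereal y = b}"
      by (rule plus_emeasure[symmetric]) (auto simp: s C_def)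
    also have "\<dots> = ennreal (B x)"
      unfolding 1 end2_mass using le w2(1) by (simp add: ennreal_plus[symmetric] del: ennreal_plus)
    finally show ?thesis .
  qed
  have C_lim1: "(\<lambda>n. ennreal (A_left (u n) - A_left (l n))) \<longlonglongrightarrow> emeasure \<eta>\<^sub>1 C"
    using Lim_emeasure_incseq[of "\<lambda>n. {l n..<u n}" \<eta>\<^sub>1] incs s UnC
    by (simp add: Icc1[OF luC(1) luC(2) less_imp_le[OF seq(4)]] image_subset_iff)
  have C_lim2: "(\<lambda>n. ennreal (B (l n) - B (u n))) \<longlonglongrightarrow> emeasure \<eta>\<^sub>2 C"
    using Lim_emeasure_incseq[of "\<lambda>n. {l n..<u n}" \<eta>\<^sub>2] incs s UnC
    by (simp add: Icc2[OF luC(1) luC(2) less_imp_le[OF seq(4)]] image_subset_iff)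
  \<comment> \<open>The slice over a carries all of \<open>\<eta>\<^sub>2\<close>, whose total mass
    is the limit \<open>w\<^sub>1\<close> of B; this limit is available when
    \<open>\<gamma>\<^sub>1\<close> has an atom at a.\<close>
  have up_a: "emeasure \<eta>\<^sub>2 {x..} = ennreal w\<^sub>1" if x: "ereal x = a" and pos: "0 < end1" for x
  proof -
    have "(\<lambda>n. ennreal (B (l n) - B (u n))) \<longlonglongrightarrow> ennreal (w\<^sub>1 - end2 / w\<^sub>2)"
      by (intro tendsto_ennrealI tendsto_diff w2(2) w1(3) pos)
    then have 1: "emeasure \<eta>\<^sub>2 C = ennreal (w\<^sub>1 - end2 / w\<^sub>2)" using C_lim2 LIMSEQ_unique by blast
    have le: "end2 / w\<^sub>2 \<le> w\<^sub>1"
      by (rule LIMSEQ_le[OF w2(2) w1(3)[OF pos]])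
         (intro exI[of _ 0] allI impI B_antimono luC less_imp_le[OF seq(4)])
    have "emeasure \<eta>\<^sub>2 {x..} = emeasure \<eta>\<^sub>2 (C \<union> {y. ereal y = b})"
      using AE2
    proof (intro emeasure_eq_AE, eventually_elim)
      case (elim y)
      have "ereal x < b" using x ab by simp
      then show ?case using elim x by (auto simp: C_def less_imp_le)
    qed (auto simp: s)
    also have "\<dots> = emeasure \<eta>\<^sub>2 C + emeasure \<eta>\<^sub>2 {y. ereal y = b}"
      by (rule plus_emeasure[symmetric]) (auto simp: s C_def)
    also have "\<dots> = ennreal w\<^sub>1"
      unfolding 1 end2_mass using le w2(1) by (simp add: ennreal_plus[symmetric] del: ennreal_plus)
    finally show ?thesis .
  qed
  \<comment> \<open>The slice is closed at y, so the atom of \<open>\<eta>\<^sub>1\<close> at y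
    lifts \<open>A_left y\<close> to \<open>A y\<close>; the atom at a restores the limit lost in
    telescoping.\<close>
  have down: "emeasure \<eta>\<^sub>1 {..y} = ennreal (A y)" if y: "y \<in> C" for y
  proof -
    have "(\<lambda>n. emeasure \<eta>\<^sub>1 {l n..<y}) \<longlonglongrightarrow> emeasure \<eta>\<^sub>1 (\<Union>n. {l n..<y})"
      using seq(3) s by (intro Lim_emeasure_incseq) (auto simp: incseq_def decseq_def intro: order_trans)
    moreover have "(\<Union>n. {l n..<y}) = C \<inter> {..<y}"
    proof (intro equalityI subsetI)
      fix x assume "x \<in> (\<Union>n. {l n..<y})"
      then obtain n where "l n \<le> x" "x < y" by auto
      then show "x \<in> C \<inter> {..<y}" using C_between[OF luC(1) y, of n x] by simp
    next
      fix x assume "x \<in> C \<inter> {..<y}"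
      then show "x \<in> (\<Union>n. {l n..<y})" using in_lu[of x] by auto
    qed
    moreover have "(\<lambda>n. emeasure \<eta>\<^sub>1 {l n..<y}) \<longlonglongrightarrow> ennreal (A_left y - end1 / w\<^sub>1)"
    proof (rule Lim_transform_eventually)
      show "(\<lambda>n. ennreal (A_left y - A_left (l n))) \<longlonglongrightarrow> ennreal (A_left y - end1 / w\<^sub>1)"
        by (intro tendsto_ennrealI tendsto_diff tendsto_const w1)
      show "\<forall>\<^sub>F n in sequentially. ennreal (A_left y - A_left (l n)) = emeasure \<eta>\<^sub>1 {l n..<y}"
        using l_lt[OF y] by eventually_elim (simp add: Icc1[OF luC(1) y])
    qed
    ultimately have 1: "emeasure \<eta>\<^sub>1 (C \<inter> {..<y}) = ennreal (A_left y - end1 / w\<^sub>1)"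
      using LIMSEQ_unique by metis
    have le: "end1 / w\<^sub>1 \<le> A_left y"
    proof (rule LIMSEQ_le_const2[OF w1(2)])
      obtain N where N: "\<And>n. N \<le> n \<Longrightarrow> l n < y" using l_lt[OF y] by (auto simp: eventually_sequentially)
      show "\<exists>N. \<forall>n\<ge>N. A_left (l n) \<le> A_left y"
        using A_left_mono[OF luC(1) y less_imp_le[OF N]] by blast
    qed
    have 2: "emeasure \<eta>\<^sub>1 {y} = ennreal (1 / B y * atom y)"
    proof -
      have "emeasure \<eta>\<^sub>1 {y} = (\<integral>\<^sup>+x. ennreal (1 / B y) * indicator {y} x \<partial>\<gamma>\<^sub>1)"
        unfolding \<eta>\<^sub>1_def using fm y by (subst emeasure_density)
          (auto simp: g1.M_is_borel f1_def indicator_def intro!: nn_integral_cong)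
      also have "\<dots> = ennreal (1 / B y) * emeasure \<gamma>\<^sub>1 {y}"
        by (rule nn_integral_cmult_indicator) (simp add: g1.M_is_borel)
      finally show ?thesis
        using B_pos[OF y] by (simp add: g1.emeasure_eq_measure atom_def ennreal_mult'[symmetric])
    qed
    have "emeasure \<eta>\<^sub>1 {..y} = emeasure \<eta>\<^sub>1 (((C \<inter> {..<y}) \<union> {y}) \<union> {x. ereal x = a})"
      using AE1
    proof (intro emeasure_eq_AE, eventually_elim)
      case (elim x)
      have "a < ereal y" using y by (simp add: C_def)
      then show ?case using elim y by (auto simp: less_imp_le)
    qed (auto simp: s)
    also have "\<dots> = emeasure \<eta>\<^sub>1 ((C \<inter> {..<y}) \<union> {y}) + emeasure \<eta>\<^sub>1 {x. ereal x = a}"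
      using y by (intro plus_emeasure[symmetric]) (auto simp: s C_def)
    also have "emeasure \<eta>\<^sub>1 ((C \<inter> {..<y}) \<union> {y}) = emeasure \<eta>\<^sub>1 (C \<inter> {..<y}) + emeasure \<eta>\<^sub>1 {y}"
      by (intro plus_emeasure[symmetric]) (auto simp: s)
    also have "emeasure \<eta>\<^sub>1 (C \<inter> {..<y}) + emeasure \<eta>\<^sub>1 {y} + emeasure \<eta>\<^sub>1 {x. ereal x = a} = ennreal (A y)"
      unfolding 1 2 end1_mass density1_jump[OF y, symmetric] using le w1(1) B_pos[OF y]
      by (simp add: ennreal_plus[symmetric] del: ennreal_plus)
    finally show ?thesis .
  qed
  have down_b: "emeasure \<eta>\<^sub>1 {..y} = ennreal w\<^sub>2" if y: "ereal y = b" and pos: "0 < end2" for y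
  proof -
    have "(\<lambda>n. ennreal (A_left (u n) - A_left (l n))) \<longlonglongrightarrow> ennreal (w\<^sub>2 - end1 / w\<^sub>1)"
      by (intro tendsto_ennrealI tendsto_diff w1(2) w2(3) pos)
    then have 1: "emeasure \<eta>\<^sub>1 C = ennreal (w\<^sub>2 - end1 / w\<^sub>1)" using C_lim1 LIMSEQ_unique by blast
    have le: "end1 / w\<^sub>1 \<le> w\<^sub>2"
      by (rule LIMSEQ_le[OF w1(2) w2(3)[OF pos]])
         (intro exI[of _ 0] allI impI A_left_mono luC less_imp_le[OF seq(4)])
    have "emeasure \<eta>\<^sub>1 {..y} = emeasure \<eta>\<^sub>1 (C \<union> {x. ereal x = a})"
      using AE1
    proof (intro emeasure_eq_AE, eventually_elim)
      case (elim x)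
      have "a < ereal y" using y ab by simp
      then show ?case using elim y by (auto simp: C_def less_imp_le)
    qed (auto simp: s)
    also have "\<dots> = emeasure \<eta>\<^sub>1 C + emeasure \<eta>\<^sub>1 {x. ereal x = a}"
      by (rule plus_emeasure[symmetric]) (auto simp: s C_def)
    also have "\<dots> = ennreal w\<^sub>2"
      unfolding 1 end1_mass using le w1(1) by (simp add: ennreal_plus[symmetric] del: ennreal_plus)
    finally show ?thesis .
  qed
  have e1: "AE x in \<gamma>\<^sub>1. ennreal (f1 x) * emeasure \<eta>\<^sub>2 {x..} = 1"
  proof -
    \<comment> \<open>The slice mass at a is known only if \<open>end1\<close> is positive;
      otherwise a is a null point of \<open>\<gamma>\<^sub>1\<close>.\<close>
    have "AE x in \<gamma>\<^sub>1. ereal x = a \<longrightarrow> 0 < end1"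
    proof (cases "end1 = 0")
      case True
      have "AE x in \<gamma>\<^sub>1. \<not> (ereal x = a)"
        by (rule AE_I[of _ _ "{x. ereal x = a}"])
           (use True in \<open>auto simp: g1.emeasure_eq_measure end1_def g1.M_is_borel\<close>)
      then show ?thesis by eventually_elim simp
    qed (use end_nonneg(1) in \<open>auto simp: less_le\<close>)
    with conc1' show ?thesis
    proof eventually_elim
      case (elim x)
      show ?case
      proof (cases "x \<in> C")
        case True
        then show ?thesis using B_pos[OF True] by (simp add: up f1_def ennreal_mult'[symmetric])
      next
        case False
        then have "ereal x = a" "0 < end1" using elim by auto
        then show ?thesis using False w1(1) by (simp add: up_a f1_def ennreal_mult'[symmetric])
      qed
    qed
  qed
  have e2: "AE y in \<gamma>\<^sub>2. ennreal (f2 y) * emeasure \<eta>\<^sub>1 {..y} = 1"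
  proof -
    have "AE y in \<gamma>\<^sub>2. ereal y = b \<longrightarrow> 0 < end2"
    proof (cases "end2 = 0")
      case True
      have "AE x in \<gamma>\<^sub>2. \<not> (ereal x = b)"
        by (rule AE_I[of _ _ "{x. ereal x = b}"])
           (use True in \<open>auto simp: g2.emeasure_eq_measure end2_def g2.M_is_borel\<close>)
      then show ?thesis by eventually_elim simp
    qed (use end_nonneg(2) in \<open>auto simp: less_le\<close>)
    with conc2' show ?thesis
    proof eventually_elim
      case (elim y)
      show ?case
      proof (cases "y \<in> C")
        case True
        then show ?thesis using A_pos[OF True] by (simp add: down f2_def ennreal_mult'[symmetric])
      next
        case False
        then have "ereal y = b" "0 < end2" using elim by auto
        then show ?thesis using False w2(1) by (simp add: down_b f2_def ennreal_mult'[symmetric])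
      qed
    qed
  qed
  note meas_tail = measurable_emeasure_rays(1)[OF sf s] and meas_head = measurable_emeasure_rays(2)[OF sf s]
  let ?\<pi> = "restr (\<eta>\<^sub>1 \<Otimes>\<^sub>M \<eta>\<^sub>2) F_set"
  have m1: "emeasure ?\<pi> (X \<times> UNIV) = emeasure \<gamma>\<^sub>1 X" if X: "X \<in> sets borel" for X
  proof -
    have "emeasure ?\<pi> (X \<times> UNIV) = (\<integral>\<^sup>+x. emeasure \<eta>\<^sub>2 {x..} * indicator X x \<partial>\<eta>\<^sub>1)"
      by (rule restr_F_prod_emeasure[OF sf s X])
    also have "\<dots> = (\<integral>\<^sup>+x. ennreal (f1 x) * (emeasure \<eta>\<^sub>2 {x..} * indicator X x) \<partial>\<gamma>\<^sub>1)"
      unfolding \<eta>\<^sub>1_def using meas_tail X fm by (intro nn_integral_density meas1) auto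
    also have "\<dots> = (\<integral>\<^sup>+x. indicator X x \<partial>\<gamma>\<^sub>1)"
      using e1 by (intro nn_integral_cong_AE) (auto elim!: eventually_mono simp: mult.assoc[symmetric])
    finally show ?thesis using X by (simp add: g1.M_is_borel)
  qed
  have m2: "emeasure ?\<pi> (UNIV \<times> X) = emeasure \<gamma>\<^sub>2 X" if X: "X \<in> sets borel" for X
  proof -
    have "emeasure ?\<pi> (UNIV \<times> X) = (\<integral>\<^sup>+y. emeasure \<eta>\<^sub>1 {..y} * indicator X y \<partial>\<eta>\<^sub>2)"
      by (rule restr_F_prod_emeasure[OF sf s X])
    also have "\<dots> = (\<integral>\<^sup>+y. ennreal (f2 y) * (emeasure \<eta>\<^sub>1 {..y} * indicator X y) \<partial>\<gamma>\<^sub>2)"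
      unfolding \<eta>\<^sub>2_def using meas_head X fm by (intro nn_integral_density meas2) auto
    also have "\<dots> = (\<integral>\<^sup>+x. indicator X x \<partial>\<gamma>\<^sub>2)"
      using e2 by (intro nn_integral_cong_AE) (auto elim!: eventually_mono simp: mult.assoc[symmetric])
    finally show ?thesis using X by (simp add: g2.M_is_borel)
  qed
  have "?\<pi> \<in> Marg \<gamma>\<^sub>1 \<gamma>\<^sub>2"
  proof (rule MargI)
    show sets\<pi>: "sets ?\<pi> = sets borel"
      unfolding borel_prod[symmetric] sets_restr by (rule sets_pair_measure_cong[OF s])
    show "finite_measure ?\<pi>"
      using m1[of UNIV] sets_eq_imp_space_eq[OF sets\<pi>] by (intro finite_measureI) simp
  qed (use m1 m2 in \<open>auto simp: g1.M_is_borel g2.M_is_borel\<close>)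
  then show ?thesis using sf s by blast
qed

end

section \<open>Uniqueness of Kellerer plans\<close>

text \<open>\<open>\<eta>\<close> itself may have a part singular to \<mu>, so only its restriction
  to \<open>N\<close> is given a density. Sigma-finiteness makes this density finite almost
  everywhere, hence real-valued.\<close>

lemma restr_eq_density:
  fixes \<mu> \<eta> :: "real measure"
  assumes \<mu>: "finite_borel_measure \<mu>" and \<eta>: "sigma_finite_measure \<eta>" "sets \<eta> = sets borel"
    and N: "N \<in> sets borel" and null: "\<And>X. X \<in> sets borel \<Longrightarrow> emeasure \<mu> X = 0 \<Longrightarrow> emeasure \<eta> (N \<inter> X) = 0"
  obtains G :: "real \<Rightarrow> real" where "G \<in> borel_measurable borel" "\<And>x. 0 \<le> G x"
    "restr \<eta> N = density \<mu> (\<lambda>x. ennreal (G x))"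
proof -
  interpret \<mu>: finite_borel_measure \<mu> by fact
  interpret \<eta>: sigma_finite_measure \<eta> by fact
  have N': "N \<in> sets \<eta>" using N \<eta>(2) by simp
  have s: "sets (restr \<eta> N) = sets \<mu>" using \<eta>(2) by (simp add: \<mu>.M_is_borel)
  have ac: "absolutely_continuous \<mu> (restr \<eta> N)"
    unfolding absolutely_continuous_def
  proof
    fix X assume "X \<in> null_sets \<mu>"
    then have "X \<in> sets borel" "emeasure \<mu> X = 0" by (auto simp: null_sets_def \<mu>.M_is_borel)
    then show "X \<in> null_sets (restr \<eta> N)"
      using null[of X] N' \<eta>(2) by (auto simp: null_sets_def emeasure_restr)
  qed
  have sf: "sigma_finite_measure (restr \<eta> N)"
    unfolding restr_def using N' by (subst \<eta>.sigma_finite_iff_density_finite) (auto simp: indicator_def)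
  define G where "G x = enn2real (RN_deriv \<mu> (restr \<eta> N) x)" for x
  have "G \<in> borel_measurable \<mu>" unfolding G_def[abs_def] by measurable
  then have G: "G \<in> borel_measurable borel" by (simp add: measurable_cong_sets[OF \<mu>.M_is_borel refl])
  have "restr \<eta> N = density \<mu> (RN_deriv \<mu> (restr \<eta> N))"
    using \<mu>.density_RN_deriv[OF ac s] by simp
  also have "\<dots> = density \<mu> (\<lambda>x. ennreal (G x))"
  proof (rule density_cong)
    show "AE x in \<mu>. RN_deriv \<mu> (restr \<eta> N) x = ennreal (G x)"
      using \<mu>.RN_deriv_finite[OF sf ac s] by eventually_elim (simp add: G_def top.not_eq_extremum)
  qed (use \<open>G \<in> borel_measurable \<mu>\<close> in auto)
  finally have eq: "restr \<eta> N = density \<mu> (\<lambda>x. ennreal (G x))" .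
  show ?thesis by (rule that[OF G _ eq]) (simp add: G_def)
qed

lemma prod_sets: "finite_borel_measure \<mu> \<Longrightarrow> finite_borel_measure \<nu> \<Longrightarrow> sets (\<mu> \<Otimes>\<^sub>M \<nu>) = sets borel"
  unfolding borel_prod[symmetric] by (intro sets_pair_measure_cong finite_borel_measure.M_is_borel)

text \<open>\<open>\<eta>\<^sub>1\<close> may be singular where the slices are null, but the plan
  does not charge those points. On \<open>N1\<close>, where slices have positive mass, a \<mu>-null
  set is \<open>\<gamma>\<^sub>1\<close>-null and hence \<open>\<eta>\<^sub>1\<close>-null. The
  reference measures are left free: uniqueness uses the marginals themselves, the entropy uses \<mu>
  and \<nu>.\<close>

lemma product_form:
  fixes \<mu> \<nu> \<gamma>\<^sub>1 \<gamma>\<^sub>2 \<eta>\<^sub>1 \<eta>\<^sub>2 :: "real measure"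
  assumes \<eta>: "sigma_finite_measure \<eta>\<^sub>1" "sigma_finite_measure \<eta>\<^sub>2" "sets \<eta>\<^sub>1 = sets borel" "sets \<eta>\<^sub>2 = sets borel"
    and Marg: "restr (\<eta>\<^sub>1 \<Otimes>\<^sub>M \<eta>\<^sub>2) F_set \<in> Marg \<gamma>\<^sub>1 \<gamma>\<^sub>2"
    and \<mu>: "finite_borel_measure \<mu>" and \<nu>: "finite_borel_measure \<nu>"
    and ac1: "\<And>X. X \<in> sets borel \<Longrightarrow> emeasure \<mu> X = 0 \<Longrightarrow> emeasure \<gamma>\<^sub>1 X = 0"
    and ac2: "\<And>X. X \<in> sets borel \<Longrightarrow> emeasure \<nu> X = 0 \<Longrightarrow> emeasure \<gamma>\<^sub>2 X = 0"
  obtains G H :: "real \<Rightarrow> real" where "G \<in> borel_measurable borel" "H \<in> borel_measurable borel"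
    "\<And>x. 0 \<le> G x" "\<And>y. 0 \<le> H y"
    "restr (\<eta>\<^sub>1 \<Otimes>\<^sub>M \<eta>\<^sub>2) F_set = density (\<mu> \<Otimes>\<^sub>M \<nu>) (\<lambda>z. ennreal (indicator F_set z * (G (fst z) * H (snd z))))"
proof -
  interpret \<mu>: finite_borel_measure \<mu> by fact
  interpret \<nu>: finite_borel_measure \<nu> by fact
  interpret P: pair_sigma_finite \<eta>\<^sub>1 \<eta>\<^sub>2 using \<eta> by (simp add: pair_sigma_finite_def)
  let ?\<pi> = "restr (\<eta>\<^sub>1 \<Otimes>\<^sub>M \<eta>\<^sub>2) F_set"
  note MD = MargD[OF Marg]
  have sP: "sets (\<eta>\<^sub>1 \<Otimes>\<^sub>M \<eta>\<^sub>2) = sets (borel \<Otimes>\<^sub>M borel)" by (rule sets_pair_measure_cong[OF \<eta>(3,4)])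
  have FP: "F_set \<in> sets (\<eta>\<^sub>1 \<Otimes>\<^sub>M \<eta>\<^sub>2)" unfolding sP by simp
  note m1 = measurable_emeasure_rays(1)[OF \<eta>] and m2 = measurable_emeasure_rays(2)[OF \<eta>]
  define N1 where "N1 = {x. emeasure \<eta>\<^sub>2 {x..} \<noteq> 0}"
  define N2 where "N2 = {y. emeasure \<eta>\<^sub>1 {..y} \<noteq> 0}"
  have N: "N1 \<in> sets borel" "N2 \<in> sets borel"
    unfolding N1_def N2_def using m1 m2 by measurable
  have e1: "emeasure \<gamma>\<^sub>1 X = (\<integral>\<^sup>+x. emeasure \<eta>\<^sub>2 {x..} * indicator X x \<partial>\<eta>\<^sub>1)" if "X \<in> sets borel" for X
    using MD(5)[OF that] restr_F_prod_emeasure(1)[OF \<eta> that] by simp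
  have e2: "emeasure \<gamma>\<^sub>2 X = (\<integral>\<^sup>+y. emeasure \<eta>\<^sub>1 {..y} * indicator X y \<partial>\<eta>\<^sub>2)" if "X \<in> sets borel" for X
    using MD(6)[OF that] restr_F_prod_emeasure(2)[OF \<eta> that] by simp
  have null1: "emeasure \<eta>\<^sub>1 (N1 \<inter> X) = 0" if X: "X \<in> sets borel" "emeasure \<mu> X = 0" for X
  proof -
    have "(\<integral>\<^sup>+x. emeasure \<eta>\<^sub>2 {x..} * indicator X x \<partial>\<eta>\<^sub>1) = 0"
      using ac1[OF X] e1[OF X(1)] by simp
    then have "AE x in \<eta>\<^sub>1. emeasure \<eta>\<^sub>2 {x..} * indicator X x = 0"
      using m1 X(1) by (subst (asm) nn_integral_0_iff_AE) (auto simp: measurable_cong_sets[OF \<eta>(3) refl])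
    then have "AE x in \<eta>\<^sub>1. x \<notin> N1 \<inter> X" by eventually_elim (auto simp: N1_def)
    then show ?thesis using emeasure_eq_0_AE[of "\<lambda>x. x \<in> N1 \<inter> X" \<eta>\<^sub>1] sets_eq_imp_space_eq[OF \<eta>(3)]
      by (simp add: Int_def)
  qed
  have null2: "emeasure \<eta>\<^sub>2 (N2 \<inter> X) = 0" if X: "X \<in> sets borel" "emeasure \<nu> X = 0" for X
  proof -
    have "(\<integral>\<^sup>+x. emeasure \<eta>\<^sub>1 {..x} * indicator X x \<partial>\<eta>\<^sub>2) = 0"
      using ac2[OF X] e2[OF X(1)] by simp
    then have "AE x in \<eta>\<^sub>2. emeasure \<eta>\<^sub>1 {..x} * indicator X x = 0"
      using m2 X(1) by (subst (asm) nn_integral_0_iff_AE) (auto simp: measurable_cong_sets[OF \<eta>(4) refl])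
    then have "AE x in \<eta>\<^sub>2. x \<notin> N2 \<inter> X" by eventually_elim (auto simp: N2_def)
    then show ?thesis using emeasure_eq_0_AE[of "\<lambda>x. x \<in> N2 \<inter> X" \<eta>\<^sub>2] sets_eq_imp_space_eq[OF \<eta>(4)]
      by (simp add: Int_def)
  qed
  obtain G where G: "G \<in> borel_measurable borel" "\<And>x. 0 \<le> G x" "restr \<eta>\<^sub>1 N1 = density \<mu> (\<lambda>x. ennreal (G x))"
    using restr_eq_density[OF \<mu> \<eta>(1,3) N(1) null1] by blast
  obtain H where H: "H \<in> borel_measurable borel" "\<And>x. 0 \<le> H x" "restr \<eta>\<^sub>2 N2 = density \<nu> (\<lambda>x. ennreal (H x))"
    using restr_eq_density[OF \<nu> \<eta>(2,4) N(2) null2] by blast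
  have "emeasure ?\<pi> ((- N1) \<times> UNIV) = 0"
    using N(1) by (subst restr_F_prod_emeasure(1)[OF \<eta>])
      (auto simp: N1_def indicator_def intro!: nn_integral_zero' AE_I2)
  moreover have "emeasure ?\<pi> (UNIV \<times> (- N2)) = 0"
    using N(2) by (subst restr_F_prod_emeasure(2)[OF \<eta>])
      (auto simp: N2_def indicator_def intro!: nn_integral_zero' AE_I2)
  moreover have "(- N1) \<times> UNIV \<in> sets ?\<pi>" "UNIV \<times> (- N2) \<in> sets ?\<pi>"
    unfolding sets_restr sP using N by auto
  ultimately have "AE z in ?\<pi>. z \<notin> (- N1) \<times> UNIV" "AE z in ?\<pi>. z \<notin> UNIV \<times> (- N2)"
    by (auto intro!: AE_not_in simp: null_sets_def)
  then have "AE z in ?\<pi>. fst z \<in> N1 \<and> snd z \<in> N2"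
    by eventually_elim (auto simp: mem_Times_iff)
  then have AEN: "AE z in \<eta>\<^sub>1 \<Otimes>\<^sub>M \<eta>\<^sub>2. z \<in> F_set \<longrightarrow> fst z \<in> N1 \<and> snd z \<in> N2"
    by (subst (asm) AE_restr_iff[OF FP])
  have sf2: "sigma_finite_measure (restr \<eta>\<^sub>2 N2)"
    unfolding restr_def using N \<eta>(4) by (subst P.M2.sigma_finite_iff_density_finite) (auto simp: indicator_def)
  have [measurable]: "N1 \<in> sets \<eta>\<^sub>1" "N2 \<in> sets \<eta>\<^sub>2" using N \<eta> by auto
  have pr1: "restr \<eta>\<^sub>1 N1 \<Otimes>\<^sub>M restr \<eta>\<^sub>2 N2 = density (\<eta>\<^sub>1 \<Otimes>\<^sub>M \<eta>\<^sub>2) (\<lambda>(x, y). indicator N1 x * indicator N2 y)"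
    unfolding restr_def
    by (rule pair_measure_density) (use \<eta> sf2 in \<open>auto simp: restr_def\<close>)
  have "?\<pi> = restr (restr \<eta>\<^sub>1 N1 \<Otimes>\<^sub>M restr \<eta>\<^sub>2 N2) F_set"
    unfolding pr1 unfolding restr_def
    using FP AEN by (subst density_density_eq) (auto intro!: density_cong elim!: eventually_mono simp: indicator_def split: prod.splits)
  also have "\<dots> = restr (density (\<mu> \<Otimes>\<^sub>M \<nu>) (\<lambda>(x, y). ennreal (G x) * ennreal (H y))) F_set"
  proof -
    have "density \<mu> (\<lambda>x. ennreal (G x)) \<Otimes>\<^sub>M density \<nu> (\<lambda>x. ennreal (H x))
        = density (\<mu> \<Otimes>\<^sub>M \<nu>) (\<lambda>(x, y). ennreal (G x) * ennreal (H y))"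
      by (rule pair_measure_density)
         (use G H sf2 \<nu>.sigma_finite_measure_axioms in \<open>auto simp: measurable_cong_sets[OF \<mu>.M_is_borel refl] measurable_cong_sets[OF \<nu>.M_is_borel refl]\<close>)
    then show ?thesis unfolding G(3) H(3) by simp
  qed
  also have "\<dots> = density (\<mu> \<Otimes>\<^sub>M \<nu>) (\<lambda>z. ennreal (indicator F_set z * (G (fst z) * H (snd z))))"
  proof -
    have [measurable]: "G \<in> borel_measurable \<mu>" "H \<in> borel_measurable \<nu>"
      using G H by (auto simp: measurable_cong_sets[OF \<mu>.M_is_borel refl] measurable_cong_sets[OF \<nu>.M_is_borel refl])
    have [measurable]: "F_set \<in> sets (\<mu> \<Otimes>\<^sub>M \<nu>)"
      unfolding sets_pair_measure_cong[OF \<mu>.M_is_borel \<nu>.M_is_borel] by simp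
    show ?thesis
      unfolding restr_def using G(2) H(2)
      by (subst density_density_eq)
         (auto intro!: arg_cong[where f="density (\<mu> \<Otimes>\<^sub>M \<nu>)"] simp: indicator_def ennreal_mult')
  qed
  finally have eq: "?\<pi> = density (\<mu> \<Otimes>\<^sub>M \<nu>) (\<lambda>z. ennreal (indicator F_set z * (G (fst z) * H (snd z))))" .
  show ?thesis by (rule that[OF G(1) H(1) G(2) H(2) eq])
qed

text \<open>The marginals see where \<open>G\<close> and \<open>H\<close> vanish, so every competitor is concentrated on the set
  where the density is positive.\<close>

lemma Marg_product_pos:
  assumes \<pi>: "\<pi> \<in> Marg \<gamma>\<^sub>1 \<gamma>\<^sub>2" and \<pi>': "\<pi>' \<in> Marg \<gamma>\<^sub>1 \<gamma>\<^sub>2"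
    and eq: "\<pi> = density \<rho> (\<lambda>z. ennreal (indicator S z * (G (fst z) * H (snd z))))"
    and sets: "sets \<rho> = sets borel" and S: "S \<in> sets borel"
    and GH: "G \<in> borel_measurable borel" "H \<in> borel_measurable borel" "\<And>x. 0 \<le> G x" "\<And>y. 0 \<le> H y"
  shows "AE z in \<pi>'. 0 < G (fst z) \<and> 0 < H (snd z)"
proof -
  have cs: "X \<times> (UNIV :: real set) \<in> sets borel" "(UNIV :: real set) \<times> X \<in> sets borel" if "X \<in> sets borel" for X :: "real set"
    unfolding borel_prod[symmetric] using that by auto
  have [measurable]: "fst \<in> measurable \<rho> borel" "snd \<in> measurable \<rho> borel" "S \<in> sets \<rho>"
    using S sets unfolding measurable_cong_sets[OF sets refl] borel_prod[symmetric] by auto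
  have m: "(\<lambda>z. ennreal (indicator S z * (G (fst z) * H (snd z)))) \<in> borel_measurable \<rho>"
    using GH by measurable
  define M where "M = {x. G x = 0}"
  define N where "N = {x. H x = 0}"
  have MN: "M \<in> sets borel" "N \<in> sets borel" unfolding M_def N_def using GH by measurable
  have "emeasure \<pi> (M \<times> UNIV) = 0" "emeasure \<pi> (UNIV \<times> N) = 0"
    unfolding eq using m cs MN sets
    by (auto simp: emeasure_density M_def N_def indicator_def intro!: nn_integral_zero' AE_I2)
  then have "emeasure \<pi>' (M \<times> UNIV) = 0" "emeasure \<pi>' (UNIV \<times> N) = 0"
    using MargD(5,6)[OF \<pi>] MargD(5,6)[OF \<pi>'] MN by auto
  then have "AE z in \<pi>'. z \<notin> M \<times> UNIV" "AE z in \<pi>'. z \<notin> UNIV \<times> N"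
    using cs MN MargD(2)[OF \<pi>'] by (auto intro!: AE_not_in simp: null_sets_def)
  then show ?thesis
    by eventually_elim (use GH(3,4) in \<open>auto simp: M_def N_def mem_Times_iff less_le\<close>)
qed

lemma Marg_integral:
  fixes f g :: "real \<Rightarrow> real"
  assumes \<pi>: "\<pi> \<in> Marg \<gamma>\<^sub>1 \<gamma>\<^sub>2" and f: "f \<in> borel_measurable borel" "g \<in> borel_measurable borel"
    and bd: "\<And>x. \<bar>f x\<bar> \<le> K" "\<And>x. \<bar>g x\<bar> \<le> K"
  shows "integrable \<pi> (\<lambda>z. f (fst z) + g (snd z))"
    and "(\<integral>z. f (fst z) + g (snd z) \<partial>\<pi>) = (\<integral>x. f x \<partial>\<gamma>\<^sub>1) + (\<integral>y. g y \<partial>\<gamma>\<^sub>2)"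
proof -
  note D = MargD[OF \<pi>]
  interpret finite_measure \<pi> by (rule D)
  have m: "fst \<in> measurable \<pi> borel" "snd \<in> measurable \<pi> borel"
    unfolding measurable_cong_sets[OF D(2) refl] borel_prod[symmetric] by auto
  have i: "integrable \<pi> (\<lambda>z. f (fst z))" "integrable \<pi> (\<lambda>z. g (snd z))"
    using bd f m by (auto intro!: integrable_const_bound[of _ K] measurable_compose[OF m(1)] measurable_compose[OF m(2)])
  then show "integrable \<pi> (\<lambda>z. f (fst z) + g (snd z))" by (rule Bochner_Integration.integrable_add)
  have "\<gamma>\<^sub>1 = distr \<pi> borel fst" "\<gamma>\<^sub>2 = distr \<pi> borel snd" using \<pi> by (auto simp: Marg_def)
  then show "(\<integral>z. f (fst z) + g (snd z) \<partial>\<pi>) = (\<integral>x. f x \<partial>\<gamma>\<^sub>1) + (\<integral>y. g y \<partial>\<gamma>\<^sub>2)"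
    using i m f by (simp add: integral_distr)
qed

text \<open>Only the sign of \<open>arctan u + arctan v\<close> matters, which is that of \<open>u + v\<close>: its integral depends
  on the marginals only, while its product with the difference of the densities is nonnegative.\<close>

lemma product_form_unique:
  fixes \<gamma>\<^sub>1 \<gamma>\<^sub>2 \<eta>\<^sub>1 \<eta>\<^sub>2 \<eta>\<^sub>1' \<eta>\<^sub>2' :: "real measure"
  assumes \<eta>: "sigma_finite_measure \<eta>\<^sub>1" "sigma_finite_measure \<eta>\<^sub>2" "sets \<eta>\<^sub>1 = sets borel" "sets \<eta>\<^sub>2 = sets borel"
    and \<eta>': "sigma_finite_measure \<eta>\<^sub>1'" "sigma_finite_measure \<eta>\<^sub>2'" "sets \<eta>\<^sub>1' = sets borel" "sets \<eta>\<^sub>2' = sets borel"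
    and Marg: "restr (\<eta>\<^sub>1 \<Otimes>\<^sub>M \<eta>\<^sub>2) F_set \<in> Marg \<gamma>\<^sub>1 \<gamma>\<^sub>2" "restr (\<eta>\<^sub>1' \<Otimes>\<^sub>M \<eta>\<^sub>2') F_set \<in> Marg \<gamma>\<^sub>1 \<gamma>\<^sub>2"
  shows "restr (\<eta>\<^sub>1 \<Otimes>\<^sub>M \<eta>\<^sub>2) F_set = restr (\<eta>\<^sub>1' \<Otimes>\<^sub>M \<eta>\<^sub>2') F_set"
proof -
  note fb = Marg_finite_borel_measure[OF Marg(1)]
  interpret g1: finite_borel_measure \<gamma>\<^sub>1 by (rule fb)
  interpret g2: finite_borel_measure \<gamma>\<^sub>2 by (rule fb)
  let ?\<pi> = "restr (\<eta>\<^sub>1 \<Otimes>\<^sub>M \<eta>\<^sub>2) F_set" and ?\<pi>' = "restr (\<eta>\<^sub>1' \<Otimes>\<^sub>M \<eta>\<^sub>2') F_set" and ?\<rho> = "\<gamma>\<^sub>1 \<Otimes>\<^sub>M \<gamma>\<^sub>2"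
  have sr: "sets ?\<rho> = sets borel" by (rule prod_sets[OF fb])
  obtain G H where GH: "G \<in> borel_measurable borel" "H \<in> borel_measurable borel" "\<And>x. 0 \<le> G x" "\<And>y. 0 \<le> H y"
    and eq: "?\<pi> = density ?\<rho> (\<lambda>z. ennreal (indicator F_set z * (G (fst z) * H (snd z))))"
    using product_form[OF \<eta> Marg(1) fb] by blast
  obtain G' H' where GH': "G' \<in> borel_measurable borel" "H' \<in> borel_measurable borel" "\<And>x. 0 \<le> G' x" "\<And>y. 0 \<le> H' y"
    and eq': "?\<pi>' = density ?\<rho> (\<lambda>z. ennreal (indicator F_set z * (G' (fst z) * H' (snd z))))"
    using product_form[OF \<eta>' Marg(2) fb] by blast
  define k where "k z = (indicator F_set z * (G (fst z) * H (snd z)) :: real)" for z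
  define k' where "k' z = (indicator F_set z * (G' (fst z) * H' (snd z)) :: real)" for z
  have F: "F_set \<in> sets borel" unfolding borel_prod[symmetric] by simp
  have [measurable]: "fst \<in> measurable ?\<rho> borel" "snd \<in> measurable ?\<rho> borel" "F_set \<in> sets ?\<rho>"
    using F sr unfolding measurable_cong_sets[OF sr refl] borel_prod[symmetric] by auto
  have km: "k \<in> borel_measurable ?\<rho>" "k' \<in> borel_measurable ?\<rho>"
    unfolding k_def[abs_def] k'_def[abs_def] using GH GH' by measurable
  have k0: "0 \<le> k z" "0 \<le> k' z" for z using GH GH' by (auto simp: k_def k'_def)
  define u where "u x = ln (G' x) - ln (G x)" for x
  define v where "v y = ln (H' y) - ln (H y)" for y
  have uv: "(\<lambda>x. arctan (u x)) \<in> borel_measurable borel" "(\<lambda>x. arctan (v x)) \<in> borel_measurable borel"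
    unfolding u_def v_def using GH GH' by measurable
  \<comment> \<open>Boundedness of arctan makes the test function integrable, which the logarithms
    may fail to be.\<close>
  have bd: "\<bar>arctan t\<bar> \<le> pi / 2" for t using arctan_bounded[of t] by (auto simp: abs_le_iff)
  define w where "w z = arctan (u (fst z)) + arctan (v (snd z))" for z
  have wm: "w \<in> borel_measurable ?\<rho>" unfolding w_def[abs_def] using uv by measurable
  note I = Marg_integral[OF Marg(1) uv bd bd, folded w_def]
  note I' = Marg_integral[OF Marg(2) uv bd bd, folded w_def]
  have i: "integrable ?\<rho> (\<lambda>z. k z * w z)" "(\<integral>z. k z * w z \<partial>?\<rho>) = (\<integral>z. w z \<partial>?\<pi>)"
    using I(1) unfolding eq k_def[symmetric]
    by (auto simp: integrable_density[OF wm km(1)] integral_density[OF wm km(1)] k0)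
  have i': "integrable ?\<rho> (\<lambda>z. k' z * w z)" "(\<integral>z. k' z * w z \<partial>?\<rho>) = (\<integral>z. w z \<partial>?\<pi>')"
    using I'(1) unfolding eq' k'_def[symmetric]
    by (auto simp: integrable_density[OF wm km(2)] integral_density[OF wm km(2)] k0)
  have int0: "(\<integral>z. k' z * w z - k z * w z \<partial>?\<rho>) = 0"
    using i i' I(2) I'(2) by simp
  have null: "AE z in ?\<rho>. P (fst z)" if "AE x in \<gamma>\<^sub>1. P x" "{x. \<not> P x} \<in> sets borel" for P
  proof -
    have "emeasure \<gamma>\<^sub>1 {x. \<not> P x} = 0"
      using that(1) emeasure_eq_0_AE[of "\<lambda>x. \<not> P x" \<gamma>\<^sub>1] sets_eq_imp_space_eq[OF g1.M_is_borel] by simp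
    then have "emeasure ?\<rho> ({x. \<not> P x} \<times> UNIV) = 0"
      using that(2) by (subst g2.emeasure_pair_measure_Times) (auto simp: g1.M_is_borel g2.M_is_borel)
    moreover have "{x. \<not> P x} \<times> UNIV \<in> sets ?\<rho>"
      using that(2) by (auto simp: g1.M_is_borel g2.M_is_borel intro!: pair_measureI)
    ultimately have "AE z in ?\<rho>. z \<notin> {x. \<not> P x} \<times> UNIV" by (auto intro!: AE_not_in simp: null_sets_def)
    then show ?thesis by eventually_elim (auto simp: mem_Times_iff)
  qed
  have null2: "AE z in ?\<rho>. P (snd z)" if "AE x in \<gamma>\<^sub>2. P x" "{x. \<not> P x} \<in> sets borel" for P
  proof -
    have "emeasure \<gamma>\<^sub>2 {x. \<not> P x} = 0"
      using that(1) emeasure_eq_0_AE[of "\<lambda>x. \<not> P x" \<gamma>\<^sub>2] sets_eq_imp_space_eq[OF g2.M_is_borel] by simp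
    then have "emeasure ?\<rho> (UNIV \<times> {x. \<not> P x}) = 0"
      using that(2) by (subst g2.emeasure_pair_measure_Times) (auto simp: g1.M_is_borel g2.M_is_borel)
    moreover have "UNIV \<times> {x. \<not> P x} \<in> sets ?\<rho>"
      using that(2) by (auto simp: g1.M_is_borel g2.M_is_borel intro!: pair_measureI)
    ultimately have "AE z in ?\<rho>. z \<notin> UNIV \<times> {x. \<not> P x}" by (auto intro!: AE_not_in simp: null_sets_def)
    then show ?thesis by eventually_elim (auto simp: mem_Times_iff)
  qed
  have m\<pi>: "fst \<in> measurable \<sigma> borel" "snd \<in> measurable \<sigma> borel" if "\<sigma> \<in> Marg \<gamma>\<^sub>1 \<gamma>\<^sub>2" for \<sigma>
    unfolding measurable_cong_sets[OF MargD(2)[OF that] refl] borel_prod[symmetric] by auto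
  \<comment> \<open>Positivity passes from the plan to its marginals and from there to their
    product, where the two densities are compared.\<close>
  have AE\<rho>: "AE z in ?\<rho>. 0 < G0 (fst z) \<and> 0 < H0 (snd z)"
    if M: "\<sigma> \<in> Marg \<gamma>\<^sub>1 \<gamma>\<^sub>2" and g: "G0 \<in> borel_measurable borel" "H0 \<in> borel_measurable borel"
      and ae: "AE z in \<sigma>. 0 < G0 (fst z) \<and> 0 < H0 (snd z)" for \<sigma> and G0 H0 :: "real \<Rightarrow> real"
  proof -
    have d: "\<gamma>\<^sub>1 = distr \<sigma> borel fst" "\<gamma>\<^sub>2 = distr \<sigma> borel snd" using M by (auto simp: Marg_def)
    have "AE x in \<gamma>\<^sub>1. 0 < G0 x" "AE x in \<gamma>\<^sub>2. 0 < H0 x"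
      unfolding d using g ae m\<pi>[OF M] by (subst AE_distr_iff; auto)+
    then have "AE z in ?\<rho>. 0 < G0 (fst z)" "AE z in ?\<rho>. 0 < H0 (snd z)"
      using g by (auto intro!: null null2)
    then show ?thesis by eventually_elim simp
  qed
  have pos: "AE z in ?\<rho>. 0 < G (fst z) \<and> 0 < H (snd z)" "AE z in ?\<rho>. 0 < G' (fst z) \<and> 0 < H' (snd z)"
    using AE\<rho>[OF Marg(1) GH(1,2) Marg_product_pos[OF Marg(1,1) eq sr F GH]]
      AE\<rho>[OF Marg(2) GH'(1,2) Marg_product_pos[OF Marg(2,2) eq' sr F GH']] by auto
  have sign: "0 \<le> k' z * w z - k z * w z \<and> (k' z * w z - k z * w z = 0 \<longrightarrow> k' z = k z)"
    if "0 < G (fst z) \<and> 0 < H (snd z)" "0 < G' (fst z) \<and> 0 < H' (snd z)" for z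
  proof (cases "z \<in> F_set")
    case True
    define s where "s = u (fst z) + v (snd z)"
    have k: "k z = exp (ln (G (fst z)) + ln (H (snd z)))" "k' z = exp (ln (G' (fst z)) + ln (H' (snd z)))"
      using True that by (auto simp: k_def k'_def exp_add)
    have le: "k z \<le> k' z \<longleftrightarrow> 0 \<le> s" "k' z = k z \<longleftrightarrow> s = 0"
      unfolding k by (auto simp: s_def u_def v_def)
    have w: "w z = arctan (u (fst z)) - arctan (- v (snd z))" by (simp add: w_def arctan_minus)
    have w0: "0 \<le> w z \<longleftrightarrow> 0 \<le> s" "w z = 0 \<longleftrightarrow> s = 0"
      unfolding w by (auto simp: arctan_le_iff arctan_eq_iff s_def)
    have "0 \<le> (k' z - k z) * w z" using le w0 by (auto simp: zero_le_mult_iff)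
    moreover have "(k' z - k z) * w z = 0 \<longrightarrow> k' z = k z" using le w0 by auto
    ultimately show ?thesis by (simp add: left_diff_distrib)
  qed (auto simp: k_def k'_def)
  have nn: "AE z in ?\<rho>. 0 \<le> k' z * w z - k z * w z"
    using pos by eventually_elim (use sign in blast)
  have "AE z in ?\<rho>. k' z * w z - k z * w z = 0"
    using integral_nonneg_eq_0_iff_AE[OF _ nn] int0 i(1) i'(1) by auto
  with pos have "AE z in ?\<rho>. k' z = k z"
    by eventually_elim (use sign in blast)
  then have "density ?\<rho> (\<lambda>z. ennreal (k z)) = density ?\<rho> (\<lambda>z. ennreal (k' z))"
    using km by (intro density_cong) (auto elim!: eventually_mono)
  then show ?thesis unfolding eq eq' k_def k'_def .
qed

lemma kellerer_F_eq:
  fixes \<eta>\<^sub>1 \<eta>\<^sub>2 :: "real measure"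
  assumes "sigma_finite_measure \<eta>\<^sub>1" "sets \<eta>\<^sub>1 = sets borel" "sigma_finite_measure \<eta>\<^sub>2" "sets \<eta>\<^sub>2 = sets borel"
    and "restr (\<eta>\<^sub>1 \<Otimes>\<^sub>M \<eta>\<^sub>2) F_set \<in> Marg \<gamma>\<^sub>1 \<gamma>\<^sub>2"
  shows "kellerer_F \<gamma>\<^sub>1 \<gamma>\<^sub>2 = restr (\<eta>\<^sub>1 \<Otimes>\<^sub>M \<eta>\<^sub>2) F_set"
  unfolding kellerer_F_def
proof (rule the_equality)
  fix \<pi>
  assume "\<pi> \<in> Marg \<gamma>\<^sub>1 \<gamma>\<^sub>2 \<and> (\<exists>\<eta>\<^sub>1 \<eta>\<^sub>2 :: real measure.
        sigma_finite_measure \<eta>\<^sub>1 \<and> sets \<eta>\<^sub>1 = sets borel \<and>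
        sigma_finite_measure \<eta>\<^sub>2 \<and> sets \<eta>\<^sub>2 = sets borel \<and>
        \<pi> = restr (\<eta>\<^sub>1 \<Otimes>\<^sub>M \<eta>\<^sub>2) F_set)"
  then obtain \<eta>\<^sub>1' \<eta>\<^sub>2' :: "real measure" where \<pi>: "\<pi> \<in> Marg \<gamma>\<^sub>1 \<gamma>\<^sub>2" "sigma_finite_measure \<eta>\<^sub>1'" "sets \<eta>\<^sub>1' = sets borel"
    "sigma_finite_measure \<eta>\<^sub>2'" "sets \<eta>\<^sub>2' = sets borel" "\<pi> = restr (\<eta>\<^sub>1' \<Otimes>\<^sub>M \<eta>\<^sub>2') F_set" by blast
  show "\<pi> = restr (\<eta>\<^sub>1 \<Otimes>\<^sub>M \<eta>\<^sub>2) F_set"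
    unfolding \<pi>(6)
    by (rule product_form_unique[OF \<pi>(2,4,3,5) assms(1,3,2,4) \<pi>(1)[unfolded \<pi>(6)] assms(5)])
qed (use assms in blast)

section \<open>The generalized Kellerer plan\<close>

text \<open>The condition is a weak inequality between continuous functions of two pairs, so it
  survives limits.\<close>

lemma noncrossing_closure:
  assumes "noncrossing \<Gamma>"
  shows "noncrossing (closure \<Gamma>)"
proof (rule noncrossingI)
  fix x y x' y' assume z: "(x, y) \<in> closure \<Gamma>" "(x', y') \<in> closure \<Gamma>"
  define S where "S = {p :: (real \<times> real) \<times> (real \<times> real).
    min (snd (fst p)) (fst (snd p)) \<le> max (fst (fst p)) (snd (snd p))}"
  have "closed S" unfolding S_def by (intro closed_Collect_le continuous_intros)
  moreover have "\<Gamma> \<times> \<Gamma> \<subseteq> S"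
    using noncrossingD[OF assms] by (auto simp: S_def simp del: min_le_iff_disj le_max_iff_disj)
  ultimately have "closure (\<Gamma> \<times> \<Gamma>) \<subseteq> S" by (rule closure_minimal[rotated])
  then have "((x, y), (x', y')) \<in> S" using z by (auto simp: closure_Times)
  then show "min y x' \<le> max x y'" by (simp add: S_def)
qed

text \<open>Both quantile functions are monotone in the same parameter, so two pairs are always
  ordered in the same direction and cannot cross. Masses are normalised to 1 to have quantile
  functions and rescaled by \<open>m\<close> afterwards.\<close>

lemma quantile_plan_exists:
  assumes M: "finite_borel_measure \<mu>" and N: "finite_borel_measure \<nu>"
    and eq: "measure \<mu> UNIV = measure \<nu> UNIV" and pos: "0 < measure \<mu> UNIV"
  obtains \<pi> \<Gamma> where "noncrossing_plan \<mu> \<nu> \<pi> \<Gamma>"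
proof -
  define m where "m = measure \<mu> UNIV"
  have m: "0 < m" using pos by (simp add: m_def)
  have rd: "real_distribution (scale_measure (ennreal (1 / m)) \<gamma>)"
    if "finite_borel_measure \<gamma>" "measure \<gamma> UNIV = m" for \<gamma>
  proof -
    interpret finite_borel_measure \<gamma> by fact
    show ?thesis
    proof (intro real_distribution.intro real_distribution_axioms.intro prob_spaceI)
      have "space \<gamma> = UNIV" using sets_eq_imp_space_eq[OF M_is_borel] by simp
      then show "emeasure (scale_measure (ennreal (1 / m)) \<gamma>) (space (scale_measure (ennreal (1 / m)) \<gamma>)) = 1"
        using that(2) m by (simp add: space_scale_measure emeasure_eq_measure ennreal_mult'[symmetric])
    qed (simp add: M_is_borel)
  qed
  interpret P: cdf_distribution "scale_measure (ennreal (1 / m)) \<mu>"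
    unfolding cdf_distribution_def by (rule rd[OF M]) (simp add: m_def)
  interpret Q: cdf_distribution "scale_measure (ennreal (1 / m)) \<nu>"
    unfolding cdf_distribution_def by (rule rd[OF N]) (simp add: m_def eq)
  let ?\<Omega> = "restrict_space lborel {0<..<1::real}"
  define \<phi> where "\<phi> \<omega> = (P.I \<omega>, Q.I \<omega>)" for \<omega>
  have IP: "P.I \<in> measurable ?\<Omega> borel" and IQ: "Q.I \<in> measurable ?\<Omega> borel"
    using P.measurable_CI Q.measurable_CI
    by (auto simp: measurable_cong_sets[OF sets_restrict_space_cong[OF sets_lborel] refl])
  have \<phi>: "\<phi> \<in> measurable ?\<Omega> borel"
    unfolding \<phi>_def[abs_def] borel_prod[symmetric] using IP IQ by measurable
  \<comment> \<open>The closure is Borel, so its complement can serve as a measurable null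
    set.\<close>
  define \<Gamma> where "\<Gamma> = closure (\<phi> ` {0<..<1})"
  define \<pi> where "\<pi> = scale_measure (ennreal m) (distr ?\<Omega> borel \<phi>)"
  have scale: "ennreal m * (ennreal (1 / m) * e) = e" for e
    using m by (simp add: mult.assoc[symmetric] ennreal_mult'[symmetric])
  have sp\<Omega>: "space ?\<Omega> = {0<..<1}" by (simp add: space_restrict_space)
  have cs: "X \<times> (UNIV :: real set) \<in> sets borel" "(UNIV :: real set) \<times> X \<in> sets borel"
    if "X \<in> sets borel" for X :: "real set"
    unfolding borel_prod[symmetric] using that by auto
  have e1: "emeasure \<pi> (X \<times> UNIV) = emeasure \<mu> X" if X: "X \<in> sets borel" for X
  proof -
    have "emeasure \<pi> (X \<times> UNIV) = ennreal m * emeasure (distr ?\<Omega> borel P.I) X"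
      using \<phi> IP X cs[OF X]
      by (simp add: \<pi>_def emeasure_distr) (auto simp: \<phi>_def intro!: arg_cong[where f="\<lambda>A. ennreal m * emeasure ?\<Omega> A"])
    then show ?thesis unfolding P.distr_I_eq_M by (simp add: scale)
  qed
  have e2: "emeasure \<pi> (UNIV \<times> X) = emeasure \<nu> X" if X: "X \<in> sets borel" for X
  proof -
    have "emeasure \<pi> (UNIV \<times> X) = ennreal m * emeasure (distr ?\<Omega> borel Q.I) X"
      using \<phi> IQ X cs[OF X]
      by (simp add: \<pi>_def emeasure_distr) (auto simp: \<phi>_def intro!: arg_cong[where f="\<lambda>A. ennreal m * emeasure ?\<Omega> A"])
    then show ?thesis unfolding Q.distr_I_eq_M by (simp add: scale)
  qed
  have "noncrossing_plan \<mu> \<nu> \<pi> \<Gamma>"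
  proof
    show "\<pi> \<in> Marg \<mu> \<nu>"
    proof (rule MargI)
      have "space \<pi> = UNIV" by (simp add: \<pi>_def space_scale_measure)
      then show "finite_measure \<pi>"
        using e1[of UNIV] finite_measure.emeasure_finite[OF finite_borel_measure.axioms(1)[OF M]]
        by (intro finite_measureI) simp
    qed (use e1 e2 finite_borel_measure.M_is_borel[OF M] finite_borel_measure.M_is_borel[OF N] in \<open>auto simp: \<pi>_def\<close>)
    show "noncrossing \<Gamma>"
      unfolding \<Gamma>_def
    proof (intro noncrossing_closure noncrossingI)
      fix x y x' y' assume "(x, y) \<in> \<phi> ` {0<..<1}" "(x', y') \<in> \<phi> ` {0<..<1}"
      then obtain s t where st: "s \<in> {0<..<1}" "t \<in> {0<..<1}" "x = P.I s" "y = Q.I s" "x' = P.I t" "y' = Q.I t"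
        by (auto simp: \<phi>_def)
      show "min y x' \<le> max x y'"
      proof (cases "s \<le> t")
        case True
        then have "y \<le> y'" using st Q.mono_I by (auto simp: mono_on_def)
        then show ?thesis by simp
      next
        case False
        then have "x' \<le> x" using st P.mono_I by (auto simp: mono_on_def)
        then show ?thesis by simp
      qed
    qed
    have G: "- \<Gamma> \<in> sets borel" by (simp add: \<Gamma>_def)
    have "\<phi> -` (- \<Gamma>) \<inter> space ?\<Omega> = {}"
      using closure_subset[of "\<phi> ` {0<..<1}"] by (auto simp: \<Gamma>_def sp\<Omega>)
    then have "emeasure \<pi> (- \<Gamma>) = 0" using \<phi> G by (simp add: \<pi>_def emeasure_distr)
    then show "AE z in \<pi>. z \<in> \<Gamma>"
      using G by (intro AE_I[of _ _ "- \<Gamma>"]) (auto simp: \<pi>_def space_scale_measure)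
  qed
  then show ?thesis using that by blast
qed

lemma E_eq_measurable [measurable]:
  assumes "finite_borel_measure \<mu>" "finite_borel_measure \<nu>"
  shows "E_eq \<mu> \<nu> \<in> sets borel"
  using open_E_plus[OF assms] open_E_plus[OF assms(2,1)] by (auto simp: E_eq_def E_minus_eq)

lemma diag_region_measurable:
  assumes "finite_borel_measure \<mu>" "finite_borel_measure \<nu>"
  shows "diag_region \<mu> \<nu> \<in> sets borel"
proof -
  note [measurable] = E_eq_measurable[OF assms]
  have "{z \<in> space (borel \<Otimes>\<^sub>M borel). fst z = (snd z :: real) \<and> fst z \<in> E_eq \<mu> \<nu>} \<in> sets (borel \<Otimes>\<^sub>M borel)"
    by measurable
  then show ?thesis
    unfolding diag_region_def case_prod_unfold borel_prod[symmetric] by (simp add: space_pair_measure)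
qed

lemma countable_components_E:
  assumes "finite_borel_measure \<mu>" "finite_borel_measure \<nu>"
  shows "countable (components (E_plus \<mu> \<nu>))" "countable (components (E_minus \<mu> \<nu>))"
  unfolding E_minus_eq using countable_components open_E_plus assms by auto

lemma plan_support_measurable:
  assumes "finite_borel_measure \<mu>" "finite_borel_measure \<nu>"
  shows "plan_support \<mu> \<nu> \<in> sets borel"
  unfolding plan_support_def using countable_components_E[OF assms] diag_region_measurable[OF assms]
  by (intro sets.Un sets.countable_UN') auto

lemma minus_region_disjoint:
  assumes "finite_borel_measure \<mu>" "finite_borel_measure \<nu>"
    and "C \<in> components (E_minus \<mu> \<nu>)" "C' \<in> components (E_minus \<mu> \<nu>)"
    "z \<in> minus_region C" "z \<in> minus_region C'"
  shows "C = C'"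
  using plus_region_disjoint[OF assms(2,1), of C C' "prod.swap z"] assms
  by (simp add: minus_region_def E_minus_eq)

lemma minus_diag_region_disjoint:
  assumes "finite_borel_measure \<mu>" "finite_borel_measure \<nu>"
    and "C \<in> components (E_minus \<mu> \<nu>)" "z \<in> minus_region C" "z \<in> diag_region \<mu> \<nu>"
  shows False
  using plus_diag_region_disjoint[OF assms(2,1), of C "prod.swap z"] assms
  by (auto simp: minus_region_def E_minus_eq diag_region_def E_eq_commute[of \<mu>])

text \<open>Stated for an arbitrary Borel measure because it is applied to plans and, for the
  entropy, to measures with the shifted integrand as density.\<close>

lemma emeasure_plan_support:
  assumes fb: "finite_borel_measure \<mu>" "finite_borel_measure \<nu>" and \<tau>: "sets \<tau> = sets borel" and A: "A \<in> sets borel"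
  shows "emeasure \<tau> (plan_support \<mu> \<nu> \<inter> A) =
    (\<integral>\<^sup>+C. emeasure \<tau> (plus_region C \<inter> A) \<partial>count_space (components (E_plus \<mu> \<nu>))) +
    (\<integral>\<^sup>+C. emeasure \<tau> (minus_region C \<inter> A) \<partial>count_space (components (E_minus \<mu> \<nu>))) +
    emeasure \<tau> (diag_region \<mu> \<nu> \<inter> A)"
proof -
  let ?P = "\<Union>C\<in>components (E_plus \<mu> \<nu>). plus_region C \<inter> A"
  let ?M = "\<Union>C\<in>components (E_minus \<mu> \<nu>). minus_region C \<inter> A"
  note cc = countable_components_E[OF fb]
  have [simp]: "plus_region C \<inter> A \<in> sets \<tau>" "minus_region C \<inter> A \<in> sets \<tau>" for C
    using A \<tau> by auto
  have P: "?P \<in> sets \<tau>" by (rule sets.countable_UN'[OF cc(1)]) auto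
  have M: "?M \<in> sets \<tau>" by (rule sets.countable_UN'[OF cc(2)]) auto
  have D: "diag_region \<mu> \<nu> \<inter> A \<in> sets \<tau>" using diag_region_measurable[OF fb] A \<tau> by auto
  note PM = P M D
  have "plan_support \<mu> \<nu> \<inter> A = (?P \<union> ?M) \<union> (diag_region \<mu> \<nu> \<inter> A)"
    by (auto simp: plan_support_def)
  also have "emeasure \<tau> \<dots> = emeasure \<tau> ?P + emeasure \<tau> ?M + emeasure \<tau> (diag_region \<mu> \<nu> \<inter> A)"
  proof -
    have "emeasure \<tau> (?P \<union> ?M \<union> (diag_region \<mu> \<nu> \<inter> A)) =
        emeasure \<tau> (?P \<union> ?M) + emeasure \<tau> (diag_region \<mu> \<nu> \<inter> A)"
    proof (rule plus_emeasure[symmetric])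
      show "(?P \<union> ?M) \<inter> (diag_region \<mu> \<nu> \<inter> A) = {}"
        by (auto dest: plus_diag_region_disjoint[OF fb] minus_diag_region_disjoint[OF fb])
    qed (use PM in auto)
    moreover have "emeasure \<tau> (?P \<union> ?M) = emeasure \<tau> ?P + emeasure \<tau> ?M"
    proof (rule plus_emeasure[symmetric])
      show "?P \<inter> ?M = {}" by (auto dest: plus_minus_region_disjoint[OF fb])
    qed (fact P M)+
    ultimately show ?thesis by simp
  qed
  also have "emeasure \<tau> ?P = (\<integral>\<^sup>+C. emeasure \<tau> (plus_region C \<inter> A) \<partial>count_space (components (E_plus \<mu> \<nu>)))"
  proof (rule emeasure_UN_countable[OF _ cc(1)])
    show "disjoint_family_on (\<lambda>C. plus_region C \<inter> A) (components (E_plus \<mu> \<nu>))"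
      unfolding disjoint_family_on_def by (blast dest: plus_region_disjoint[OF fb])
  qed simp
  also have "emeasure \<tau> ?M = (\<integral>\<^sup>+C. emeasure \<tau> (minus_region C \<inter> A) \<partial>count_space (components (E_minus \<mu> \<nu>)))"
  proof (rule emeasure_UN_countable[OF _ cc(2)])
    show "disjoint_family_on (\<lambda>C. minus_region C \<inter> A) (components (E_minus \<mu> \<nu>))"
      unfolding disjoint_family_on_def by (blast dest: minus_region_disjoint[OF fb])
  qed simp
  finally show ?thesis .
qed

lemma countable_endpts:
  assumes "finite_borel_measure \<mu>" "finite_borel_measure \<nu>"
  shows "countable (endpts \<mu> \<nu>)"
proof -
  let ?K = "components (E_plus \<mu> \<nu>) \<union> components (E_minus \<mu> \<nu>)"
  have "endpts \<mu> \<nu> \<subseteq> real_of_ereal ` (lep ` ?K \<union> rep ` ?K)"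
  proof
    fix x assume "x \<in> endpts \<mu> \<nu>"
    then obtain C where C: "C \<in> ?K" "ereal x = lep C \<or> ereal x = rep C" by (auto simp: endpts_def)
    then have "x = real_of_ereal (lep C) \<or> x = real_of_ereal (rep C)" by (metis real_of_ereal.simps(1))
    then show "x \<in> real_of_ereal ` (lep ` ?K \<union> rep ` ?K)" using C(1) by blast
  qed
  then show ?thesis using countable_components_E[OF assms] by (meson countable_Un countable_image countable_subset)
qed

lemma E_minus_parts:
  "mu_minus \<mu> \<nu> = nu_plus \<nu> \<mu>" "nu_minus \<mu> \<nu> = mu_plus \<nu> \<mu>"
  by (auto simp: fun_eq_iff mu_minus_def nu_plus_def nu_minus_def mu_plus_def)

section \<open>The minus and diagonal parts read off from a plan\<close>

context noncrossing_plan begin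

lemma emeasure_minus_region:
  assumes C: "C \<in> components (E_minus \<mu> \<nu>)" and X: "X \<in> sets borel"
  shows "emeasure \<pi> (minus_region C \<inter> X \<times> UNIV) = emeasure (mu_minus \<mu> \<nu> C) X"
    and "emeasure \<pi> (minus_region C \<inter> UNIV \<times> X) = emeasure (nu_minus \<mu> \<nu> C) X"
proof -
  interpret S: noncrossing_plan \<nu> \<mu> "distr \<pi> borel prod.swap" "prod.swap ` \<Gamma>" by (rule swap)
  have C': "C \<in> components (E_plus \<nu> \<mu>)" using C by (simp add: E_minus_eq)
  have sw: "emeasure (distr \<pi> borel prod.swap) Y = emeasure \<pi> (prod.swap -` Y)" if "Y \<in> sets borel" for Y
    using that by (subst emeasure_distr) (auto simp: measurable_cong_sets[OF sets_\<pi> refl])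
  have "prod.swap -` (plus_region C \<inter> UNIV \<times> X) = minus_region C \<inter> X \<times> UNIV"
    "prod.swap -` (plus_region C \<inter> X \<times> UNIV) = minus_region C \<inter> UNIV \<times> X"
    by (auto simp: minus_region_def)
  then show "emeasure \<pi> (minus_region C \<inter> X \<times> UNIV) = emeasure (mu_minus \<mu> \<nu> C) X"
    "emeasure \<pi> (minus_region C \<inter> UNIV \<times> X) = emeasure (nu_minus \<mu> \<nu> C) X"
    using S.emeasure_fst_plus_region[OF C' X] S.emeasure_snd_plus_region[OF C' X]
      sw[of "plus_region C \<inter> UNIV \<times> X"] sw[of "plus_region C \<inter> X \<times> UNIV"] cylinder_sets[OF X]
    by (auto simp: E_minus_parts)
qed

lemma emeasure_\<pi>_eq: "A \<in> sets borel \<Longrightarrow> emeasure \<pi> A = emeasure \<pi> (plan_support \<mu> \<nu> \<inter> A)"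
  using AE_plan_support plan_support_measurable[OF fb]
  by (intro emeasure_eq_AE) (auto elim!: eventually_mono)

lemma emeasure_decompose:
  assumes "A \<in> sets borel"
  shows "emeasure \<pi> A =
    (\<integral>\<^sup>+C. emeasure \<pi> (plus_region C \<inter> A) \<partial>count_space (components (E_plus \<mu> \<nu>))) +
    (\<integral>\<^sup>+C. emeasure \<pi> (minus_region C \<inter> A) \<partial>count_space (components (E_minus \<mu> \<nu>))) +
    emeasure \<pi> (diag_region \<mu> \<nu> \<inter> A)"
  unfolding emeasure_\<pi>_eq[OF assms] by (rule emeasure_plan_support[OF fb sets_\<pi> assms])

text \<open>The mass of \<mu> at x splits into what the plan moves within plus regions, within minus
  regions and leaves on the diagonal. The subtraction recovers the last part, so it is nonnegative
  and not truncated.\<close>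

lemma emeasure_atom_diag:
  "ennreal (measure \<mu> {x} - measure (mu_plus_total \<mu> \<nu>) {x} - measure (mu_minus_total \<mu> \<nu>) {x})
    = emeasure \<pi> (diag_region \<mu> \<nu> \<inter> {x} \<times> UNIV)"
proof -
  have X: "{x} \<in> sets borel" by simp
  have p: "emeasure (mu_plus_total \<mu> \<nu>) {x} =
      (\<integral>\<^sup>+C. emeasure \<pi> (plus_region C \<inter> {x} \<times> UNIV) \<partial>count_space (components (E_plus \<mu> \<nu>)))"
    unfolding mu_plus_total_def
    by (subst emeasure_sum_measure)
       (auto simp: mu_plus_def emeasure_fst_plus_region[OF _ X] intro!: nn_integral_cong)
  have m: "emeasure (mu_minus_total \<mu> \<nu>) {x} =
      (\<integral>\<^sup>+C. emeasure \<pi> (minus_region C \<inter> {x} \<times> UNIV) \<partial>count_space (components (E_minus \<mu> \<nu>)))"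
    unfolding mu_minus_total_def
    by (subst emeasure_sum_measure)
       (auto simp: mu_minus_def emeasure_minus_region[OF _ X] intro!: nn_integral_cong)
  have e: "emeasure \<mu> {x} = emeasure (mu_plus_total \<mu> \<nu>) {x} + emeasure (mu_minus_total \<mu> \<nu>) {x}
      + emeasure \<pi> (diag_region \<mu> \<nu> \<inter> {x} \<times> UNIV)"
    unfolding p m MargD(5)[OF Marg X] by (rule emeasure_decompose[OF cylinder_sets(1)[OF X]])
  have add: "enn2real (p + m + d) = enn2real p + enn2real m + enn2real d" if "p + m + d < \<top>" for p m d :: ennreal
    using that by (simp add: enn2real_plus)
  have "emeasure \<mu> {x} < \<top>" by (simp add: top.not_eq_extremum[symmetric])
  then have "measure \<mu> {x} = measure (mu_plus_total \<mu> \<nu>) {x} + measure (mu_minus_total \<mu> \<nu>) {x}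
      + measure \<pi> (diag_region \<mu> \<nu> \<inter> {x} \<times> UNIV)"
    unfolding measure_def e by (rule add)
  then show ?thesis by (simp add: \<pi>.emeasure_eq_measure)
qed

text \<open>A point of \<open>E_eq\<close> that is no endpoint can only be sent to itself, so there
  \<mu> equals the diagonal part. The endpoints are countable and are treated atom by atom.\<close>

lemma emeasure_mu_eq:
  assumes X: "X \<in> sets borel"
  shows "emeasure (mu_eq \<mu> \<nu>) X = emeasure \<pi> (diag_region \<mu> \<nu> \<inter> X \<times> UNIV)"
proof -
  let ?B = "endpts \<mu> \<nu>"
  have cB: "countable ?B" by (rule countable_endpts[OF fb])
  have B: "?B \<in> sets borel" by (rule sets.countable[OF _ cB]) auto
  note E = E_eq_measurable[OF fb] and D = diag_region_measurable[OF fb]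
  have out: "emeasure \<pi> (((- ?B \<inter> E_eq \<mu> \<nu>) \<inter> X) \<times> UNIV) = emeasure \<pi> (diag_region \<mu> \<nu> \<inter> (X - ?B) \<times> UNIV)"
  proof (rule emeasure_eq_AE)
    show "AE z in \<pi>. z \<in> ((- ?B \<inter> E_eq \<mu> \<nu>) \<inter> X) \<times> UNIV \<longleftrightarrow> z \<in> diag_region \<mu> \<nu> \<inter> (X - ?B) \<times> UNIV"
      using AE_plan_support
    proof eventually_elim
      case (elim z)
      obtain x y where z: "z = (x, y)" by (cases z)
      have "(x, y) \<in> diag_region \<mu> \<nu>" if x: "x \<in> E_eq \<mu> \<nu>" "x \<notin> ?B"
        using elim[unfolded z]
      proof (cases rule: plan_support_cases[OF fb, consumes 1, case_names plus minus diag])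
        case (plus C)
        have "ereal x \<noteq> lep C" using x(2) plus(1) by (auto simp: endpts_def)
        then have "x \<in> C" using plus(2) unfolding component_mem_iff[OF open_E_plus[OF fb] plus(1)]
          by (auto simp: plus_region_def)
        then show ?thesis using x(1) in_components_subset[OF plus(1)] by (auto simp: E_eq_def)
      next
        case (minus C)
        have "ereal x \<noteq> rep C" using x(2) minus(1) by (auto simp: endpts_def E_minus_eq)
        then have "x \<in> C" using minus(2) unfolding component_mem_iff[OF open_E_plus[OF fb(2,1)] minus(1)]
          by (auto simp: plus_region_def)
        then have "x \<in> E_minus \<mu> \<nu>" using in_components_subset[OF minus(1)] by (auto simp: E_minus_eq)
        then show ?thesis using x(1) by (simp add: E_eq_def)
      qed (simp add: diag_region_def)
      moreover have "x \<in> E_eq \<mu> \<nu>" if "(x, y) \<in> diag_region \<mu> \<nu>"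
        using that by (auto simp: diag_region_def)
      ultimately show ?case unfolding z by blast
    qed
  next
    show "((- ?B \<inter> E_eq \<mu> \<nu>) \<inter> X) \<times> UNIV \<in> sets \<pi>"
      using cylinder_sets(1)[of "(- ?B \<inter> E_eq \<mu> \<nu>) \<inter> X"] B E X by simp
    show "diag_region \<mu> \<nu> \<inter> (X - ?B) \<times> UNIV \<in> sets \<pi>"
      using cylinder_sets(1)[of "X - ?B"] B D X by simp
  qed
  have "emeasure (mu_eq \<mu> \<nu>) X = emeasure \<mu> ((- ?B \<inter> E_eq \<mu> \<nu>) \<inter> X) +
      (\<integral>\<^sup>+x. emeasure \<pi> (diag_region \<mu> \<nu> \<inter> {x} \<times> UNIV) * indicator X x \<partial>count_space ?B)"
    using X B E MargD(3)[OF Marg]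
    by (simp add: mu_eq_def emeasure_add_measure emeasure_restr emeasure_sum_measure emeasure_atom_diag)
  also have "emeasure \<mu> ((- ?B \<inter> E_eq \<mu> \<nu>) \<inter> X) = emeasure \<pi> (diag_region \<mu> \<nu> \<inter> (X - ?B) \<times> UNIV)"
    unfolding out[symmetric] using B E X by (intro MargD(5)[OF Marg]) auto
  also have "(\<integral>\<^sup>+x. emeasure \<pi> (diag_region \<mu> \<nu> \<inter> {x} \<times> UNIV) * indicator X x \<partial>count_space ?B)
      = (\<integral>\<^sup>+x. emeasure \<pi> (diag_region \<mu> \<nu> \<inter> ({x} \<inter> X) \<times> UNIV) \<partial>count_space ?B)"
    by (intro nn_integral_cong) (auto simp: indicator_def)
  also have "\<dots> = emeasure \<pi> (\<Union>x\<in>?B. diag_region \<mu> \<nu> \<inter> ({x} \<inter> X) \<times> UNIV)"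
  proof (rule emeasure_UN_countable[symmetric])
    show "diag_region \<mu> \<nu> \<inter> ({x} \<inter> X) \<times> UNIV \<in> sets \<pi>" for x
      using D cylinder_sets(1)[of "{x} \<inter> X"] X by simp
  qed (auto simp: disjoint_family_on_def cB)
  also have "(\<Union>x\<in>?B. diag_region \<mu> \<nu> \<inter> ({x} \<inter> X) \<times> UNIV) = diag_region \<mu> \<nu> \<inter> (X \<inter> ?B) \<times> UNIV"
    by auto
  also have "emeasure \<pi> (diag_region \<mu> \<nu> \<inter> (X - ?B) \<times> UNIV) + emeasure \<pi> (diag_region \<mu> \<nu> \<inter> (X \<inter> ?B) \<times> UNIV)
      = emeasure \<pi> ((diag_region \<mu> \<nu> \<inter> (X - ?B) \<times> UNIV) \<union> (diag_region \<mu> \<nu> \<inter> (X \<inter> ?B) \<times> UNIV))"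
    using B D X cylinder_sets(1)[of "X - ?B"] cylinder_sets(1)[of "X \<inter> ?B"]
    by (intro plus_emeasure) auto
  also have "(diag_region \<mu> \<nu> \<inter> (X - ?B) \<times> UNIV) \<union> (diag_region \<mu> \<nu> \<inter> (X \<inter> ?B) \<times> UNIV) = diag_region \<mu> \<nu> \<inter> X \<times> UNIV"
    by auto
  finally show ?thesis .
qed

lemma emeasure_diag_plan:
  assumes A: "A \<in> sets borel"
  shows "emeasure (distr (mu_eq \<mu> \<nu>) borel (\<lambda>x. (x, x))) A = emeasure \<pi> (diag_region \<mu> \<nu> \<inter> A)"
proof -
  have m: "(\<lambda>x. (x, x)) \<in> measurable (borel :: real measure) (borel :: (real \<times> real) measure)"
    unfolding borel_prod[symmetric] by measurable
  have s: "sets (mu_eq \<mu> \<nu>) = sets borel" by (simp add: mu_eq_def)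
  have X: "{x. (x, x) \<in> A} \<in> sets borel" using measurable_sets[OF m A] by (simp add: vimage_def)
  have "emeasure (distr (mu_eq \<mu> \<nu>) borel (\<lambda>x. (x, x))) A = emeasure (mu_eq \<mu> \<nu>) {x. (x, x) \<in> A}"
    using A m by (subst emeasure_distr)
      (auto simp: measurable_cong_sets[OF s refl] sets_eq_imp_space_eq[OF s] vimage_def)
  also have "\<dots> = emeasure \<pi> (diag_region \<mu> \<nu> \<inter> {x. (x, x) \<in> A} \<times> UNIV)" by (rule emeasure_mu_eq[OF X])
  also have "diag_region \<mu> \<nu> \<inter> {x. (x, x) \<in> A} \<times> UNIV = diag_region \<mu> \<nu> \<inter> A" by (auto simp: diag_region_def)
  finally show ?thesis .
qed

end

lemma F_set_borel [measurable]: "F_set \<in> sets borel"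
  unfolding borel_prod[symmetric] by simp

lemma measure_restr:
  "A \<in> sets \<gamma> \<Longrightarrow> X \<in> sets \<gamma> \<Longrightarrow> measure (restr \<gamma> A) X = measure \<gamma> (A \<inter> X)"
  by (simp add: measure_def emeasure_restr)

lemma noncrossing_plus_region: "noncrossing (plus_region C)"
proof (rule noncrossingI)
  fix x y x' y' assume "(x, y) \<in> plus_region C" "(x', y') \<in> plus_region C"
  then have "x' \<le> y'" by (simp add: plus_region_def)
  then show "min y x' \<le> max x y'" by simp
qed

text \<open>A point of C is never an end of a component of \<open>E_plus\<close>, so the component
  of an arrow to the right that passes or touches it must contain it.\<close>

lemma plan_support_through:
  assumes fb: "finite_borel_measure \<mu>" "finite_borel_measure \<nu>"
    and C: "C \<in> components (E_plus \<mu> \<nu>)" and z: "(x, y) \<in> plan_support \<mu> \<nu>"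
    and t: "t \<in> C" "x \<le> t" "t \<le> y" "x < y"
  shows "(x, y) \<in> plus_region C"
  using z
proof (cases rule: plan_support_cases[OF fb, consumes 1, case_names plus minus diag])
  case (plus C')
  have "t \<in> E_plus \<mu> \<nu>" using t(1) in_components_subset[OF C] by blast
  then have ne: "ereal t \<noteq> lep C'" "ereal t \<noteq> rep C'"
    using component_endpoint_notin[OF open_E_plus[OF fb] plus(1), of t] by blast+
  have "lep C' \<le> ereal x" "ereal y \<le> rep C'" using plus(2) by (auto simp: plus_region_def)
  moreover have "ereal x \<le> ereal t" "ereal t \<le> ereal y" using t by auto
  ultimately have "lep C' \<le> ereal t" "ereal t \<le> rep C'" by (meson order_trans)+
  with ne have "t \<in> C'"
    unfolding component_mem_iff[OF open_E_plus[OF fb] plus(1)] by (simp add: less_le)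
  then show ?thesis using components_disjoint[OF C plus(1) t(1)] plus(2) by simp
qed (use t in \<open>auto simp: plus_region_def\<close>)

section \<open>Kellerer plans on the components\<close>

context noncrossing_plan begin

lemma plus_part:
  assumes C: "C \<in> components (E_plus \<mu> \<nu>)"
  shows "noncrossing_plan (mu_plus \<mu> \<nu> C) (nu_plus \<mu> \<nu> C) (restr \<pi> (plus_region C)) (plus_region C)"
proof
  show "AE z in restr \<pi> (plus_region C). z \<in> plus_region C" by (subst AE_restr_iff) auto
qed (rule restr_plus_region_Marg[OF C] noncrossing_plus_region)+

text \<open>Every arrow to the right across a point t of C belongs to the part over C, so the
  crossing masses at t are those of the whole plan, and the strict inequalities defining
  \<open>E_plus\<close> pass to the component marginals.\<close>

lemma component_kellerer_pair:
  assumes C: "C \<in> components (E_plus \<mu> \<nu>)"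
  shows "kellerer_pair (mu_plus \<mu> \<nu> C) (nu_plus \<mu> \<nu> C) (lep C) (rep C)"
proof -
  interpret R: noncrossing_plan "mu_plus \<mu> \<nu> C" "nu_plus \<mu> \<nu> C" "restr \<pi> (plus_region C)" "plus_region C"
    by (rule plus_part[OF C])
  have mem: "t \<in> C" if "lep C < ereal t" "ereal t < rep C" for t
    using that unfolding component_mem_iff[OF open_E_plus[OF fb] C] by blast
  have tE: "t \<in> E_plus \<mu> \<nu>" if "t \<in> C" for t using that in_components_subset[OF C] by blast
  show ?thesis
  proof (rule kellerer_pair.intro)
    show "finite_borel_measure (mu_plus \<mu> \<nu> C)" "finite_borel_measure (nu_plus \<mu> \<nu> C)" by (rule R.fb)+
    show "lep C < rep C" by (rule component_eq_einterval(3)[OF open_E_plus[OF fb] C])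
    show "AE x in mu_plus \<mu> \<nu> C. lep C \<le> ereal x \<and> ereal x < rep C"
    proof (rule AE_I)
      let ?X = "{x. \<not> (lep C \<le> ereal x \<and> ereal x < rep C)}"
      have X: "?X \<in> sets borel" by measurable
      have "plus_region C \<inter> ?X \<times> UNIV = {}" by (auto simp: plus_region_def)
      then show "emeasure (mu_plus \<mu> \<nu> C) ?X = 0"
        using emeasure_fst_plus_region[OF C X] by simp
      show "?X \<in> sets (mu_plus \<mu> \<nu> C)" using X by (simp add: mu_plus_def)
    qed auto
    show "AE x in nu_plus \<mu> \<nu> C. lep C < ereal x \<and> ereal x \<le> rep C"
    proof (rule AE_I)
      let ?X = "{x. \<not> (lep C < ereal x \<and> ereal x \<le> rep C)}"
      have X: "?X \<in> sets borel" by measurable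
      have "plus_region C \<inter> UNIV \<times> ?X = {}" by (auto simp: plus_region_def)
      then show "emeasure (nu_plus \<mu> \<nu> C) ?X = 0"
        using emeasure_snd_plus_region[OF C X] by simp
      show "?X \<in> sets (nu_plus \<mu> \<nu> C)" using X by (simp add: nu_plus_def)
    qed auto
    show "measure (mu_plus \<mu> \<nu> C) UNIV = measure (nu_plus \<mu> \<nu> C) UNIV"
      using emeasure_fst_plus_region[OF C, of UNIV] emeasure_snd_plus_region[OF C, of UNIV]
      by (simp add: measure_def)
    fix t assume t: "lep C < ereal t" "ereal t < rep C"
    have tC: "t \<in> C" by (rule mem[OF t])
    have "measure (restr \<pi> (plus_region C)) {z. fst z \<le> t \<and> t < snd z} = measure \<pi> (plus_region C \<inter> {z. fst z \<le> t \<and> t < snd z})"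
      by (rule measure_restr) auto
    also have "\<dots> = measure \<pi> {z. fst z \<le> t \<and> t < snd z}"
    proof (rule \<pi>.finite_measure_eq_AE)
      show "AE z in \<pi>. z \<in> plus_region C \<inter> {z. fst z \<le> t \<and> t < snd z} \<longleftrightarrow> z \<in> {z. fst z \<le> t \<and> t < snd z}"
        using AE_plan_support
        by eventually_elim (auto intro: plan_support_through[OF fb C _ tC])
    qed measurable
    finally have "measure (restr \<pi> (plus_region C)) {z. fst z \<le> t \<and> t < snd z} = measure \<pi> {z. fst z \<le> t \<and> t < snd z}" .
    moreover have "measure (restr \<pi> (plus_region C)) {z. snd z \<le> t \<and> t < fst z} = 0"
    proof -
      have "plus_region C \<inter> {z. snd z \<le> t \<and> t < fst z} = {}" by (auto simp: plus_region_def)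
      then show ?thesis by (subst measure_restr) auto
    qed
    ultimately show "cdf (nu_plus \<mu> \<nu> C) t < cdf (mu_plus \<mu> \<nu> C) t"
      using R.cdf_diff[of t] cross_measure(1)[of t] tE[OF tC] by (auto simp: E_plus_def)
    have "measure (restr \<pi> (plus_region C)) {z. fst z < t \<and> t \<le> snd z} = measure \<pi> (plus_region C \<inter> {z. fst z < t \<and> t \<le> snd z})"
      by (rule measure_restr) auto
    also have "\<dots> = measure \<pi> {z. fst z < t \<and> t \<le> snd z}"
    proof (rule \<pi>.finite_measure_eq_AE)
      show "AE z in \<pi>. z \<in> plus_region C \<inter> {z. fst z < t \<and> t \<le> snd z} \<longleftrightarrow> z \<in> {z. fst z < t \<and> t \<le> snd z}"
        using AE_plan_support
        by eventually_elim (auto intro: plan_support_through[OF fb C _ tC])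
    qed measurable
    finally have "measure (restr \<pi> (plus_region C)) {z. fst z < t \<and> t \<le> snd z} = measure \<pi> {z. fst z < t \<and> t \<le> snd z}" .
    moreover have "measure (restr \<pi> (plus_region C)) {z. snd z < t \<and> t \<le> fst z} = 0"
    proof -
      have "plus_region C \<inter> {z. snd z < t \<and> t \<le> fst z} = {}" by (auto simp: plus_region_def)
      then show ?thesis by (subst measure_restr) auto
    qed
    ultimately show "cdf_left (nu_plus \<mu> \<nu> C) t < cdf_left (mu_plus \<mu> \<nu> C) t"
      using R.cdf_left_diff[of t] cross_measure(2)[of t] tE[OF tC] by (auto simp: E_plus_def)
  qed
qed

text \<open>The component marginals are dominated by \<mu> and \<nu>, which permits a density with
  respect to their product. Concentration on F together with the location of the marginals places
  the plan in the region.\<close>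

lemma kellerer_component:
  assumes C: "C \<in> components (E_plus \<mu> \<nu>)"
  obtains G H :: "real \<Rightarrow> real" where "kellerer_F (mu_plus \<mu> \<nu> C) (nu_plus \<mu> \<nu> C) \<in> Marg (mu_plus \<mu> \<nu> C) (nu_plus \<mu> \<nu> C)"
    "AE z in kellerer_F (mu_plus \<mu> \<nu> C) (nu_plus \<mu> \<nu> C). z \<in> plus_region C"
    "G \<in> borel_measurable borel" "H \<in> borel_measurable borel" "\<And>x. 0 \<le> G x" "\<And>y. 0 \<le> H y"
    "kellerer_F (mu_plus \<mu> \<nu> C) (nu_plus \<mu> \<nu> C) =
       density (\<mu> \<Otimes>\<^sub>M \<nu>) (\<lambda>z. ennreal (indicator F_set z * (G (fst z) * H (snd z))))"
proof -
  interpret K: kellerer_pair "mu_plus \<mu> \<nu> C" "nu_plus \<mu> \<nu> C" "lep C" "rep C"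
    by (rule component_kellerer_pair[OF C])
  obtain \<eta>\<^sub>1 \<eta>\<^sub>2 :: "real measure" where \<eta>: "sigma_finite_measure \<eta>\<^sub>1" "sets \<eta>\<^sub>1 = sets borel"
     "sigma_finite_measure \<eta>\<^sub>2" "sets \<eta>\<^sub>2 = sets borel"
     "restr (\<eta>\<^sub>1 \<Otimes>\<^sub>M \<eta>\<^sub>2) F_set \<in> Marg (mu_plus \<mu> \<nu> C) (nu_plus \<mu> \<nu> C)"
    using K.kellerer_exists by blast
  let ?\<kappa> = "restr (\<eta>\<^sub>1 \<Otimes>\<^sub>M \<eta>\<^sub>2) F_set"
  have eq: "kellerer_F (mu_plus \<mu> \<nu> C) (nu_plus \<mu> \<nu> C) = ?\<kappa>" by (rule kellerer_F_eq[OF \<eta>])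
  have ac1: "emeasure (mu_plus \<mu> \<nu> C) X = 0" if X: "X \<in> sets borel" "emeasure \<mu> X = 0" for X
  proof -
    have "emeasure (mu_plus \<mu> \<nu> C) X \<le> emeasure \<pi> (X \<times> UNIV)"
      unfolding emeasure_fst_plus_region[OF C X(1), symmetric]
      using cylinder_sets(1)[OF X(1)] by (intro emeasure_mono) auto
    then show ?thesis using X MargD(5)[OF Marg X(1)] by simp
  qed
  have ac2: "emeasure (nu_plus \<mu> \<nu> C) X = 0" if X: "X \<in> sets borel" "emeasure \<nu> X = 0" for X
  proof -
    have "emeasure (nu_plus \<mu> \<nu> C) X \<le> emeasure \<pi> (UNIV \<times> X)"
      unfolding emeasure_snd_plus_region[OF C X(1), symmetric]
      using cylinder_sets(2)[OF X(1)] by (intro emeasure_mono) auto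
    then show ?thesis using X MargD(6)[OF Marg X(1)] by simp
  qed
  obtain G H where GH: "G \<in> borel_measurable borel" "H \<in> borel_measurable borel"
    "\<And>x. 0 \<le> G x" "\<And>y. 0 \<le> H y"
    "?\<kappa> = density (\<mu> \<Otimes>\<^sub>M \<nu>) (\<lambda>z. ennreal (indicator F_set z * (G (fst z) * H (snd z))))"
    using product_form[OF \<eta>(1,3,2,4,5) fb ac1 ac2] by blast
  have m: "fst \<in> measurable ?\<kappa> borel" "snd \<in> measurable ?\<kappa> borel"
    unfolding measurable_cong_sets[OF MargD(2)[OF \<eta>(5)] refl] borel_prod[symmetric] by auto
  have d: "mu_plus \<mu> \<nu> C = distr ?\<kappa> borel fst" "nu_plus \<mu> \<nu> C = distr ?\<kappa> borel snd"
    using \<eta>(5) by (auto simp: Marg_def)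
  have F: "F_set \<in> sets (\<eta>\<^sub>1 \<Otimes>\<^sub>M \<eta>\<^sub>2)"
    unfolding sets_pair_measure_cong[OF \<eta>(2,4)] by simp
  have "AE z in ?\<kappa>. z \<in> F_set" by (subst AE_restr_iff[OF F]) auto
  moreover have "AE z in ?\<kappa>. lep C \<le> ereal (fst z) \<and> ereal (fst z) < rep C"
    using K.conc1 by (subst (asm) d) (rule AE_distrD[OF m(1)])
  moreover have "AE z in ?\<kappa>. lep C < ereal (snd z) \<and> ereal (snd z) \<le> rep C"
    using K.conc2 by (subst (asm) d) (rule AE_distrD[OF m(2)])
  ultimately have conc: "AE z in ?\<kappa>. z \<in> plus_region C"
    by eventually_elim (auto simp: plus_region_def F_set_def)
  show ?thesis
    by (rule that[of G H, unfolded eq, OF \<eta>(5) conc GH])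
qed

end

lemma emeasure_null_outside:
  assumes "AE z in \<tau>. z \<in> R" "X \<in> sets \<tau>" "X \<inter> R = {}"
  shows "emeasure \<tau> X = 0"
proof -
  have "AE z in \<tau>. z \<in> X \<longleftrightarrow> z \<in> {}" using assms(1) by eventually_elim (use assms(3) in auto)
  then have "emeasure \<tau> X = emeasure \<tau> {}" using assms(2) by (rule emeasure_eq_AE) simp
  then show ?thesis by simp
qed

lemma emeasure_inside:
  assumes "AE z in \<tau>. z \<in> R" "R \<in> sets \<tau>" "X \<in> sets \<tau>"
  shows "emeasure \<tau> (R \<inter> X) = emeasure \<tau> X"
  using assms by (intro emeasure_eq_AE) (auto elim!: eventually_mono)

lemma nn_integral_count_space_single:
  assumes "i \<in> I" "\<And>j. j \<in> I \<Longrightarrow> j \<noteq> i \<Longrightarrow> f j = (0 :: ennreal)"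
  shows "(\<integral>\<^sup>+j. f j \<partial>count_space I) = f i"
  using assms by (subst nn_integral_count_space'[of "{i}"]) auto

lemma nn_integral_count_space_zero:
  "(\<And>j. j \<in> I \<Longrightarrow> f j = (0 :: ennreal)) \<Longrightarrow> (\<integral>\<^sup>+j. f j \<partial>count_space I) = 0"
  by (subst nn_integral_0_iff_AE) (auto simp: AE_count_space)

section \<open>Assembling the generalized plan\<close>

context noncrossing_plan begin

lemma kellerer_component_minus:
  assumes C: "C \<in> components (E_minus \<mu> \<nu>)"
  obtains G H :: "real \<Rightarrow> real" where
    "kellerer_F_tilde (mu_minus \<mu> \<nu> C) (nu_minus \<mu> \<nu> C) \<in> Marg (mu_minus \<mu> \<nu> C) (nu_minus \<mu> \<nu> C)"
    "AE z in kellerer_F_tilde (mu_minus \<mu> \<nu> C) (nu_minus \<mu> \<nu> C). z \<in> minus_region C"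
    "G \<in> borel_measurable borel" "H \<in> borel_measurable borel" "\<And>x. 0 \<le> G x" "\<And>y. 0 \<le> H y"
    "kellerer_F_tilde (mu_minus \<mu> \<nu> C) (nu_minus \<mu> \<nu> C) =
       density (\<mu> \<Otimes>\<^sub>M \<nu>) (\<lambda>z. ennreal (indicator (prod.swap -` F_set) z * (G (fst z) * H (snd z))))"
proof -
  interpret S: noncrossing_plan \<nu> \<mu> "distr \<pi> borel prod.swap" "prod.swap ` \<Gamma>" by (rule swap)
  have C': "C \<in> components (E_plus \<nu> \<mu>)" using C by (simp add: E_minus_eq)
  let ?\<kappa> = "kellerer_F (mu_plus \<nu> \<mu> C) (nu_plus \<nu> \<mu> C)"
  obtain G H where \<kappa>: "?\<kappa> \<in> Marg (mu_plus \<nu> \<mu> C) (nu_plus \<nu> \<mu> C)"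
    "AE z in ?\<kappa>. z \<in> plus_region C"
    and GH: "G \<in> borel_measurable borel" "H \<in> borel_measurable borel" "\<And>x. 0 \<le> G x" "\<And>y. 0 \<le> H y"
    and eq: "?\<kappa> = density (\<nu> \<Otimes>\<^sub>M \<mu>) (\<lambda>z. ennreal (indicator F_set z * (G (fst z) * H (snd z))))"
    using S.kellerer_component[OF C'] by blast
  have t: "kellerer_F_tilde (mu_minus \<mu> \<nu> C) (nu_minus \<mu> \<nu> C) = distr ?\<kappa> borel prod.swap"
    by (simp add: kellerer_F_tilde_def E_minus_parts)
  have sw: "prod.swap \<in> measurable ?\<kappa> borel"
    unfolding measurable_cong_sets[OF MargD(2)[OF \<kappa>(1)] refl] by (rule swap_measurable)
  have 1: "distr ?\<kappa> borel prod.swap \<in> Marg (mu_minus \<mu> \<nu> C) (nu_minus \<mu> \<nu> C)"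
    using Marg_swap[OF \<kappa>(1)] by (simp add: E_minus_parts)
  have 2: "AE z in distr ?\<kappa> borel prod.swap. z \<in> minus_region C"
    using \<kappa>(2) by (subst AE_distr_iff[OF sw]) (auto simp: minus_region_def)
  interpret P: pair_sigma_finite \<mu> \<nu>
    using \<mu>.sigma_finite_measure_axioms \<nu>.sigma_finite_measure_axioms by (simp add: pair_sigma_finite_def)
  define f where "f z = ennreal (indicator (prod.swap -` F_set) z * (H (fst z) * G (snd z)))" for z
  have sr: "sets (\<mu> \<Otimes>\<^sub>M \<nu>) = sets borel" by (rule prod_sets[OF fb])
  have F': "prod.swap -` F_set \<in> sets borel"
    using measurable_sets[OF swap_measurable F_set_borel] by simp
  have [measurable]: "fst \<in> measurable (\<mu> \<Otimes>\<^sub>M \<nu>) borel" "snd \<in> measurable (\<mu> \<Otimes>\<^sub>M \<nu>) borel"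
    "prod.swap -` F_set \<in> sets (\<mu> \<Otimes>\<^sub>M \<nu>)"
    using F' sr unfolding measurable_cong_sets[OF sr refl] borel_prod[symmetric] by auto
  have fm: "f \<in> borel_measurable (\<mu> \<Otimes>\<^sub>M \<nu>)"
    unfolding f_def[abs_def] using GH by measurable
  have "density (\<mu> \<Otimes>\<^sub>M \<nu>) f = density (distr (\<nu> \<Otimes>\<^sub>M \<mu>) (\<mu> \<Otimes>\<^sub>M \<nu>) (\<lambda>(x, y). (y, x))) f"
    by (subst P.distr_pair_swap) simp
  also have "\<dots> = distr (density (\<nu> \<Otimes>\<^sub>M \<mu>) (\<lambda>z. f ((\<lambda>(x, y). (y, x)) z))) (\<mu> \<Otimes>\<^sub>M \<nu>) (\<lambda>(x, y). (y, x))"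
    by (rule density_distr[OF fm]) (rule measurable_pair_swap')
  also have "(\<lambda>z. f ((\<lambda>(x, y). (y, x)) z)) = (\<lambda>z. ennreal (indicator F_set z * (G (fst z) * H (snd z))))"
    by (auto simp: f_def fun_eq_iff indicator_def mult.commute)
  also have "distr (density (\<nu> \<Otimes>\<^sub>M \<mu>) (\<lambda>z. ennreal (indicator F_set z * (G (fst z) * H (snd z))))) (\<mu> \<Otimes>\<^sub>M \<nu>) (\<lambda>(x, y). (y, x))
      = distr ?\<kappa> borel prod.swap"
    unfolding eq by (rule distr_cong) (auto simp: sr)
  finally have 3: "distr ?\<kappa> borel prod.swap = density (\<mu> \<Otimes>\<^sub>M \<nu>)
      (\<lambda>z. ennreal (indicator (prod.swap -` F_set) z * (H (fst z) * G (snd z))))"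
    by (simp add: f_def[abs_def])
  show ?thesis by (rule that[of H G, unfolded t, OF 1 2 GH(2,1,4,3) 3])
qed

abbreviation "\<kappa>\<^sub>p C \<equiv> kellerer_F (mu_plus \<mu> \<nu> C) (nu_plus \<mu> \<nu> C)"
abbreviation "\<kappa>\<^sub>m C \<equiv> kellerer_F_tilde (mu_minus \<mu> \<nu> C) (nu_minus \<mu> \<nu> C)"

lemma \<kappa>\<^sub>p: "C \<in> components (E_plus \<mu> \<nu>) \<Longrightarrow> \<kappa>\<^sub>p C \<in> Marg (mu_plus \<mu> \<nu> C) (nu_plus \<mu> \<nu> C)"
  "C \<in> components (E_plus \<mu> \<nu>) \<Longrightarrow> AE z in \<kappa>\<^sub>p C. z \<in> plus_region C"
  by (rule kellerer_component; assumption)+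

lemma \<kappa>\<^sub>m: "C \<in> components (E_minus \<mu> \<nu>) \<Longrightarrow> \<kappa>\<^sub>m C \<in> Marg (mu_minus \<mu> \<nu> C) (nu_minus \<mu> \<nu> C)"
  "C \<in> components (E_minus \<mu> \<nu>) \<Longrightarrow> AE z in \<kappa>\<^sub>m C. z \<in> minus_region C"
  by (rule kellerer_component_minus; assumption)+

lemma \<kappa>_null:
  assumes X: "X \<in> sets borel"
  shows "C \<in> components (E_plus \<mu> \<nu>) \<Longrightarrow> X \<inter> plus_region C = {} \<Longrightarrow> emeasure (\<kappa>\<^sub>p C) X = 0"
    and "C \<in> components (E_minus \<mu> \<nu>) \<Longrightarrow> X \<inter> minus_region C = {} \<Longrightarrow> emeasure (\<kappa>\<^sub>m C) X = 0"
  using X MargD(2)[OF \<kappa>\<^sub>p(1)] MargD(2)[OF \<kappa>\<^sub>m(1)]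
  by (auto intro: emeasure_null_outside[OF \<kappa>\<^sub>p(2)] emeasure_null_outside[OF \<kappa>\<^sub>m(2)])

lemma sets_kellerer_plan [simp]: "sets (kellerer_plan \<mu> \<nu>) = sets borel"
  by (simp add: kellerer_plan_def)

text \<open>The diagonal part is written through the plan at hand, which prepares the comparison
  with a competitor.\<close>

lemma emeasure_kellerer_plan:
  assumes A: "A \<in> sets borel"
  shows "emeasure (kellerer_plan \<mu> \<nu>) A =
    (\<integral>\<^sup>+C. emeasure (\<kappa>\<^sub>p C) A \<partial>count_space (components (E_plus \<mu> \<nu>))) +
    (\<integral>\<^sup>+C. emeasure (\<kappa>\<^sub>m C) A \<partial>count_space (components (E_minus \<mu> \<nu>))) +
    emeasure \<pi> (diag_region \<mu> \<nu> \<inter> A)"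
proof -
  have "emeasure (sum_measure (components (E_plus \<mu> \<nu>)) \<kappa>\<^sub>p) A
      = (\<integral>\<^sup>+C. emeasure (\<kappa>\<^sub>p C) A \<partial>count_space (components (E_plus \<mu> \<nu>)))"
    by (rule emeasure_sum_measure[OF _ A]) (rule MargD(2)[OF \<kappa>\<^sub>p(1)])
  moreover have "emeasure (sum_measure (components (E_minus \<mu> \<nu>)) \<kappa>\<^sub>m) A
      = (\<integral>\<^sup>+C. emeasure (\<kappa>\<^sub>m C) A \<partial>count_space (components (E_minus \<mu> \<nu>)))"
    by (rule emeasure_sum_measure[OF _ A]) (rule MargD(2)[OF \<kappa>\<^sub>m(1)])
  ultimately show ?thesis
    unfolding kellerer_plan_def
    by (simp add: emeasure_add_measure A emeasure_diag_plan)
qed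

text \<open>Each Kellerer part has the marginals of the corresponding part of \<open>\<pi>\<close>,
  so the two decompositions agree term by term on cylinders.\<close>

lemma kellerer_plan_Marg: "kellerer_plan \<mu> \<nu> \<in> Marg \<mu> \<nu>"
proof (rule MargI)
  have 1: "emeasure (kellerer_plan \<mu> \<nu>) (X \<times> UNIV) = emeasure \<mu> X" if X: "X \<in> sets borel" for X
    unfolding emeasure_kellerer_plan[OF cylinder_sets(1)[OF X]] MargD(5)[OF Marg X]
      emeasure_decompose[OF cylinder_sets(1)[OF X]]
    using MargD(5)[OF \<kappa>\<^sub>p(1) X] MargD(5)[OF \<kappa>\<^sub>m(1) X] emeasure_fst_plus_region[OF _ X] emeasure_minus_region(1)[OF _ X]
    by (intro arg_cong2[where f="(+)"] nn_integral_cong refl) auto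
  show "emeasure (kellerer_plan \<mu> \<nu>) (X \<times> UNIV) = emeasure \<mu> X" if X: "X \<in> sets borel" for X
    by (rule 1[OF X])
  show "emeasure (kellerer_plan \<mu> \<nu>) (UNIV \<times> X) = emeasure \<nu> X" if X: "X \<in> sets borel" for X
    unfolding emeasure_kellerer_plan[OF cylinder_sets(2)[OF X]] MargD(6)[OF Marg X]
      emeasure_decompose[OF cylinder_sets(2)[OF X]]
    using MargD(6)[OF \<kappa>\<^sub>p(1) X] MargD(6)[OF \<kappa>\<^sub>m(1) X] emeasure_snd_plus_region[OF _ X] emeasure_minus_region(2)[OF _ X]
    by (intro arg_cong2[where f="(+)"] nn_integral_cong refl) auto
  show "finite_measure (kellerer_plan \<mu> \<nu>)"
    using 1[of UNIV] sets_eq_imp_space_eq[OF sets_kellerer_plan] by (intro finite_measureI) simp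
qed (auto simp: MargD(3,4)[OF Marg])

lemma emeasure_kellerer_plan_plus:
  assumes C: "C \<in> components (E_plus \<mu> \<nu>)" and A: "A \<in> sets borel"
  shows "emeasure (kellerer_plan \<mu> \<nu>) (plus_region C \<inter> A) = emeasure (\<kappa>\<^sub>p C) A"
proof -
  let ?X = "plus_region C \<inter> A"
  have X: "?X \<in> sets borel" using A by simp
  have "(\<integral>\<^sup>+C'. emeasure (\<kappa>\<^sub>p C') ?X \<partial>count_space (components (E_plus \<mu> \<nu>))) = emeasure (\<kappa>\<^sub>p C) ?X"
    by (rule nn_integral_count_space_single[OF C], rule \<kappa>_null(1)[OF X])
       (use plus_region_disjoint[OF fb C] in blast)+
  moreover have "(\<integral>\<^sup>+C'. emeasure (\<kappa>\<^sub>m C') ?X \<partial>count_space (components (E_minus \<mu> \<nu>))) = 0"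
    by (rule nn_integral_count_space_zero, rule \<kappa>_null(2)[OF X])
       (use plus_minus_region_disjoint[OF fb C] in blast)+
  moreover have "diag_region \<mu> \<nu> \<inter> ?X = {}" using plus_diag_region_disjoint[OF fb C] by blast
  moreover have "emeasure (\<kappa>\<^sub>p C) ?X = emeasure (\<kappa>\<^sub>p C) A"
    using A MargD(2)[OF \<kappa>\<^sub>p(1)[OF C]] by (intro emeasure_inside[OF \<kappa>\<^sub>p(2)[OF C]]) auto
  ultimately show ?thesis unfolding emeasure_kellerer_plan[OF X] by simp
qed

lemma emeasure_kellerer_plan_minus:
  assumes C: "C \<in> components (E_minus \<mu> \<nu>)" and A: "A \<in> sets borel"
  shows "emeasure (kellerer_plan \<mu> \<nu>) (minus_region C \<inter> A) = emeasure (\<kappa>\<^sub>m C) A"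
proof -
  let ?X = "minus_region C \<inter> A"
  have X: "?X \<in> sets borel" using A by simp
  have "(\<integral>\<^sup>+C'. emeasure (\<kappa>\<^sub>m C') ?X \<partial>count_space (components (E_minus \<mu> \<nu>))) = emeasure (\<kappa>\<^sub>m C) ?X"
    by (rule nn_integral_count_space_single[OF C], rule \<kappa>_null(2)[OF X])
       (use minus_region_disjoint[OF fb C] in blast)+
  moreover have "(\<integral>\<^sup>+C'. emeasure (\<kappa>\<^sub>p C') ?X \<partial>count_space (components (E_plus \<mu> \<nu>))) = 0"
    by (rule nn_integral_count_space_zero, rule \<kappa>_null(1)[OF X])
       (use plus_minus_region_disjoint[OF fb _ C] in blast)+
  moreover have "diag_region \<mu> \<nu> \<inter> ?X = {}" using minus_diag_region_disjoint[OF fb C] by blast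
  moreover have "emeasure (\<kappa>\<^sub>m C) ?X = emeasure (\<kappa>\<^sub>m C) A"
    using A MargD(2)[OF \<kappa>\<^sub>m(1)[OF C]] by (intro emeasure_inside[OF \<kappa>\<^sub>m(2)[OF C]]) auto
  ultimately show ?thesis unfolding emeasure_kellerer_plan[OF X] by simp
qed

lemma emeasure_kellerer_plan_outside:
  assumes X: "X \<in> sets borel" "\<And>C. C \<in> components (E_plus \<mu> \<nu>) \<Longrightarrow> X \<inter> plus_region C = {}"
    "\<And>C. C \<in> components (E_minus \<mu> \<nu>) \<Longrightarrow> X \<inter> minus_region C = {}"
  shows "emeasure (kellerer_plan \<mu> \<nu>) X = emeasure \<pi> (diag_region \<mu> \<nu> \<inter> X)"
  unfolding emeasure_kellerer_plan[OF X(1)]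
  by (simp add: nn_integral_count_space_zero \<kappa>_null[OF X(1)] X(2,3))

lemma emeasure_kellerer_plan_diag:
  assumes A: "A \<in> sets borel"
  shows "emeasure (kellerer_plan \<mu> \<nu>) (diag_region \<mu> \<nu> \<inter> A) = emeasure \<pi> (diag_region \<mu> \<nu> \<inter> A)"
proof -
  have "emeasure (kellerer_plan \<mu> \<nu>) (diag_region \<mu> \<nu> \<inter> A) = emeasure \<pi> (diag_region \<mu> \<nu> \<inter> (diag_region \<mu> \<nu> \<inter> A))"
  proof (rule emeasure_kellerer_plan_outside)
    show "diag_region \<mu> \<nu> \<inter> A \<in> sets borel" using A diag_region_measurable[OF fb] by simp
  qed (use plus_diag_region_disjoint[OF fb] minus_diag_region_disjoint[OF fb] in blast)+
  then show ?thesis by (simp add: Int_assoc[symmetric])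
qed

lemma kellerer_plan_support: "AE z in kellerer_plan \<mu> \<nu>. z \<in> plan_support \<mu> \<nu>"
proof -
  have X: "- plan_support \<mu> \<nu> \<in> sets borel" using plan_support_measurable[OF fb] by simp
  have "emeasure (kellerer_plan \<mu> \<nu>) (- plan_support \<mu> \<nu>) = emeasure \<pi> (diag_region \<mu> \<nu> \<inter> - plan_support \<mu> \<nu>)"
    by (rule emeasure_kellerer_plan_outside[OF X]) (auto simp: plan_support_def)
  also have "diag_region \<mu> \<nu> \<inter> - plan_support \<mu> \<nu> = {}" by (auto simp: plan_support_def)
  finally show ?thesis using X by (intro AE_I[of _ _ "- plan_support \<mu> \<nu>"]) auto
qed

lemma kellerer_plan_cyc_mono: "kellerer_plan \<mu> \<nu> \<in> cyc_mono_plans \<mu> \<nu>"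
  using kellerer_plan_Marg kellerer_plan_support
    noncrossing_imp_cyclically_monotone[OF noncrossing_plan_support[OF fb]]
  by (auto simp: cyc_mono_plans_def)

end

section \<open>Entropy\<close>

text \<open>This is ln t \<le> t - 1 at t = exp c / f, multiplied by f; equality holds for f = exp
  c.\<close>

lemma mult_ln_ge_Young:
  fixes f c :: real
  assumes "0 \<le> f"
  shows "f * c + f - exp c \<le> f * ln f"
proof (cases "f = 0")
  case False
  then have f: "0 < f" using assms by simp
  have "ln (exp c / f) \<le> exp c / f - 1" using f by (intro ln_le_minus_one) simp
  then have "c - ln f \<le> exp c / f - 1" using f by (simp add: ln_div)
  then have "f * (c - ln f) \<le> f * (exp c / f - 1)" using f by (intro mult_left_mono) auto
  then show ?thesis using f by (simp add: algebra_simps)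
qed simp

lemma mult_ln_ge: "0 \<le> f \<Longrightarrow> - 1 \<le> f * ln f" for f :: real
  using mult_ln_ge_Young[of f 0] by simp

definition clamp_real :: "real \<Rightarrow> real \<Rightarrow> real" where
  "clamp_real n t = max (- n) (min n t)"

lemma clamp_real_bounded: "0 \<le> n \<Longrightarrow> \<bar>clamp_real n t\<bar> \<le> n"
  by (auto simp: clamp_real_def)

text \<open>Truncation is odd, monotone and does not expand distances: from u \<ge> -v it keeps the
  order of u and -v and can only shrink their distance.\<close>

lemma clamp_real_add_nonneg:
  assumes "0 \<le> n" "0 \<le> u + v"
  shows "0 \<le> clamp_real n u + clamp_real n v" "clamp_real n u + clamp_real n v \<le> u + v"
  using assms unfolding clamp_real_def max_def min_def by (auto split: if_splits)

lemma clamp_real_add_nonpos: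
  assumes "0 \<le> n" "u + v \<le> 0"
  shows "clamp_real n u + clamp_real n v \<le> 0" "u + v \<le> clamp_real n u + clamp_real n v"
  using assms unfolding clamp_real_def max_def min_def by (auto split: if_splits)

lemma clamp_real_eventually: "eventually (\<lambda>n. clamp_real (real n) t = t) sequentially"
proof -
  obtain N :: nat where "\<bar>t\<bar> \<le> real N" using real_arch_simple by blast
  then show ?thesis
    by (intro eventually_sequentiallyI[of N]) (auto simp: clamp_real_def max_def min_def abs_le_iff)
qed

lemma clamp_real_measurable [measurable]:
  "f \<in> borel_measurable M \<Longrightarrow> (\<lambda>x. clamp_real n (f x)) \<in> borel_measurable M"
  unfolding clamp_real_def by (intro borel_measurable_max borel_measurable_min borel_measurable_const)

lemma ennreal_integral_le_nn_integral:
  fixes g :: "'a \<Rightarrow> real"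
  assumes "integrable M g"
  shows "ennreal (\<integral>x. g x \<partial>M) \<le> (\<integral>\<^sup>+x. ennreal (g x) \<partial>M)"
proof -
  have i: "integrable M (\<lambda>x. max 0 (g x))" using assms by auto
  have "ennreal (\<integral>x. g x \<partial>M) \<le> ennreal (\<integral>x. max 0 (g x) \<partial>M)"
    using assms i by (intro ennreal_leI integral_mono) auto
  also have "\<dots> = (\<integral>\<^sup>+x. ennreal (max 0 (g x)) \<partial>M)"
    using i by (intro nn_integral_eq_integral[symmetric]) auto
  also have "\<dots> = (\<integral>\<^sup>+x. ennreal (g x) \<partial>M)" by (intro nn_integral_cong) (auto simp: max_def ennreal_neg)
  finally show ?thesis .
qed

text \<open>The test functions \<open>W n\<close> truncate \<open>ln k\<close> without changing its sign, and are sums of functions of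
  one variable, so that their integral only depends on the marginals.  Testing the convex conjugate of
  \<open>t ln t\<close> with \<open>W n\<close> and applying Fatou's lemma avoids any integrability assumption on \<open>ln G\<close> and \<open>ln H\<close>.\<close>

lemma entropy_le_of_product:
  fixes \<rho> \<sigma> \<kappa> :: "(real \<times> real) measure" and G H :: "real \<Rightarrow> real" and f :: "real \<times> real \<Rightarrow> real"
  assumes \<rho>: "finite_measure \<rho>" "sets \<rho> = sets borel"
    and Marg: "\<sigma> \<in> Marg \<gamma>\<^sub>1 \<gamma>\<^sub>2" "\<kappa> \<in> Marg \<gamma>\<^sub>1 \<gamma>\<^sub>2"
    and GH: "G \<in> borel_measurable borel" "H \<in> borel_measurable borel" "\<And>x. 0 \<le> G x" "\<And>y. 0 \<le> H y"
    and S: "S \<in> sets borel"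
    and k: "\<And>z. k z = indicator S z * (G (fst z) * H (snd z))" and \<kappa>: "\<kappa> = density \<rho> (\<lambda>z. ennreal (k z))"
    and f: "f \<in> borel_measurable \<rho>" "\<And>z. 0 \<le> f z" and \<sigma>: "\<sigma> = density \<rho> (\<lambda>z. ennreal (f z))"
    and conc: "AE z in \<sigma>. z \<in> S"
  shows "(\<integral>\<^sup>+z. ennreal (k z * ln (k z) + 2) \<partial>\<rho>) \<le> (\<integral>\<^sup>+z. ennreal (f z * ln (f z) + 2) \<partial>\<rho>)"
proof -
  interpret \<rho>: finite_measure \<rho> by fact
  interpret \<sigma>: finite_measure \<sigma> by (rule MargD[OF Marg(1)])
  interpret \<kappa>: finite_measure \<kappa> by (rule MargD[OF Marg(2)])
  have [measurable]: "fst \<in> measurable \<rho> borel" "snd \<in> measurable \<rho> borel" "S \<in> sets \<rho>"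
    using S \<rho>(2) unfolding measurable_cong_sets[OF \<rho>(2) refl] borel_prod[symmetric] by auto
  note [measurable] = GH(1,2) f(1)
  have km [measurable]: "k \<in> borel_measurable \<rho>" unfolding k[abs_def] by measurable
  have k0: "0 \<le> k z" for z using GH(3,4) by (simp add: k)
  define P where "P = {z. 0 < k z}"
  have "{z \<in> space \<rho>. 0 < k z} \<in> sets \<rho>" by measurable
  then have P [measurable]: "P \<in> sets \<rho>"
    using sets_eq_imp_space_eq[OF \<rho>(2)] by (simp add: P_def)
  have "AE z in \<sigma>. 0 < G (fst z) \<and> 0 < H (snd z)"
    by (rule Marg_product_pos[OF Marg(2,1) \<kappa>[unfolded k] \<rho>(2) S GH])
  with conc have "AE z in \<sigma>. z \<in> P" by eventually_elim (simp add: P_def k)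
  then have "AE z in \<rho>. 0 < ennreal (f z) \<longrightarrow> z \<in> P"
    unfolding \<sigma> using f by (subst (asm) AE_density) auto
  then have offP: "AE z in \<rho>. z \<in> P \<or> f z = 0"
    by eventually_elim (use f(2) in \<open>auto simp: less_le\<close>)
  define u where "u x = ln (G x)" for x
  define v where "v x = ln (H x)" for x
  have uv [measurable]: "u \<in> borel_measurable borel" "v \<in> borel_measurable borel"
    unfolding u_def[abs_def] v_def[abs_def] by measurable
  define W where "W n z = clamp_real (real n) (u (fst z)) + clamp_real (real n) (v (snd z))" for n :: nat and z
  have Wm [measurable]: "W n \<in> borel_measurable \<rho>" for n unfolding W_def[abs_def] by measurable
  have cu: "(\<lambda>x. clamp_real (real n) (u x)) \<in> borel_measurable borel"
    "(\<lambda>x. clamp_real (real n) (v x)) \<in> borel_measurable borel" for n by measurable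
  have bd: "\<bar>clamp_real (real n) t\<bar> \<le> real n" for n t by (rule clamp_real_bounded) simp
  have Wbd: "W n z \<le> 2 * real n" for n z
    unfolding W_def using bd[of n "u (fst z)"] bd[of n "v (snd z)"] by (simp add: abs_le_iff)
  have lnk: "k z = exp (u (fst z) + v (snd z))" "ln (k z) = u (fst z) + v (snd z)" if "z \<in> P" for z
  proof -
    have "k z \<noteq> 0" using that by (simp add: P_def)
    then have "z \<in> S" "G (fst z) \<noteq> 0" "H (snd z) \<noteq> 0"
      by (auto simp: k indicator_def split: if_splits)
    then have "z \<in> S" "0 < G (fst z)" "0 < H (snd z)"
      using GH(3)[of "fst z"] GH(4)[of "snd z"] by (auto simp: less_le)
    then show "k z = exp (u (fst z) + v (snd z))" "ln (k z) = u (fst z) + v (snd z)"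
      by (auto simp: k u_def v_def exp_add ln_mult)
  qed
  note I\<sigma> = Marg_integral[OF Marg(1) cu bd bd, folded W_def]
  note I\<kappa> = Marg_integral[OF Marg(2) cu bd bd, folded W_def]
  have ik: "integrable \<rho> (\<lambda>z. k z * W n z)" "(\<integral>z. k z * W n z \<partial>\<rho>) = (\<integral>z. W n z \<partial>\<kappa>)" for n
    using I\<kappa>(1)[of n] unfolding \<kappa>
    by (auto simp: integrable_density[OF Wm km] integral_density[OF Wm km] k0)
  have if': "integrable \<rho> (\<lambda>z. f z * W n z)" "(\<integral>z. f z * W n z \<partial>\<rho>) = (\<integral>z. W n z \<partial>\<sigma>)" for n
    using I\<sigma>(1)[of n] unfolding \<sigma>
    by (auto simp: integrable_density[OF Wm f(1)] integral_density[OF Wm f(1)] f(2))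
  have one: "(\<lambda>z. 1 :: real) \<in> borel_measurable \<rho>" by simp
  have ik1: "integrable \<rho> k" "(\<integral>z. k z \<partial>\<rho>) = measure \<kappa> UNIV"
    using \<kappa>.integrable_const[of "1::real"] integral_density[OF one km] sets_eq_imp_space_eq[OF MargD(2)[OF Marg(2)]]
    unfolding \<kappa> by (auto simp: integrable_density[OF one km] k0)
  have if1: "integrable \<rho> f" "(\<integral>z. f z \<partial>\<rho>) = measure \<sigma> UNIV"
    using \<sigma>.integrable_const[of "1::real"] integral_density[OF one f(1)] sets_eq_imp_space_eq[OF MargD(2)[OF Marg(1)]]
    unfolding \<sigma> by (auto simp: integrable_density[OF one f(1)] f(2))
  have masses: "measure \<sigma> UNIV = measure \<kappa> UNIV"
    using MargD(5)[OF Marg(1), of UNIV] MargD(5)[OF Marg(2), of UNIV] by (simp add: measure_def)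
  \<comment> \<open>Off \<open>P\<close> the logarithms are default values; there f vanishes almost
    everywhere, and dropping the exponential makes both sides of Young's inequality 0.\<close>
  define e where "e n z = indicator P z * exp (W n z)" for n z
  have ie: "integrable \<rho> (e n)" for n
    by (rule \<rho>.integrable_const_bound[of _ "exp (2 * real n)"])
       (use Wbd[of n] in \<open>auto simp: e_def[abs_def] indicator_def\<close>)
  \<comment> \<open>\<open>W n\<close> is a sum of functions of one coordinate, so both plans give
    it the same integral; the masses agree and the term \<open>e n\<close> is common.\<close>
  have E: "(\<integral>z. k z * W n z + k z - e n z + 2 \<partial>\<rho>) = (\<integral>z. f z * W n z + f z - e n z + 2 \<partial>\<rho>)" for n
    using ik[of n] if'[of n] ik1 if1 ie[of n] I\<sigma>(2)[of n] I\<kappa>(2)[of n] masses by simp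
  have ih: "integrable \<rho> (\<lambda>z. k z * W n z + k z - e n z + 2)" "integrable \<rho> (\<lambda>z. f z * W n z + f z - e n z + 2)" for n
    using ik[of n] if'[of n] ik1 if1 ie[of n] by auto
  \<comment> \<open>Origin of the constant 2: for k \<ge> 1 the truncation gives exp W \<le> k and k
    W \<ge> 0; for 0 < k < 1 it gives k W \<ge> k ln k \<ge> -1 and exp W \<le> 1. Fatou's lemma
    needs this uniform bound.\<close>
  have nonneg: "0 \<le> k z * W n z + k z - e n z + 2" for n z
  proof (cases "z \<in> P")
    case True
    define w where "w = u (fst z) + v (snd z)"
    have kw: "k z = exp w" using lnk[OF True] by (simp add: w_def)
    show ?thesis
    proof (cases "0 \<le> w")
      case w: True
      have "0 \<le> W n z" "W n z \<le> w"
        unfolding W_def w_def using clamp_real_add_nonneg[of "real n" "u (fst z)" "v (snd z)"] w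
        by (auto simp: w_def)
      then have "exp (W n z) \<le> k z" "0 \<le> k z * W n z" using kw by auto
      then show ?thesis using True by (simp add: e_def)
    next
      case w: False
      have W: "W n z \<le> 0" "w \<le> W n z"
        unfolding W_def w_def using clamp_real_add_nonpos[of "real n" "u (fst z)" "v (snd z)"] w
        by (auto simp: w_def)
      then have "k z * w \<le> k z * W n z" using k0 by (intro mult_left_mono) auto
      moreover have "- 1 \<le> k z * w" using mult_ln_ge[OF k0[of z]] by (simp add: kw)
      moreover have "exp (W n z) \<le> 1" using W(1) by simp
      moreover have "e n z = exp (W n z)" using True by (simp add: e_def)
      ultimately show ?thesis using k0[of z] by linarith
    qed
  qed (use k0[of z] in \<open>auto simp: P_def e_def less_le\<close>)
  have lim: "(\<lambda>n. ennreal (k z * W n z + k z - e n z + 2)) \<longlonglongrightarrow> ennreal (k z * ln (k z) + 2)" for z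
  proof (cases "z \<in> P")
    case True
    have "eventually (\<lambda>n. W n z = ln (k z)) sequentially"
      using clamp_real_eventually[of "u (fst z)"] clamp_real_eventually[of "v (snd z)"]
      by eventually_elim (simp add: W_def lnk[OF True])
    then have "eventually (\<lambda>n. ennreal (k z * W n z + k z - e n z + 2) = ennreal (k z * ln (k z) + 2)) sequentially"
      by eventually_elim (use True in \<open>auto simp: e_def P_def\<close>)
    then show ?thesis by (rule tendsto_eventually)
  next
    case False
    then have "k z = 0" using k0[of z] by (simp add: P_def)
    then show ?thesis using False by (simp add: e_def)
  qed
  have "(\<integral>\<^sup>+z. ennreal (k z * ln (k z) + 2) \<partial>\<rho>)
      = (\<integral>\<^sup>+z. liminf (\<lambda>n. ennreal (k z * W n z + k z - e n z + 2)) \<partial>\<rho>)"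
    by (intro nn_integral_cong lim_imp_Liminf[symmetric] lim) simp
  also have "\<dots> \<le> liminf (\<lambda>n. \<integral>\<^sup>+z. ennreal (k z * W n z + k z - e n z + 2) \<partial>\<rho>)"
    using ih(1) by (intro nn_integral_liminf) auto
  also have "\<dots> \<le> liminf (\<lambda>n :: nat. \<integral>\<^sup>+z. ennreal (f z * ln (f z) + 2) \<partial>\<rho>)"
  proof (intro Liminf_mono always_eventually allI)
    fix n
    have "(\<integral>\<^sup>+z. ennreal (k z * W n z + k z - e n z + 2) \<partial>\<rho>) = ennreal (\<integral>z. k z * W n z + k z - e n z + 2 \<partial>\<rho>)"
      using nonneg by (intro nn_integral_eq_integral ih) auto
    also have "\<dots> = ennreal (\<integral>z. f z * W n z + f z - e n z + 2 \<partial>\<rho>)" by (simp only: E)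
    \<comment> \<open>For f the integrand may be negative; its truncation by \<open>ennreal\<close>
      only enlarges the integral, which is the right direction.\<close>
    also have "\<dots> \<le> (\<integral>\<^sup>+z. ennreal (f z * W n z + f z - e n z + 2) \<partial>\<rho>)"
      by (rule ennreal_integral_le_nn_integral[OF ih(2)])
    also have "\<dots> \<le> (\<integral>\<^sup>+z. ennreal (f z * ln (f z) + 2) \<partial>\<rho>)"
    proof (rule nn_integral_mono_AE)
      show "AE z in \<rho>. ennreal (f z * W n z + f z - e n z + 2) \<le> ennreal (f z * ln (f z) + 2)"
        using offP
      proof eventually_elim
        case (elim z)
        have "f z * W n z + f z - e n z \<le> f z * ln (f z)"
        proof (cases "z \<in> P")
          case True
          then show ?thesis using mult_ln_ge_Young[OF f(2), of z "W n z"] by (simp add: e_def)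
        qed (use elim in \<open>auto simp: e_def\<close>)
        then show ?case by (intro ennreal_leI) simp
      qed
    qed
    finally show "(\<integral>\<^sup>+z. ennreal (k z * W n z + k z - e n z + 2) \<partial>\<rho>) \<le> (\<integral>\<^sup>+z. ennreal (f z * ln (f z) + 2) \<partial>\<rho>)" .
  qed
  also have "\<dots> = (\<integral>\<^sup>+z. ennreal (f z * ln (f z) + 2) \<partial>\<rho>)" by (simp add: Liminf_const)
  finally show ?thesis .
qed

lemma density_real_RN_deriv:
  assumes \<rho>: "finite_measure \<rho>" and \<gamma>: "finite_measure \<gamma>" and ac: "absolutely_continuous \<rho> \<gamma>" and s: "sets \<gamma> = sets \<rho>"
  shows "\<gamma> = density \<rho> (\<lambda>z. ennreal (enn2real (RN_deriv \<rho> \<gamma> z)))"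
proof -
  interpret \<rho>: finite_measure \<rho> by fact
  interpret \<gamma>: finite_measure \<gamma> by fact
  have "AE z in \<rho>. RN_deriv \<rho> \<gamma> z \<noteq> \<infinity>"
    by (rule \<rho>.RN_deriv_finite[OF \<gamma>.sigma_finite_measure_axioms ac s])
  then have "density \<rho> (RN_deriv \<rho> \<gamma>) = density \<rho> (\<lambda>z. ennreal (enn2real (RN_deriv \<rho> \<gamma> z)))"
    by (intro density_cong) (auto elim!: eventually_mono simp: less_top)
  then show ?thesis using \<rho>.density_RN_deriv[OF ac s] by simp
qed

text \<open>Since t ln t \<ge> -1, the shifted integrand is positive. Entropies can then be added
  over regions in \<open>ennreal\<close> without meeting \<infinity> - \<infinity>.\<close>

definition shifted_entropy :: "'a measure \<Rightarrow> ('a \<Rightarrow> real) \<Rightarrow> ennreal" where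
  "shifted_entropy \<rho> f = (\<integral>\<^sup>+z. ennreal (f z * ln (f z) + 2) \<partial>\<rho>)"

text \<open>The negative part is bounded by 1 on a finite measure, so the shift changes the extended
  integral by a finite amount, also when the positive part diverges.\<close>

lemma Ent_eq_shifted:
  assumes \<rho>: "finite_measure \<rho>" and ac: "absolutely_continuous \<rho> \<gamma>"
  shows "Ent \<gamma> \<rho> = enn2ereal (shifted_entropy \<rho> (\<lambda>z. enn2real (RN_deriv \<rho> \<gamma> z))) - ereal (2 * measure \<rho> (space \<rho>))"
proof -
  interpret \<rho>: finite_measure \<rho> by fact
  define f where "f z = enn2real (RN_deriv \<rho> \<gamma> z)" for z
  have [measurable]: "f \<in> borel_measurable \<rho>" unfolding f_def[abs_def] by measurable
  define g where "g z = ln (f z) * f z" for z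
  have [measurable]: "g \<in> borel_measurable \<rho>" unfolding g_def[abs_def] by measurable
  have g: "- 1 \<le> g z" for z using mult_ln_ge[of "f z"] by (simp add: g_def f_def mult.commute)
  let ?A = "\<integral>\<^sup>+z. ennreal (g z + 2) \<partial>\<rho>" and ?P = "\<integral>\<^sup>+z. ennreal (g z) \<partial>\<rho>" and ?N = "\<integral>\<^sup>+z. ennreal (- g z) \<partial>\<rho>"
  define r where "r = measure \<rho> (space \<rho>)"
  have "?A + ?N = (\<integral>\<^sup>+z. ennreal (g z + 2) + ennreal (- g z) \<partial>\<rho>)"
    by (rule nn_integral_add[symmetric]) auto
  also have "\<dots> = (\<integral>\<^sup>+z. ennreal (g z) + ennreal 2 \<partial>\<rho>)"
  proof (rule nn_integral_cong)
    fix z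
    show "ennreal (g z + 2) + ennreal (- g z) = ennreal (g z) + ennreal 2"
    proof (cases "0 \<le> g z")
      case True
      then show ?thesis by (simp add: ennreal_neg ennreal_plus del: ennreal_numeral)
    next
      case False
      then show ?thesis using g[of z] by (simp add: ennreal_neg ennreal_plus[symmetric] del: ennreal_plus)
    qed
  qed
  also have "\<dots> = ?P + ennreal (2 * r)"
    by (subst nn_integral_add) (auto simp: r_def \<rho>.emeasure_eq_measure ennreal_mult' simp del: ennreal_numeral)
  finally have eq: "?A + ?N = ?P + ennreal (2 * r)" .
  have "?N \<le> (\<integral>\<^sup>+z. ennreal 1 \<partial>\<rho>)" using g by (intro nn_integral_mono ennreal_leI) (simp add: minus_le_iff)
  also have "\<dots> < \<top>" by (simp add: \<rho>.emeasure_eq_measure)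
  finally obtain n where n: "?N = ennreal n" "0 \<le> n" by (cases "?N") auto
  have r: "0 \<le> r" by (simp add: r_def)
  have "enn2ereal ?P - enn2ereal ?N = enn2ereal ?A - ereal (2 * r)"
  proof (cases "?A")
    case top
    then have "\<top> = ?P + ennreal (2 * r)" using eq by simp
    then have "?P + ennreal (2 * r) = \<top>" by (rule sym)
    then have "?P = \<top>" by (simp only: ennreal_add_eq_top ennreal_neq_top simp_thms)
    then show ?thesis using top n by simp
  next
    case (real a)
    then have "?P + ennreal (2 * r) = ennreal (a + n)" using eq n by simp
    then have "?P \<noteq> \<top>" by (metis ennreal_add_eq_top ennreal_neq_top)
    then obtain p where p: "?P = ennreal p" "0 \<le> p" by (cases "?P") auto
    have "ennreal (p + 2 * r) = ennreal (a + n)"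
      using \<open>?P + ennreal (2 * r) = ennreal (a + n)\<close> p r by simp
    then have "p + 2 * r = a + n" using p r real n by (subst (asm) ennreal_inj) auto
    then show ?thesis using p n real r by simp
  qed
  then show ?thesis
    using ac by (simp add: Ent_def ext_integral_def shifted_entropy_def g_def f_def r_def mult.commute)
qed

lemma Ent_gt_MInfty:
  assumes "finite_measure \<rho>"
  shows "Ent \<gamma> \<rho> > - \<infinity>"
proof (cases "absolutely_continuous \<rho> \<gamma>")
  case True
  have "- \<infinity> < enn2ereal A - ereal c" for A c
    by (cases A) auto
  then show ?thesis unfolding Ent_eq_shifted[OF assms True] .
qed (simp add: Ent_def)

text \<open>Outside \<open>R\<close> the integrand is 0 ln 0 + 2 = 2, with the convention 0 ln 0 =
  0.\<close>

lemma nn_integral_shifted_indicator: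
  fixes h :: "'a \<Rightarrow> real"
  assumes [measurable]: "h \<in> borel_measurable \<rho>" "R \<in> sets \<rho>"
  shows "shifted_entropy \<rho> (\<lambda>z. indicator R z * h z)
    = (\<integral>\<^sup>+z. ennreal (h z * ln (h z) + 2) * indicator R z \<partial>\<rho>) + 2 * emeasure \<rho> (space \<rho> - R)"
proof -
  have "shifted_entropy \<rho> (\<lambda>z. indicator R z * h z)
      = (\<integral>\<^sup>+z. ennreal (h z * ln (h z) + 2) * indicator R z + 2 * indicator (space \<rho> - R) z \<partial>\<rho>)"
    unfolding shifted_entropy_def by (intro nn_integral_cong) (auto simp: indicator_def)
  also have "\<dots> = (\<integral>\<^sup>+z. ennreal (h z * ln (h z) + 2) * indicator R z \<partial>\<rho>) + 2 * emeasure \<rho> (space \<rho> - R)"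
    by (subst nn_integral_add) (auto simp: nn_integral_cmult)
  finally show ?thesis .
qed

lemma restr_density:
  assumes "h \<in> borel_measurable \<rho>" "\<And>z. 0 \<le> h z" "R \<in> sets \<rho>"
  shows "restr (density \<rho> (\<lambda>z. ennreal (h z))) R = density \<rho> (\<lambda>z. ennreal (indicator R z * h z))"
  unfolding restr_def using assms
  by (subst density_density_eq) (auto intro!: density_cong simp: indicator_def)

section \<open>Comparison of entropies region by region\<close>

context noncrossing_plan begin

text \<open>The plus and minus parts always have densities. Only the diagonal part can be singular,
  and it coincides with that of \<open>\<pi>\<close>.\<close>

lemma kellerer_plan_ac:
  assumes ac: "absolutely_continuous (\<mu> \<Otimes>\<^sub>M \<nu>) \<pi>"
  shows "absolutely_continuous (\<mu> \<Otimes>\<^sub>M \<nu>) (kellerer_plan \<mu> \<nu>)"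
  unfolding absolutely_continuous_def
proof
  have sr: "sets (\<mu> \<Otimes>\<^sub>M \<nu>) = sets borel" by (rule prod_sets[OF fb])
  have dens: "emeasure \<tau> X = 0"
    if "\<tau> = density (\<mu> \<Otimes>\<^sub>M \<nu>) h" "sets \<tau> = sets borel" "X \<in> null_sets (\<mu> \<Otimes>\<^sub>M \<nu>)" "h \<in> borel_measurable (\<mu> \<Otimes>\<^sub>M \<nu>)"
    for \<tau> h X
    using that absolutely_continuousI_density[OF that(4)] by (auto simp: absolutely_continuous_def)
  have F': "prod.swap -` F_set \<in> sets borel"
    using measurable_sets[OF swap_measurable F_set_borel] by simp
  have [measurable]: "fst \<in> measurable (\<mu> \<Otimes>\<^sub>M \<nu>) borel" "snd \<in> measurable (\<mu> \<Otimes>\<^sub>M \<nu>) borel"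
    "F_set \<in> sets (\<mu> \<Otimes>\<^sub>M \<nu>)" "prod.swap -` F_set \<in> sets (\<mu> \<Otimes>\<^sub>M \<nu>)"
    using F' F_set_borel sr unfolding measurable_cong_sets[OF sr refl] borel_prod[symmetric] by auto
  fix X assume X: "X \<in> null_sets (\<mu> \<Otimes>\<^sub>M \<nu>)"
  then have Xb: "X \<in> sets borel" using sr by auto
  have p: "emeasure (\<kappa>\<^sub>p C) X = 0" if C: "C \<in> components (E_plus \<mu> \<nu>)" for C
  proof -
    obtain G H where GH: "G \<in> borel_measurable borel" "H \<in> borel_measurable borel"
      and eq: "\<kappa>\<^sub>p C = density (\<mu> \<Otimes>\<^sub>M \<nu>) (\<lambda>z. ennreal (indicator F_set z * (G (fst z) * H (snd z))))"
      by (rule kellerer_component[OF C]) (rule that; assumption)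
    note [measurable] = GH
    show ?thesis by (rule dens[OF eq MargD(2)[OF \<kappa>\<^sub>p(1)[OF C]] X]) measurable
  qed
  have m: "emeasure (\<kappa>\<^sub>m C) X = 0" if C: "C \<in> components (E_minus \<mu> \<nu>)" for C
  proof -
    obtain G H where GH: "G \<in> borel_measurable borel" "H \<in> borel_measurable borel"
      and eq: "\<kappa>\<^sub>m C = density (\<mu> \<Otimes>\<^sub>M \<nu>) (\<lambda>z. ennreal (indicator (prod.swap -` F_set) z * (G (fst z) * H (snd z))))"
      by (rule kellerer_component_minus[OF C]) (rule that; assumption)
    note [measurable] = GH
    show ?thesis by (rule dens[OF eq MargD(2)[OF \<kappa>\<^sub>m(1)[OF C]] X]) measurable
  qed
  have "X \<in> null_sets \<pi>" using ac X by (auto simp: absolutely_continuous_def)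
  then have "emeasure \<pi> X = 0" by (simp add: null_sets_def)
  then have "emeasure \<pi> (diag_region \<mu> \<nu> \<inter> X) = 0"
    using emeasure_mono[of "diag_region \<mu> \<nu> \<inter> X" X \<pi>] Xb by simp
  then have "emeasure (kellerer_plan \<mu> \<nu>) X = 0"
    unfolding emeasure_kellerer_plan[OF Xb] using p m by (simp add: nn_integral_count_space_zero)
  then show "X \<in> null_sets (kellerer_plan \<mu> \<nu>)" using Xb by auto
qed

text \<open>The shifted integrand is used as a density, so the inequality can be shown on each
  region separately. On the diagonal and off the support the two plans have equal densities.\<close>

lemma entropy_minimal: "Ent (kellerer_plan \<mu> \<nu>) (\<mu> \<Otimes>\<^sub>M \<nu>) \<le> Ent \<pi> (\<mu> \<Otimes>\<^sub>M \<nu>)"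
proof (cases "absolutely_continuous (\<mu> \<Otimes>\<^sub>M \<nu>) \<pi>")
  case ac: True
  let ?\<rho> = "\<mu> \<Otimes>\<^sub>M \<nu>" and ?K = "kellerer_plan \<mu> \<nu>"
  have sr: "sets ?\<rho> = sets borel" by (rule prod_sets[OF fb])
  have fin\<rho>: "finite_measure ?\<rho>"
    by (rule finite_measure_pair_measure) (rule \<mu>.finite_measure_axioms \<nu>.finite_measure_axioms)+
  interpret \<rho>: finite_measure ?\<rho> by (rule fin\<rho>)
  note acK = kellerer_plan_ac[OF ac]
  define f where "f z = enn2real (RN_deriv ?\<rho> \<pi> z)" for z
  define k where "k z = enn2real (RN_deriv ?\<rho> ?K z)" for z
  have fm [measurable]: "f \<in> borel_measurable ?\<rho>" "k \<in> borel_measurable ?\<rho>"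
    unfolding f_def[abs_def] k_def[abs_def] by measurable
  have f0: "0 \<le> f z" "0 \<le> k z" for z by (auto simp: f_def k_def)
  have \<pi>: "\<pi> = density ?\<rho> (\<lambda>z. ennreal (f z))"
    unfolding f_def by (rule density_real_RN_deriv[OF fin\<rho> \<pi>.finite_measure_axioms ac]) (simp add: sr)
  have K: "?K = density ?\<rho> (\<lambda>z. ennreal (k z))"
    unfolding k_def by (rule density_real_RN_deriv[OF fin\<rho> MargD(1)[OF kellerer_plan_Marg] acK]) (simp add: sr)
  define \<phi> where "\<phi> h z = ennreal (h z * ln (h z) + 2)" for h :: "real \<times> real \<Rightarrow> real" and z
  have \<phi>m [measurable]: "\<phi> h \<in> borel_measurable ?\<rho>" if [measurable]: "h \<in> borel_measurable ?\<rho>" for h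
    unfolding \<phi>_def[abs_def] by measurable
  have em: "emeasure (density ?\<rho> (\<phi> h)) R = (\<integral>\<^sup>+z. ennreal (h z * ln (h z) + 2) * indicator R z \<partial>?\<rho>)"
    if "h \<in> borel_measurable ?\<rho>" "R \<in> sets borel" for h R
    using that sr by (subst emeasure_density) (auto simp: \<phi>_def)
  have F': "prod.swap -` F_set \<in> sets borel"
    using measurable_sets[OF swap_measurable F_set_borel] by simp
  have mm: "fst \<in> measurable ?\<rho> borel" "snd \<in> measurable ?\<rho> borel"
    unfolding measurable_cong_sets[OF sr refl] borel_prod[symmetric] by auto
  have region: "emeasure (density ?\<rho> (\<phi> k)) R \<le> emeasure (density ?\<rho> (\<phi> f)) R"
    if R: "R \<in> sets borel" and \<kappa>: "\<And>A. A \<in> sets borel \<Longrightarrow> emeasure ?K (R \<inter> A) = emeasure \<kappa> A"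
      and Marg': "\<kappa> \<in> Marg \<gamma>\<^sub>1 \<gamma>\<^sub>2" "restr \<pi> R \<in> Marg \<gamma>\<^sub>1 \<gamma>\<^sub>2"
      and GH: "G \<in> borel_measurable borel" "H \<in> borel_measurable borel" "\<And>x. 0 \<le> G x" "\<And>y. 0 \<le> H y"
      and S: "S \<in> sets borel" "R \<subseteq> S"
      and eq: "\<kappa> = density ?\<rho> (\<lambda>z. ennreal (indicator S z * (G (fst z) * H (snd z))))"
    for R S :: "(real \<times> real) set" and \<kappa> \<gamma>\<^sub>1 \<gamma>\<^sub>2 G H
  proof -
    have R' [measurable]: "R \<in> sets ?\<rho>" using R sr by simp
    have [measurable]: "S \<in> sets ?\<rho>" using S sr by simp
    note [measurable] = GH(1,2) mm
    define l where "l z = indicator S z * (G (fst z) * H (snd z))" for z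
    have lm: "l \<in> borel_measurable ?\<rho>" unfolding l_def[abs_def] by measurable
    have l0: "0 \<le> l z" for z using GH(3,4) by (simp add: l_def)
    \<comment> \<open>Two densities of one measure agree almost everywhere, which identifies the
      Radon-Nikodym derivative of the whole plan on \<open>R\<close> with the product form.\<close>
    have "restr ?K R = \<kappa>"
      by (rule measure_eqI) (use R MargD(2)[OF Marg'(1)] in \<open>auto simp: emeasure_restr \<kappa>\<close>)
    then have "density ?\<rho> (\<lambda>z. ennreal (indicator R z * k z)) = density ?\<rho> (\<lambda>z. ennreal (l z))"
      using restr_density[OF fm(2) f0(2) R'] eq K by (simp add: l_def[abs_def])
    then have "AE z in ?\<rho>. ennreal (indicator R z * k z) = ennreal (l z)"
      by (intro \<rho>.density_unique) (use lm in auto)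
    then have kl: "AE z in ?\<rho>. indicator R z * k z = l z"
      by eventually_elim (use f0 l0 in \<open>auto simp: indicator_def split: if_splits\<close>)
    have "shifted_entropy ?\<rho> (\<lambda>z. indicator R z * k z) = shifted_entropy ?\<rho> l"
      unfolding shifted_entropy_def by (rule nn_integral_cong_AE) (use kl in \<open>auto elim!: eventually_mono\<close>)
    also have "\<dots> \<le> shifted_entropy ?\<rho> (\<lambda>z. indicator R z * f z)"
      unfolding shifted_entropy_def
    proof (rule entropy_le_of_product[OF fin\<rho> sr Marg'(2,1) GH S(1)])
      show "l z = indicator S z * (G (fst z) * H (snd z))" for z by (simp add: l_def)
      show "\<kappa> = density ?\<rho> (\<lambda>z. ennreal (l z))" using eq by (simp add: l_def[abs_def])
      show "(\<lambda>z. indicator R z * f z) \<in> borel_measurable ?\<rho>" by measurable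
      show "restr \<pi> R = density ?\<rho> (\<lambda>z. ennreal (indicator R z * f z))"
        using restr_density[OF fm(1) f0(1) R'] \<pi> by simp
      show "AE z in restr \<pi> R. z \<in> S" using R S(2) by (subst AE_restr_iff) auto
    qed (use f0 in auto)
    finally have le: "emeasure (density ?\<rho> (\<phi> k)) R + 2 * emeasure ?\<rho> (space ?\<rho> - R)
        \<le> emeasure (density ?\<rho> (\<phi> f)) R + 2 * emeasure ?\<rho> (space ?\<rho> - R)"
      unfolding nn_integral_shifted_indicator[OF fm(1) R'] nn_integral_shifted_indicator[OF fm(2) R']
        em[OF fm(1) R] em[OF fm(2) R] .
    \<comment> \<open>Finiteness of the product measure allows the common term to be
      cancelled.\<close>
    have "2 * emeasure ?\<rho> (space ?\<rho> - R) \<noteq> \<top>"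
      by (simp add: ennreal_mult_eq_top_iff)
    then show ?thesis using le by (simp add: ennreal_add_left_cancel_le add.commute)
  qed
  have same: "emeasure (density ?\<rho> (\<phi> k)) R = emeasure (density ?\<rho> (\<phi> f)) R"
    if R: "R \<in> sets borel" and eq: "\<And>A. A \<in> sets borel \<Longrightarrow> emeasure ?K (R \<inter> A) = emeasure \<pi> (R \<inter> A)" for R
  proof -
    have R' [measurable]: "R \<in> sets ?\<rho>" using R sr by simp
    have "restr ?K R = restr \<pi> R"
      by (rule measure_eqI) (use R in \<open>auto simp: emeasure_restr eq\<close>)
    then have "density ?\<rho> (\<lambda>z. ennreal (indicator R z * k z)) = density ?\<rho> (\<lambda>z. ennreal (indicator R z * f z))"
      using restr_density[OF fm(2) f0(2) R'] restr_density[OF fm(1) f0(1) R'] K \<pi> by simp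
    then have "AE z in ?\<rho>. ennreal (indicator R z * k z) = ennreal (indicator R z * f z)"
      by (intro \<rho>.density_unique) auto
    then have "AE z in ?\<rho>. z \<in> R \<longrightarrow> k z = f z"
      by eventually_elim (use f0 in \<open>auto simp: indicator_def split: if_splits\<close>)
    then show ?thesis
      unfolding em[OF fm(1) R] em[OF fm(2) R]
      by (intro nn_integral_cong_AE) (auto elim!: eventually_mono simp: indicator_def)
  qed
  let ?U = "plan_support \<mu> \<nu>"
  have U: "?U \<in> sets borel" by (rule plan_support_measurable[OF fb])
  have "emeasure (density ?\<rho> (\<phi> k)) ?U \<le> emeasure (density ?\<rho> (\<phi> f)) ?U"
  proof -
    have plus: "emeasure (density ?\<rho> (\<phi> k)) (plus_region C) \<le> emeasure (density ?\<rho> (\<phi> f)) (plus_region C)"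
      if C: "C \<in> components (E_plus \<mu> \<nu>)" for C
    proof -
      obtain G H where GH: "G \<in> borel_measurable borel" "H \<in> borel_measurable borel" "\<And>x. 0 \<le> G x" "\<And>y. 0 \<le> H y"
        and eq: "\<kappa>\<^sub>p C = density ?\<rho> (\<lambda>z. ennreal (indicator F_set z * (G (fst z) * H (snd z))))"
        by (rule kellerer_component[OF C]) (rule that; assumption)
      show ?thesis
        by (rule region[OF plus_region_measurable emeasure_kellerer_plan_plus[OF C] \<kappa>\<^sub>p(1)[OF C]
            restr_plus_region_Marg[OF C] GH F_set_borel _ eq]) (auto simp: plus_region_def F_set_def)
    qed
    have minus: "emeasure (density ?\<rho> (\<phi> k)) (minus_region C) \<le> emeasure (density ?\<rho> (\<phi> f)) (minus_region C)"
      if C: "C \<in> components (E_minus \<mu> \<nu>)" for C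
    proof -
      obtain G H where GH: "G \<in> borel_measurable borel" "H \<in> borel_measurable borel" "\<And>x. 0 \<le> G x" "\<And>y. 0 \<le> H y"
        and eq: "\<kappa>\<^sub>m C = density ?\<rho> (\<lambda>z. ennreal (indicator (prod.swap -` F_set) z * (G (fst z) * H (snd z))))"
        by (rule kellerer_component_minus[OF C]) (rule that; assumption)
      have M: "restr \<pi> (minus_region C) \<in> Marg (mu_minus \<mu> \<nu> C) (nu_minus \<mu> \<nu> C)"
      proof (rule MargI)
        show "finite_measure (restr \<pi> (minus_region C))"
          by (rule finite_measure_restr) (auto intro: \<pi>.finite_measure_axioms)
      qed (auto simp: emeasure_restr emeasure_minus_region[OF C] cylinder_sets mu_minus_def nu_minus_def)
      show ?thesis
        by (rule region[OF minus_region_measurable emeasure_kellerer_plan_minus[OF C] \<kappa>\<^sub>m(1)[OF C] M GH F' _ eq])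
          (auto simp: minus_region_def plus_region_def F_set_def)
    qed
    have diag: "emeasure (density ?\<rho> (\<phi> k)) (diag_region \<mu> \<nu>) = emeasure (density ?\<rho> (\<phi> f)) (diag_region \<mu> \<nu>)"
      by (rule same[OF diag_region_measurable[OF fb] emeasure_kellerer_plan_diag])
    have sd: "sets (density ?\<rho> (\<phi> k)) = sets borel" "sets (density ?\<rho> (\<phi> f)) = sets borel"
      using sr by auto
    show ?thesis
      unfolding emeasure_plan_support[OF fb sd(1), of UNIV, simplified]
        emeasure_plan_support[OF fb sd(2), of UNIV, simplified]
      by (intro add_mono nn_integral_mono) (simp_all add: plus minus diag)
  qed
  moreover have "emeasure (density ?\<rho> (\<phi> k)) (- ?U) = emeasure (density ?\<rho> (\<phi> f)) (- ?U)"
  proof (rule same)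
    fix A :: "(real \<times> real) set" assume A: "A \<in> sets borel"
    have "emeasure ?K (- ?U \<inter> A) = 0"
      using A U by (intro emeasure_null_outside[OF kellerer_plan_support]) auto
    moreover have "emeasure \<pi> (- ?U \<inter> A) = 0"
      using A U by (intro emeasure_null_outside[OF AE_plan_support]) auto
    ultimately show "emeasure ?K (- ?U \<inter> A) = emeasure \<pi> (- ?U \<inter> A)" by simp
  qed (use U in auto)
  moreover have "shifted_entropy ?\<rho> h = emeasure (density ?\<rho> (\<phi> h)) ?U + emeasure (density ?\<rho> (\<phi> h)) (- ?U)"
    if h: "h \<in> borel_measurable ?\<rho>" for h
  proof -
    have "shifted_entropy ?\<rho> h = emeasure (density ?\<rho> (\<phi> h)) UNIV"
      unfolding shifted_entropy_def by (subst em[OF h]) auto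
    also have "UNIV = ?U \<union> - ?U" by simp
    also have "emeasure (density ?\<rho> (\<phi> h)) \<dots> = emeasure (density ?\<rho> (\<phi> h)) ?U + emeasure (density ?\<rho> (\<phi> h)) (- ?U)"
      by (rule plus_emeasure[symmetric]) (use U sr in auto)
    finally show ?thesis .
  qed
  ultimately have "shifted_entropy ?\<rho> k \<le> shifted_entropy ?\<rho> f"
    using fm by (simp add: add_right_mono)
  then have "enn2ereal (shifted_entropy ?\<rho> k) \<le> enn2ereal (shifted_entropy ?\<rho> f)"
    by (simp add: less_eq_ennreal.rep_eq)
  then show ?thesis
    unfolding Ent_eq_shifted[OF fin\<rho> ac] Ent_eq_shifted[OF fin\<rho> acK] f_def[symmetric] k_def[symmetric]
    by (rule ereal_minus_mono) simp
qed (simp add: Ent_def)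

end

theorem theorem3p6:
  fixes \<mu> \<nu> :: "real measure"
  assumes "finite_borel_measure \<mu>" and "finite_borel_measure \<nu>"
    and "measure \<mu> UNIV = measure \<nu> UNIV" and "measure \<mu> UNIV > 0"
  shows "kellerer_plan \<mu> \<nu> \<in> cyc_mono_plans \<mu> \<nu> \<and>
    Ent (kellerer_plan \<mu> \<nu>) (\<mu> \<Otimes>\<^sub>M \<nu>) = (INF \<pi> \<in> cyc_mono_plans \<mu> \<nu>. Ent \<pi> (\<mu> \<Otimes>\<^sub>M \<nu>)) \<and>
    (\<forall>\<pi> \<in> cyc_mono_plans \<mu> \<nu>. Ent \<pi> (\<mu> \<Otimes>\<^sub>M \<nu>) > -\<infinity>)"
proof -
  \<comment> \<open>The quantile coupling serves to place the Kellerer plan among the competitors;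
    in the inequality each competitor is its own reference plan.\<close>
  obtain \<pi> \<Gamma> where "noncrossing_plan \<mu> \<nu> \<pi> \<Gamma>"
    using quantile_plan_exists[OF assms] by blast
  then interpret noncrossing_plan \<mu> \<nu> \<pi> \<Gamma> .
  have "finite_measure (\<mu> \<Otimes>\<^sub>M \<nu>)"
    by (rule finite_measure_pair_measure) (rule \<mu>.finite_measure_axioms \<nu>.finite_measure_axioms)+
  moreover have "Ent (kellerer_plan \<mu> \<nu>) (\<mu> \<Otimes>\<^sub>M \<nu>) \<le> Ent \<pi>' (\<mu> \<Otimes>\<^sub>M \<nu>)" if \<pi>': "\<pi>' \<in> cyc_mono_plans \<mu> \<nu>" for \<pi>'
  proof -
    obtain \<Gamma>' where "cyclically_monotone \<Gamma>'" "AE z in \<pi>'. z \<in> \<Gamma>'" "\<pi>' \<in> Marg \<mu> \<nu>"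
      using \<pi>' unfolding cyc_mono_plans_def by blast
    then have "noncrossing_plan \<mu> \<nu> \<pi>' \<Gamma>'"
      using cyclically_monotone_imp_noncrossing by (simp add: noncrossing_plan_def)
    then show ?thesis by (rule noncrossing_plan.entropy_minimal)
  qed
  ultimately show ?thesis
    using kellerer_plan_cyc_mono Ent_gt_MInfty
    by (auto intro!: antisym INF_lower INF_greatest)
qed

end
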